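(* Let $\lambda\in\mathbb{R}$ be an algebraic number of degree $d$ with minimal polynomial $p(x)=a_dx^d+\cdots+a_0\in\mathbb{Z}[x]$, where $a_0,\dots,a_d$ have no common prime factor. Then there are constants $D>0$ and $\sigma>0$ such that $$|A+\lambda\cdot A|\geq \left(|a_d|^{1/d}+|a_0|^{1/d}\right)^d|A|-D|A|^{1-\sigma}$$ holds for all finite subsets $A$ of $\mathbb{R}$.
   Context: For a set $A$ and scalar $\lambda$, $\lambda\cdot A=\{\lambda a:a\in A\}$ and $A+\lambda\cdot A=\{a+\lambda b: a,b\in A\}$. *)

theory Defs
  imports Complex_Main "HOL-Computational_Algebra.Polynomial"
begin

definition sum_dil :: "real set \<Rightarrow> real \<Rightarrow> real set" where
  "sum_dil A l = {a + l * b | a b. a \<in> A \<and> b \<in> A}"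

definition is_int_min_poly :: "int poly \<Rightarrow> real \<Rightarrow> bool" where
  "is_int_min_poly p x \<longleftrightarrow>
     p \<noteq> 0 \<and> poly (map_poly real_of_int p) x = 0 \<and>
     (\<forall>q::int poly. q \<noteq> 0 \<and> poly (map_poly real_of_int q) x = 0 \<longrightarrow> degree p \<le> degree q) \<and>
     (\<forall>r::int. prime r \<longrightarrow> \<not> (\<forall>i. r dvd coeff p i))"

end

theory Submission
  imports Defs "HOL-Analysis.Analysis" "HOL-Library.Set_Algebras"
    "HOL-Computational_Algebra.Polynomial_Factorial" "HOL-Computational_Algebra.Group_Closure"
begin

text \<open>
  A generic \<open>\<rat>(\<lambda>)\<close>-linear map reduces to sets \<open>A\<close> in the field \<open>K = \<rat>(\<lambda>)\<close>.  Let \<open>H\<close> be the claimed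
  constant and take a counterexample \<open>A\<close> of least size.  For a group \<open>\<Gamma>\<close> containing \<open>A - A\<close>, the classes
  \<open>P\<close> of \<open>A\<close> under \<open>\<lambda>(x - y) \<in> \<Gamma>\<close> and \<open>Q\<close> under \<open>(x - y)/\<lambda> \<in> \<Gamma>\<close> give pairwise disjoint sets
  \<open>Q + \<lambda>P\<close>; by minimality each of them is hardly larger than \<open>(P \<inter> Q) + \<lambda>(P \<inter> Q)\<close>, up to a small
  multiple of the error term.  If \<open>\<Gamma>\<close> is generated by \<open>A - A\<close>, this rigidity forces \<open>B = P \<inter> Q\<close> to meet
  every class of the next level, of which there are at least \<open>|a\<^sub>d|\<close> and \<open>|a\<^sub>0|\<close>.  For the pieces of \<open>B\<close>
  a discrete Brunn-Minkowski inequality contradicts the same rigidity: summing it over the classes at a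
  class \<open>P\<close> of least size and at a class \<open>Q\<close> of least size gives two incompatible strict inequalities.

  The Brunn-Minkowski inequality holds with a power saving because \<open>A + \<lambda>A\<close> is covered by few lines in
  each of \<open>d\<close> independent directions \<open>e, \<lambda>e, \<dots>, \<lambda>\<^sup>d\<^sup>-\<^sup>1e\<close>: small sumset and a pigeonhole argument yield \<open>e\<close>
  with \<open>2\<^sup>i e \<in> 2A - 2A\<close> for all \<open>i \<le> c log |A|\<close>, and a set of \<open>k\<close> integers has at most \<open>k log k\<close> pairs
  differing by a power of two, so \<open>3A - 3A\<close> has many points on some line in direction \<open>e\<close>.
\<close>

section \<open>Sumsets\<close>

text \<open>What makes the induction close is the subtracted term M = D|A|^(1-\<sigma>). Splitting a
  set into at most 4H^2 pieces raises the sum of these terms by a factor of at most (4H^2)^\<sigma>,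
  as near to 1 as desired for small \<sigma>. Two levels of splitting and the Brunn-Minkowski error
  together thus cost a tiny multiple of M, while every piece of the second level keeps a fixed
  proportion of A and so an error term of its own comparable to M. This surplus turns approximate
  inequalities into strict ones. Two levels are forced because the coefficients control the index of
  a subgroup in the group generated by A - A, not the number of its cosets that A meets: A may miss
  some of them. Near-extremality repairs this one level down. Replacing l by 1/l and p by its
  reflection exchanges the leading and the constant coefficient, so the index bound and the rigidity
  argument are each proved for one side only.\<close>

lemma card_le_card_set_plus:
  fixes X Y :: "'a::ab_group_add set"
  assumes "finite X" "finite Y" "Y \<noteq> {}"
  shows "card X \<le> card (X + Y)"
proof -
  obtain y where y: "y \<in> Y" using assms(3) by auto
  have "(\<lambda>x. x + y) ` X \<subseteq> X + Y" using y by auto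
  then have "card ((\<lambda>x. x + y) ` X) \<le> card (X + Y)"
    using assms by (intro card_mono finite_set_plus)
  then show ?thesis by (simp add: card_image inj_on_def)
qed

text \<open>Induction on \<open>C\<close>. Adding \<open>c\<close> adds to \<open>X + A + C\<close>
  at most |X + A| - |Z + A| points, as Z + A + c is already present. It adds to \<open>X + C\<close>
  the translate of X - W, hence at least |X| - |Z| points because \<open>W\<close> is contained in
  \<open>Z\<close>. Minimality of the ratio, applied to \<open>Z\<close>, compares the two
  gains.\<close>

lemma petridis:
  fixes X A C :: "'a::ab_group_add set" and q :: real
  assumes fin: "finite X" "finite A" "finite C"
    and q0: "0 \<le> q" and q: "real (card (X + A)) = q * real (card X)"
    and min: "\<And>Z. Z \<subseteq> X \<Longrightarrow> q * real (card Z) \<le> real (card (Z + A))"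
  shows "real (card (X + A + C)) \<le> q * real (card (X + C))"
  using fin(3)
proof (induction C rule: finite_induct)
  case empty
  show ?case by simp
next
  case (insert c C)
  define Z where "Z = {x \<in> X. \<forall>a\<in>A. x + a + c \<in> X + A + C}"
  define W where "W = {x \<in> X. x + c \<in> X + C}"
  have WZ: "W \<subseteq> Z"
  proof
    fix x assume x: "x \<in> W"
    have "x + a + c \<in> X + A + C" if "a \<in> A" for a
    proof -
      from x obtain x' c' where "x + c = x' + c'" "x' \<in> X" "c' \<in> C"
        unfolding W_def by (auto elim: set_plus_elim)
      then have "x + a + c = (x' + a) + c'" by (metis add.assoc add.commute)
      also have "\<dots> \<in> X + A + C"
        using \<open>x' \<in> X\<close> \<open>c' \<in> C\<close> that by (intro set_plus_intro)
      finally show ?thesis .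
    qed
    with x show "x \<in> Z" by (auto simp: W_def Z_def)
  qed
  have ZX: "Z \<subseteq> X" by (auto simp: Z_def)
  have inj: "inj_on (\<lambda>x. x + c) S" for S by (simp add: inj_on_def)
  have finC: "finite (X + A + C)" "finite (X + C)" "finite (X + A)"
    using fin insert.hyps by (auto intro: finite_set_plus)
  have sub: "X + A + insert c C \<subseteq> (X + A + C) \<union> (\<lambda>x. x + c) ` ((X + A) - (Z + A))"
  proof
    fix t assume "t \<in> X + A + insert c C"
    then obtain u c' where u: "t = u + c'" "u \<in> X + A" "c' \<in> insert c C"
      by (auto elim: set_plus_elim)
    show "t \<in> (X + A + C) \<union> (\<lambda>x. x + c) ` ((X + A) - (Z + A))"
    proof (cases "c' \<in> C")
      case True
      with u show ?thesis by auto
    next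
      case False
      with u have t: "t = u + c" by auto
      show ?thesis
      proof (cases "u \<in> Z + A")
        case True
        then obtain z a where "u = z + a" "z \<in> Z" "a \<in> A" by (auto elim: set_plus_elim)
        then have "t \<in> X + A + C" using t unfolding Z_def by auto
        then show ?thesis by auto
      next
        case False
        with u t show ?thesis by auto
      qed
    qed
  qed
  have ZA: "Z + A \<subseteq> X + A" using ZX by (auto simp: set_plus_def)
  have "card (X + A + insert c C) \<le> card ((X + A + C) \<union> (\<lambda>x. x + c) ` ((X + A) - (Z + A)))"
    using sub finC by (intro card_mono) auto
  also have "\<dots> \<le> card (X + A + C) + card ((\<lambda>x. x + c) ` ((X + A) - (Z + A)))"
    by (rule card_Un_le)
  also have "card ((\<lambda>x. x + c) ` ((X + A) - (Z + A))) = card (X + A) - card (Z + A)"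
    using ZA finC by (simp add: card_image[OF inj] card_Diff_subset finite_subset)
  finally have 1: "real (card (X + A + insert c C)) \<le> real (card (X + A + C)) + (real (card (X + A)) - real (card (Z + A)))"
    using card_mono[OF finC(3) ZA] by linarith
  have "(X + C) \<union> (\<lambda>x. x + c) ` (X - W) \<subseteq> X + insert c C" by (auto simp: set_plus_def)
  moreover have "(X + C) \<inter> (\<lambda>x. x + c) ` (X - W) = {}" by (auto simp: W_def)
  moreover have "finite (X + insert c C)" using fin insert.hyps by (auto intro!: finite_set_plus)
  ultimately have "card (X + C) + card ((\<lambda>x. x + c) ` (X - W)) \<le> card (X + insert c C)"
    using finC fin by (subst card_Un_disjoint[symmetric]) (auto intro: card_mono)
  moreover have "card ((\<lambda>x. x + c) ` (X - W)) = card X - card W"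
    using WZ ZX fin by (simp add: card_image[OF inj] card_Diff_subset finite_subset)
  moreover have "card W \<le> card Z" "card Z \<le> card X"
    using WZ ZX fin by (auto intro: card_mono finite_subset)
  ultimately have 2: "real (card (X + C)) + (real (card X) - real (card Z)) \<le> real (card (X + insert c C))"
    by linarith
  have "q * (real (card (X + C)) + (real (card X) - real (card Z))) \<le> q * real (card (X + insert c C))"
    using 2 q0 by (rule mult_left_mono)
  with 1 insert.IH min[OF ZX] q show ?case by (simp add: algebra_simps)
qed

text \<open>Once a representation w = u - v is fixed for every difference, (w, x) -> (u + x, v + x)
  is injective: the difference of the two coordinates recovers w, and then x is determined.\<close>

lemma ruzsa_triangle:
  fixes U V X :: "'a::ab_group_add set"
  assumes "finite U" "finite V" "finite X"
  shows "card (U + uminus ` V) * card X \<le> card (U + X) * card (V + X)"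
proof -
  define f where "f = (\<lambda>w. SOME p. p \<in> U \<times> V \<and> w = fst p - snd p)"
  have f: "f w \<in> U \<times> V \<and> w = fst (f w) - snd (f w)" if "w \<in> U + uminus ` V" for w
  proof -
    have "\<exists>p. p \<in> U \<times> V \<and> w = fst p - snd p"
      using that by (auto elim!: set_plus_elim)
    then show ?thesis unfolding f_def by (rule someI_ex)
  qed
  define h where "h = (\<lambda>(w, x). (fst (f w) + x, snd (f w) + x))"
  have "inj_on h ((U + uminus ` V) \<times> X)"
  proof (rule inj_onI, clarify)
    fix w x w' x' assume *: "w \<in> U + uminus ` V" "x \<in> X" "w' \<in> U + uminus ` V" "x' \<in> X" "h (w, x) = h (w', x')"
    then have e: "fst (f w) + x = fst (f w') + x'" "snd (f w) + x = snd (f w') + x'" by (auto simp: h_def)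
    have "w = w'" using e f[OF *(1)] f[OF *(3)] by (metis add_diff_cancel_right)
    with e show "w = w' \<and> x = x'" by auto
  qed
  moreover have "h ` ((U + uminus ` V) \<times> X) \<subseteq> (U + X) \<times> (V + X)"
    using f by (fastforce simp: h_def)
  ultimately have "card ((U + uminus ` V) \<times> X) \<le> card ((U + X) \<times> (V + X))"
    using assms by (intro card_inj_on_le[of h]) (auto intro: finite_set_plus)
  then show ?thesis by (simp add: card_cartesian_product)
qed

text \<open>Take a largest subset of \<open>Y\<close> whose translates of \<open>A\<close> are
  disjoint. Disjointness bounds its size, and by maximality the translate of \<open>A\<close> by any
  y in \<open>Y\<close> meets one of them.\<close>

lemma ruzsa_covering:
  fixes Y A :: "'a::ab_group_add set"
  assumes "finite Y" "finite A" "A \<noteq> {}"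
  obtains X where "X \<subseteq> Y" "card X * card A \<le> card (Y + A)" "Y \<subseteq> X + (A + uminus ` A)"
proof -
  define P where "P = (\<lambda>X. X \<subseteq> Y \<and> (\<forall>x\<in>X. \<forall>x'\<in>X. x \<noteq> x' \<longrightarrow> (+) x ` A \<inter> (+) x' ` A = {}))"
  have P0: "P {}" by (simp add: P_def)
  have Pc: "\<forall>X. P X \<longrightarrow> card X < Suc (card Y)"
    unfolding P_def less_Suc_eq_le using assms(1) by (auto intro: card_mono)
  obtain X where X: "P X" and max: "\<forall>X'. P X' \<longrightarrow> card X' \<le> card X"
    using Lattices_Big.ex_has_greatest_nat[OF P0 Pc] by (elim exE conjE)
  have finX: "finite X" using X assms(1) unfolding P_def by (auto intro: finite_subset)
  have "card (\<Union>x\<in>X. (+) x ` A) = (\<Sum>x\<in>X. card ((+) x ` A))"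
    using X finX assms by (intro card_UN_disjoint) (auto simp: P_def)
  also have "\<dots> = card X * card A" by (simp add: card_image)
  finally have c: "card (\<Union>x\<in>X. (+) x ` A) = card X * card A" .
  have "(\<Union>x\<in>X. (+) x ` A) \<subseteq> Y + A" using X by (auto simp: P_def)
  then have 1: "card X * card A \<le> card (Y + A)"
    using assms unfolding c[symmetric] by (intro card_mono finite_set_plus)
  have 2: "Y \<subseteq> X + (A + uminus ` A)"
  proof
    fix y assume y: "y \<in> Y"
    have "\<exists>x\<in>X. (+) y ` A \<inter> (+) x ` A \<noteq> {}"
    proof (cases "y \<in> X")
      case True
      with assms(3) show ?thesis by auto
    next
      case False
      show ?thesis
      proof (rule ccontr)
        assume n: "\<not> ?thesis"
        have "P (insert y X)" using X y n unfolding P_def by blast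
        with max have "card (insert y X) \<le> card X" by blast
        with False finX show False by simp
      qed
    qed
    then obtain x a a' where x: "x \<in> X" "a \<in> A" "a' \<in> A" "y + a = x + a'" by auto
    have "y = (y + a) - a" by simp
    also have "\<dots> = x + (a' + - a)" unfolding x(4) by (simp add: algebra_simps)
    also have "\<dots> \<in> X + (A + uminus ` A)" using x by (intro set_plus_intro imageI)
    finally show "y \<in> X + (A + uminus ` A)" .
  qed
  have "X \<subseteq> Y" using X unfolding P_def by (rule conjunct1)
  then show thesis using 1 2 by (rule that)
qed

section \<open>Iterated sumsets and Pluennecke's inequality\<close>

fun iterated_sum :: "nat \<Rightarrow> 'a::comm_monoid_add set \<Rightarrow> 'a set" where
  "iterated_sum 0 A = {0}"
| "iterated_sum (Suc h) A = A + iterated_sum h A"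

lemma finite_iterated_sum [simp]: "finite A \<Longrightarrow> finite (iterated_sum h A)"
  by (induction h) (auto intro: finite_set_plus)

lemma iterated_sum_add: "iterated_sum (h + k) A = iterated_sum h A + iterated_sum k A"
  by (induction h) (auto simp: add.assoc)

lemma iterated_sum_plus: "iterated_sum h (A + B) = iterated_sum h A + iterated_sum h B"
  by (induction h) (simp_all add: ac_simps)

lemma iterated_sum_uminus:
  "iterated_sum h (uminus ` A) = uminus ` iterated_sum h (A :: 'a::ab_group_add set)"
proof (induction h)
  case (Suc h)
  have "uminus ` A + uminus ` B = uminus ` (A + B)" for B :: "'a set"
    by (force simp: set_plus_def image_iff)
  with Suc show ?case by simp
qed simp

text \<open>Minimising |X + A| / |X| over the nonempty subsets \<open>X\<close> of \<open>Y\<close>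
  makes Petridis's lemma iterable, giving |X + hA| \<le> K^h |X|; the triangle inequality through
  \<open>X\<close> then passes to differences. The reference set \<open>Y\<close> is kept apart from
  \<open>A\<close> because the case wanted is Y = l A.\<close>

lemma plunnecke:
  fixes A Y :: "'a::ab_group_add set" and K :: real
  assumes fin: "finite A" "finite Y" and ne: "Y \<noteq> {}"
    and K: "real (card (Y + A)) \<le> K * real (card Y)"
  shows "real (card (iterated_sum h (A + uminus ` A))) \<le> K ^ (2 * h) * real (card Y)"
proof -
  define r where "r = (\<lambda>X. real (card (X + A)) / real (card X))"
  have "finite {X. X \<subseteq> Y \<and> X \<noteq> {}}" using fin by simp
  moreover have "{X. X \<subseteq> Y \<and> X \<noteq> {}} \<noteq> {}" using ne by auto
  ultimately obtain X where "is_arg_min r (\<lambda>X. X \<in> {X. X \<subseteq> Y \<and> X \<noteq> {}}) X"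
    using ex_is_arg_min_if_finite by blast
  then have X: "X \<subseteq> Y" "X \<noteq> {}" and min: "\<And>Z. Z \<subseteq> Y \<Longrightarrow> Z \<noteq> {} \<Longrightarrow> r X \<le> r Z"
    by (auto simp: is_arg_min_linorder)
  have finX: "finite X" using X fin by (auto intro: finite_subset)
  then have cX: "card X > 0" using X by (simp add: card_gt_0_iff)
  have cY: "card Y > 0" using ne fin by (simp add: card_gt_0_iff)
  have "r X \<le> r Y" using min ne by blast
  also have "\<dots> \<le> K" using K cY by (simp add: r_def divide_simps mult.commute)
  finally have rK: "r X \<le> K" .
  have r0: "0 \<le> r X" by (simp add: r_def)
  have pet: "real (card (X + A + C)) \<le> r X * real (card (X + C))" if "finite C" for C
  proof (rule petridis)
    show "0 \<le> r X" by (rule r0)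
    show "real (card (X + A)) = r X * real (card X)" using cX by (simp add: r_def)
    fix Z assume Z: "Z \<subseteq> X"
    show "r X * real (card Z) \<le> real (card (Z + A))"
    proof (cases "Z = {}")
      case False
      then have "card Z > 0" using Z finX by (auto simp: card_gt_0_iff intro: finite_subset)
      moreover have "r X \<le> r Z" using min False Z X by blast
      ultimately have "r X * real (card Z) \<le> r Z * real (card Z)" by (intro mult_right_mono) auto
      with \<open>card Z > 0\<close> show ?thesis by (simp add: r_def)
    qed simp
  qed (use that finX fin in auto)
  have it: "real (card (X + iterated_sum h A)) \<le> K ^ h * real (card X)" for h
  proof (induction h)
    case (Suc h)
    have "real (card (X + iterated_sum (Suc h) A)) = real (card (X + A + iterated_sum h A))"
      by (simp add: add.assoc)
    also have "\<dots> \<le> r X * real (card (X + iterated_sum h A))" using fin by (intro pet) auto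
    also have "\<dots> \<le> K * (K ^ h * real (card X))"
      using Suc rK r0 by (intro mult_mono) auto
    finally show ?case by simp
  qed simp
  have "card (iterated_sum h A + uminus ` iterated_sum h A) * card X
        \<le> card (iterated_sum h A + X) * card (iterated_sum h A + X)"
    using fin finX by (intro ruzsa_triangle) auto
  then have "real (card (iterated_sum h A + uminus ` iterated_sum h A)) * real (card X)
        \<le> real (card (X + iterated_sum h A)) * real (card (X + iterated_sum h A))"
    by (metis add.commute of_nat_le_iff of_nat_mult)
  also have "\<dots> \<le> (K ^ h * real (card X)) * (K ^ h * real (card X))"
    using it[of h] by (intro mult_mono) auto
  finally have "real (card (iterated_sum h A + uminus ` iterated_sum h A)) \<le> K ^ (2 * h) * real (card X)"
    using cX by (simp add: power_mult power2_eq_square power_mult_distrib mult_2 power_add)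
  also have "\<dots> \<le> K ^ (2 * h) * real (card Y)"
    using X fin by (intro mult_left_mono) (auto intro: card_mono)
  finally show ?thesis by (simp add: iterated_sum_plus iterated_sum_uminus)
qed


section \<open>Rich lines\<close>

lemma two_powr_le_Suc:
  fixes x :: real
  assumes "0 \<le> x" "x \<le> 1"
  shows "2 powr x \<le> 1 + x"
  using Youngs_inequality_0[of x "1 - x" 2 1] assms by simp

text \<open>The surplus 2a pays for the pairs of mixed parity in the induction below. One half of it
  is a (log(a + b) - log a) \<ge> a, from b \<ge> a; the other is b log(1 + a/b) \<ge> a, from 2^x
  \<le> 1 + x on [0, 1].\<close>

lemma mult_log_superadditive:
  fixes a b :: nat
  assumes "a \<le> b"
  shows "real a * log 2 (real a) + real b * log 2 (real b) + 2 * real a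
         \<le> real (a + b) * log 2 (real (a + b))"
proof (cases "a = 0")
  case False
  with assms have pos: "real a > 0" "real b > 0" by auto
  have 1: "log 2 (real a) + 1 \<le> log 2 (real (a + b))"
  proof -
    have "log 2 (2 * real a) \<le> log 2 (real (a + b))" using pos assms by simp
    then show ?thesis using pos by (simp add: log_mult)
  qed
  have "2 powr (real a / real b) \<le> 1 + real a / real b"
    using assms pos by (intro two_powr_le_Suc) auto
  also have "\<dots> = real (a + b) / real b" using pos by (simp add: field_simps)
  finally have "real a / real b \<le> log 2 (real (a + b) / real b)"
    using pos by (subst le_log_iff) auto
  also have "\<dots> = log 2 (real (a + b)) - log 2 (real b)" using pos by (simp add: log_divide)
  finally have 2: "real a \<le> real b * (log 2 (real (a + b)) - log 2 (real b))"
    using pos by (simp add: field_simps)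
  have "real a * (log 2 (real a) + 1) \<le> real a * log 2 (real (a + b))"
    using 1 pos by (intro mult_left_mono) auto
  with 2 show ?thesis by (simp add: algebra_simps)
qed simp

definition dyadic_pairs :: "nat \<Rightarrow> int set \<Rightarrow> (int \<times> nat) set" where
  "dyadic_pairs j P = {(a, i). i < j \<and> a \<in> P \<and> a + 2 ^ i \<in> P}"

lemma finite_dyadic_pairs: "finite P \<Longrightarrow> finite (dyadic_pairs j P)"
  by (rule finite_subset[of _ "P \<times> {..<j}"]) (auto simp: dyadic_pairs_def)

text \<open>Induction on binary digits. A pair with difference 2^i, i > 0, stays within one parity
  class and is halved. Pairs with i = 0 join the two parities, and each element of the smaller class
  lies in at most two of them; this is the surplus in \<open>mult_log_superadditive\<close>.\<close>

lemma card_dyadic_pairs_le: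
  assumes "finite P"
  shows "real (card (dyadic_pairs j P)) \<le> real (card P) * log 2 (real (card P))"
  using assms
proof (induction j arbitrary: P)
  case 0
  have "0 \<le> real (card P) * log 2 (real (card P))"
    by (cases "card P = 0") (auto intro!: mult_nonneg_nonneg)
  then show ?case by (simp add: dyadic_pairs_def)
next
  case (Suc j)
  define P0 where "P0 = {x. 2 * x \<in> P}"
  define P1 where "P1 = {x. 2 * x + 1 \<in> P}"
  define E where "E = (\<lambda>x::int. 2 * x) ` P0"
  define O' where "O' = (\<lambda>x::int. 2 * x + 1) ` P1"
  have P: "P = E \<union> O'"
  proof (intro set_eqI iffI)
    fix x assume x: "x \<in> P"
    have "x = 2 * (x div 2) \<or> x = 2 * (x div 2) + 1" by presburger
    with x show "x \<in> E \<union> O'" unfolding E_def O'_def P0_def P1_def by force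
  qed (auto simp: E_def O'_def P0_def P1_def)
  have EO: "E \<inter> O' = {}" unfolding E_def O'_def by (auto; presburger)
  have fin: "finite E" "finite O'" using Suc.prems P by (auto simp: finite_Un)
  have finP: "finite P0" "finite P1"
    using fin unfolding E_def O'_def by (auto dest!: finite_imageD simp: inj_on_def)
  have cE: "card E = card P0" "card O' = card P1"
    unfolding E_def O'_def by (auto intro!: card_image simp: inj_on_def)
  have cP: "card P = card P0 + card P1"
    using card_Un_disjoint[OF fin EO] P cE by simp
  define F0 where "F0 = (\<lambda>(a, i). (2 * a, Suc i)) ` dyadic_pairs j P0"
  define F1 where "F1 = (\<lambda>(a, i). (2 * a + 1, Suc i)) ` dyadic_pairs j P1"
  define G where "G = {(a, i :: nat). i = 0 \<and> a \<in> P \<and> a + 1 \<in> P}"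
  have sub: "dyadic_pairs (Suc j) P \<subseteq> F0 \<union> F1 \<union> G"
  proof clarify
    fix a i assume ai: "(a, i) \<in> dyadic_pairs (Suc j) P" and nG: "(a, i) \<notin> G" and n1: "(a, i) \<notin> F1"
    then have a: "i < Suc j" "a \<in> P" "a + 2 ^ i \<in> P" by (auto simp: dyadic_pairs_def)
    with nG obtain i' where i: "i = Suc i'" by (cases i) (auto simp: G_def)
    have "a = 2 * (a div 2) \<or> a = 2 * (a div 2) + 1" by presburger
    then consider b where "a = 2 * b" | b where "a = 2 * b + 1" by blast
    then show "(a, i) \<in> F0"
    proof cases
      case 1
      with a i have "(b, i') \<in> dyadic_pairs j P0"
        by (auto simp: dyadic_pairs_def P0_def algebra_simps)
      with 1 i show ?thesis unfolding F0_def by force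
    next
      case 2
      with a i have "(b, i') \<in> dyadic_pairs j P1"
        by (auto simp: dyadic_pairs_def P1_def algebra_simps)
      with 2 i n1 show ?thesis unfolding F1_def by force
    qed
  qed
  have cF: "card F0 \<le> card (dyadic_pairs j P0)" "card F1 \<le> card (dyadic_pairs j P1)"
    unfolding F0_def F1_def by (auto intro!: card_image_le finite_dyadic_pairs finP)
  have finG: "finite G"
    by (rule finite_subset[of _ "P \<times> {0}"]) (use Suc.prems in \<open>auto simp: G_def\<close>)
  have G0: "card G \<le> 2 * card Q" if Q: "Q = E \<or> Q = O'" for Q
  proof -
    have fQ: "finite Q" using Q fin by auto
    have "G \<subseteq> (\<lambda>a. (a, 0)) ` Q \<union> (\<lambda>a. (a - 1, 0)) ` Q"
    proof clarify
      fix a i assume "(a, i) \<in> G" and n: "(a, i) \<notin> (\<lambda>a. (a - 1, 0)) ` Q"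
      then have a: "i = 0" "a \<in> P" "a + 1 \<in> P" by (auto simp: G_def)
      with n have "a + 1 \<notin> Q" by (force simp: image_iff)
      with a Q P have "a \<in> Q"
        unfolding E_def O'_def by (auto simp: image_iff; presburger)
      with a show "(a, i) \<in> (\<lambda>a. (a, 0)) ` Q" by auto
    qed
    then have "card G \<le> card ((\<lambda>a. (a, 0::nat)) ` Q \<union> (\<lambda>a. (a - 1, 0)) ` Q)"
      using fQ by (intro card_mono) auto
    also have "\<dots> \<le> card ((\<lambda>a. (a, 0::nat)) ` Q) + card ((\<lambda>a. (a - 1, 0::nat)) ` Q)" by (rule card_Un_le)
    also have "\<dots> \<le> card Q + card Q" by (intro add_mono card_image_le fQ)
    finally show ?thesis by simp
  qed
  have cG: "card G \<le> 2 * card P0" "card G \<le> 2 * card P1"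
    using G0[of E] G0[of O'] cE by auto
  have "card (dyadic_pairs (Suc j) P) \<le> card (F0 \<union> F1 \<union> G)"
    using sub finG finP by (intro card_mono) (auto simp: F0_def F1_def finite_dyadic_pairs)
  also have "\<dots> \<le> card F0 + card F1 + card G"
    by (meson card_Un_le add_le_mono1 le_trans)
  finally have "card (dyadic_pairs (Suc j) P) \<le> card (dyadic_pairs j P0) + card (dyadic_pairs j P1) + card G"
    using cF by linarith
  then have main: "real (card (dyadic_pairs (Suc j) P)) \<le>
      real (card P0) * log 2 (real (card P0)) + real (card P1) * log 2 (real (card P1)) + real (card G)"
    using Suc.IH[OF finP(1)] Suc.IH[OF finP(2)] by linarith
  show ?case
  proof (cases "card P0 \<le> card P1")
    case True
    from mult_log_superadditive[OF this] main cG(1) show ?thesis unfolding cP by linarith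
  next
    case False
    then have "card P1 \<le> card P0" by simp
    from mult_log_superadditive[OF this] main cG(2) show ?thesis unfolding cP by (simp add: add.commute)
  qed
qed

text \<open>Doubling acts on \<open>D\<close> up to few digits: D + D is contained in X + D with |X|
  \<le> M, so 2s = c + \<tau> s with c in \<open>X\<close> and \<tau> s again in \<open>D\<close>.
  If s and t share their first \<open>j\<close> digits, then 2^i (s - t) = \<tau>^i s - \<tau>^i t
  for i \<le> j. There are at most M^j < |D| digit strings, so such a pair exists.\<close>

lemma ex_dyadic_multiples:
  fixes A :: "real set"
  assumes fin: "finite A" and ne: "A \<noteq> {}"
    and D: "D = A + uminus ` A"
    and K: "real (card (D + D + A)) \<le> M * real (card A)"
    and j: "M ^ j < real (card A)"
  obtains e where "e \<noteq> 0" "\<And>i. i \<le> j \<Longrightarrow> 2 ^ i * e \<in> D + D"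
proof -
  have finD: "finite D" using fin unfolding D by (auto intro: finite_set_plus)
  have cA: "card A > 0" using fin ne by (simp add: card_gt_0_iff)
  have Dneg: "- x \<in> D" if "x \<in> D" for x
    using that unfolding D by (force simp: set_plus_def image_iff)
  obtain X where X: "X \<subseteq> D + D" "card X * card A \<le> card (D + D + A)" "D + D \<subseteq> X + D"
    using ruzsa_covering[of "D + D" A] finD fin ne unfolding D[symmetric]
    by (metis finite_set_plus)
  have finX: "finite X" using X finD by (meson finite_set_plus finite_subset)
  have "real (card X) * real (card A) \<le> M * real (card A)"
    using X(2) K by (metis le_trans of_nat_le_iff of_nat_mult order_trans)
  then have cX: "real (card X) \<le> M" using cA by simp
  have "\<forall>s\<in>D. \<exists>p. fst p \<in> X \<and> snd p \<in> D \<and> s + s = fst p + snd p"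
  proof
    fix s assume "s \<in> D"
    then have "s + s \<in> X + D" using X(3) by blast
    then show "\<exists>p. fst p \<in> X \<and> snd p \<in> D \<and> s + s = fst p + snd p"
      by (auto elim!: set_plus_elim)
  qed
  then obtain q where q: "\<And>s. s \<in> D \<Longrightarrow> fst (q s) \<in> X \<and> snd (q s) \<in> D \<and> s + s = fst (q s) + snd (q s)"
    by metis
  define \<tau> where "\<tau> = (\<lambda>s. snd (q s))"
  define cf where "cf = (\<lambda>s. fst (q s))"
  have \<tau>D: "(\<tau> ^^ i) s \<in> D" if "s \<in> D" for i s
    using that by (induction i) (auto simp: \<tau>_def q)
  define col where "col = (\<lambda>s. map (\<lambda>i. cf ((\<tau> ^^ i) s)) [0..<j])"
  have "col ` D \<subseteq> {xs. set xs \<subseteq> X \<and> length xs = j}"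
    using \<tau>D q by (auto simp: col_def cf_def)
  then have "card (col ` D) \<le> card {xs. set xs \<subseteq> X \<and> length xs = j}"
    using finX by (intro card_mono finite_lists_length_eq)
  also have "\<dots> = card X ^ j" using finX by (rule card_lists_length_eq)
  finally have "real (card (col ` D)) \<le> real (card X) ^ j" by (metis of_nat_le_iff of_nat_power)
  also have "\<dots> \<le> M ^ j" using cX by (intro power_mono) auto
  also have "\<dots> < real (card A)" by (rule j)
  also have "\<dots> \<le> real (card D)"
    unfolding D using card_le_card_set_plus[of A "uminus ` A"] fin ne by simp
  finally have "card (col ` D) \<noteq> card D" by simp
  then have "\<not> inj_on col D" using card_image by blast
  then obtain s t where st: "s \<in> D" "t \<in> D" "s \<noteq> t" "col s = col t" by (auto simp: inj_on_def)
  have eq: "cf ((\<tau> ^^ i) s) = cf ((\<tau> ^^ i) t)" if "i < j" for i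
  proof -
    have "col s ! i = col t ! i" using st by simp
    with that show ?thesis by (simp add: col_def)
  qed
  have pow: "2 ^ i * (s - t) = (\<tau> ^^ i) s - (\<tau> ^^ i) t" if "i \<le> j" for i
    using that
  proof (induction i)
    case (Suc i)
    have "2 ^ Suc i * (s - t) = ((\<tau> ^^ i) s + (\<tau> ^^ i) s) - ((\<tau> ^^ i) t + (\<tau> ^^ i) t)"
      using Suc by simp
    also have "\<dots> = cf ((\<tau> ^^ i) s) + \<tau> ((\<tau> ^^ i) s) - (cf ((\<tau> ^^ i) t) + \<tau> ((\<tau> ^^ i) t))"
      using q[OF \<tau>D[OF st(1), of i]] q[OF \<tau>D[OF st(2), of i]] by (simp add: \<tau>_def cf_def)
    also have "\<dots> = (\<tau> ^^ Suc i) s - (\<tau> ^^ Suc i) t" using eq[of i] Suc.prems by simp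
    finally show ?case .
  qed simp
  show thesis
  proof (rule that)
    show "s - t \<noteq> 0" using st by simp
    fix i assume "i \<le> j"
    then have "2 ^ i * (s - t) = (\<tau> ^^ i) s + - (\<tau> ^^ i) t" using pow by simp
    also have "\<dots> \<in> D + D" using \<tau>D st Dneg by blast
    finally show "2 ^ i * (s - t) \<in> D + D" .
  qed
qed

text \<open>Every t in \<open>T\<close> gives \<open>j\<close> pairs t, t + 2^i e inside one coset
  of the group generated by e, so |T| j pairs in all. A coset part with k points carries at most k
  log k of them; hence |B| log m bounds the total, where \<open>m\<close> is the size of the largest
  part, and log m \<ge> j / M.\<close>

lemma ex_rich_coset:
  fixes B T :: "real set" and e M :: real
  assumes fin: "finite B" and e: "e \<noteq> 0" and T: "T \<subseteq> B" "T \<noteq> {}"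
    and shift: "\<And>i t. i < j \<Longrightarrow> t \<in> T \<Longrightarrow> t + 2 ^ i * e \<in> B"
    and M: "real (card B) \<le> M * real (card T)"
  obtains b L where "L \<subseteq> B" "\<And>x. x \<in> L \<Longrightarrow> \<exists>k::int. x = b + of_int k * e" "2 powr (real j / M) \<le> real (card L)"
proof -
  have finT: "finite T" using T fin by (auto intro: finite_subset)
  have cT: "card T > 0" using finT T by (simp add: card_gt_0_iff)
  have cB: "card B > 0" using T fin cT by (metis card_gt_0_iff finite_subset subset_empty)
  have Mpos: "M > 0"
    using M cT cB by (smt (verit) mult_nonpos_nonneg of_nat_0_le_iff of_nat_0_less_iff)
  define cls where "cls = (\<lambda>b. {x \<in> B. \<exists>k::int. x = b + of_int k * e})"
  have fincls: "finite (cls b)" for b using fin by (simp add: cls_def)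
  have self: "b \<in> cls b" if "b \<in> B" for b using that by (auto simp: cls_def intro: exI[of _ 0])
  have eqcls: "cls x = cls b" if "x \<in> cls b" for x b
  proof -
    from that obtain k :: int where k: "x = b + of_int k * e" by (auto simp: cls_def)
    show ?thesis
      unfolding cls_def
    proof (intro Collect_cong conj_cong refl iffI)
      fix y assume "\<exists>l::int. y = x + of_int l * e"
      then obtain l :: int where "y = x + of_int l * e" by auto
      then have "y = b + of_int (k + l) * e" by (simp add: k algebra_simps)
      then show "\<exists>l::int. y = b + of_int l * e" by blast
    next
      fix y assume "\<exists>l::int. y = b + of_int l * e"
      then obtain l :: int where "y = b + of_int l * e" by auto
      then have "y = x + of_int (l - k) * e" by (simp add: k algebra_simps)
      then show "\<exists>l::int. y = x + of_int l * e" by blast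
    qed
  qed
  define m where "m = Max ((\<lambda>b. card (cls b)) ` B)"
  have "m \<in> (\<lambda>b. card (cls b)) ` B" unfolding m_def using fin cB by (intro Max_in) auto
  then obtain b where b: "b \<in> B" "m = card (cls b)" by auto
  have mle: "card (cls x) \<le> m" if "x \<in> B" for x unfolding m_def using fin that by auto
  have m1: "m \<ge> 1" using b self[of b] fincls[of b] by (metis One_nat_def Suc_leI card_gt_0_iff empty_iff)
  define Ed where "Ed = (\<lambda>C. {(x, i). i < j \<and> x \<in> C \<and> x + 2 ^ i * e \<in> C})"
  have finEd: "finite (Ed C)" if "finite C" for C
    by (rule finite_subset[of _ "C \<times> {..<j}"]) (use that in \<open>auto simp: Ed_def\<close>)
  have EdC: "real (card (Ed C)) \<le> real (card C) * log 2 (real m)" if "C \<in> cls ` B" for C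
  proof -
    from that obtain c where c: "c \<in> B" "C = cls c" by auto
    define f where "f = (\<lambda>k::int. c + of_int k * e)"
    have injf: "inj_on f S" for S using e by (auto simp: f_def inj_on_def)
    define P where "P = {k. f k \<in> C}"
    have fP: "f ` P = C" unfolding P_def c cls_def f_def by auto
    have finP: "finite P" using fP fincls c injf by (metis finite_imageD)
    have cP: "card P = card C" using fP injf by (metis card_image)
    have "Ed C \<subseteq> (\<lambda>(k, i). (f k, i)) ` dyadic_pairs j P"
    proof clarify
      fix x i assume "(x, i) \<in> Ed C"
      then have xi: "i < j" "x \<in> C" "x + 2 ^ i * e \<in> C" by (auto simp: Ed_def)
      then obtain k where k: "k \<in> P" "x = f k" using fP by auto
      have "x + 2 ^ i * e = f (k + 2 ^ i)" by (simp add: k f_def algebra_simps)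
      with xi k have "(k, i) \<in> dyadic_pairs j P" by (auto simp: dyadic_pairs_def P_def)
      with k show "(x, i) \<in> (\<lambda>(k, i). (f k, i)) ` dyadic_pairs j P" by force
    qed
    then have "card (Ed C) \<le> card ((\<lambda>(k, i). (f k, i)) ` dyadic_pairs j P)"
      using finP by (intro card_mono finite_imageI finite_dyadic_pairs)
    also have "\<dots> \<le> card (dyadic_pairs j P)" using finP by (intro card_image_le finite_dyadic_pairs)
    finally have "real (card (Ed C)) \<le> real (card C) * log 2 (real (card C))"
      using card_dyadic_pairs_le[OF finP, of j] cP by simp
    also have "\<dots> \<le> real (card C) * log 2 (real m)"
    proof (cases "card C = 0")
      case False
      with mle[OF c(1)] c m1 show ?thesis by (intro mult_left_mono) auto
    qed simp
    finally show ?thesis .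
  qed
  have disj: "C \<inter> C' = {}" if "C \<in> cls ` B" "C' \<in> cls ` B" "C \<noteq> C'" for C C'
    using that eqcls by blast
  have UnB: "\<Union> (cls ` B) = B" using self by (auto simp: cls_def)
  have sub: "T \<times> {..<j} \<subseteq> (\<Union>C\<in>cls ` B. Ed C)"
  proof clarify
    fix t i assume ti: "t \<in> T" "i < j"
    then have "t \<in> B" using T by auto
    have "t + 2 ^ i * e \<in> B" using shift[OF ti(2,1)] .
    then have "t + 2 ^ i * e \<in> cls t" by (auto simp: cls_def intro!: exI[of _ "2 ^ i"])
    then have "(t, i) \<in> Ed (cls t)" using self[OF \<open>t \<in> B\<close>] ti by (auto simp: Ed_def)
    with \<open>t \<in> B\<close> show "(t, i) \<in> (\<Union>C\<in>cls ` B. Ed C)" by blast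
  qed
  have "card (T \<times> {..<j}) \<le> card (\<Union>C\<in>cls ` B. Ed C)"
    using sub fin fincls finEd by (intro card_mono) auto
  also have "\<dots> \<le> (\<Sum>C\<in>cls ` B. card (Ed C))" using fin by (intro card_UN_le) auto
  finally have "real (card T) * real j \<le> (\<Sum>C\<in>cls ` B. real (card (Ed C)))"
    by (simp add: card_cartesian_product flip: of_nat_sum of_nat_mult)
  also have "\<dots> \<le> (\<Sum>C\<in>cls ` B. real (card C) * log 2 (real m))" by (intro sum_mono EdC)
  also have "\<dots> = real (\<Sum>C\<in>cls ` B. card C) * log 2 (real m)" by (simp add: sum_distrib_right)
  also have "(\<Sum>C\<in>cls ` B. card C) = card (\<Union> (cls ` B))"
    using fin fincls disj by (intro card_Union_disjoint[symmetric]) (auto simp: pairwise_def disjnt_def)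
  finally have "real (card T) * real j \<le> real (card B) * log 2 (real m)" by (simp add: UnB)
  also have "\<dots> \<le> M * real (card T) * log 2 (real m)"
    using M m1 by (intro mult_right_mono) auto
  finally have "real j \<le> M * log 2 (real m)" using cT by (simp add: mult.assoc mult.left_commute)
  then have "real j / M \<le> log 2 (real m)" using Mpos by (simp add: field_simps)
  then have "2 powr (real j / M) \<le> real m" using m1 by (simp add: le_log_iff)
  then have fin_bound: "2 powr (real j / M) \<le> real (card (cls b))" using b(2) by simp
  show thesis
  proof (rule that)
    show "cls b \<subseteq> B" by (auto simp: cls_def)
    show "\<exists>k::int. x = b + of_int k * e" if "x \<in> cls b" for x using that by (simp add: cls_def)
  qed (rule fin_bound)
qed


section \<open>A discrete Brunn-Minkowski inequality\<close>

lemma card_sumset_int_ge: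
  fixes A B :: "int set"
  assumes "finite A" "finite B" "A \<noteq> {}" "B \<noteq> {}"
  shows "card A + card B \<le> card (A + B) + 1"
proof -
  define U where "U = (\<lambda>a. a + Min B) ` A"
  define V where "V = (\<lambda>b. Max A + b) ` B"
  have "U \<union> V \<subseteq> A + B" using assms Min_in Max_in unfolding U_def V_def by blast
  moreover have "finite (A + B)" using assms by (intro finite_set_plus)
  ultimately have 1: "card (U \<union> V) \<le> card (A + B)" by (intro card_mono)
  have "U \<inter> V \<subseteq> {Max A + Min B}"
  proof
    fix z assume "z \<in> U \<inter> V"
    then obtain a b where ab: "a \<in> A" "b \<in> B" "z = a + Min B" "z = Max A + b" by (auto simp: U_def V_def)
    have "a \<le> Max A" "Min B \<le> b" using ab assms by auto
    with ab show "z \<in> {Max A + Min B}" by auto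
  qed
  then have "card (U \<inter> V) \<le> 1" using card_mono[of "{Max A + Min B}" "U \<inter> V"] by simp
  moreover have "card U + card V = card (U \<union> V) + card (U \<inter> V)"
    using assms by (intro card_Un_Int) (auto simp: U_def V_def)
  moreover have "card U = card A" "card V = card B"
    unfolding U_def V_def by (auto intro!: card_image simp: inj_on_def)
  ultimately show ?thesis using 1 by linarith
qed

text \<open>The layer-cake formula for a single value; it exchanges sums of function values for
  integrals of level-set sizes.\<close>

lemma has_integral_of_bool_le:
  fixes v :: real
  assumes "0 \<le> v" "v \<le> 1"
  shows "((\<lambda>t. of_bool (t \<le> v)) has_integral v) {0..1}"
proof -
  have "{..v} \<inter> {0..1} = {0..v}" using assms by auto
  moreover have "((\<lambda>t. 1::real) has_integral v) {0..v}"
    using has_integral_const_real[of "1::real" 0 v] assms by simp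
  ultimately have "((\<lambda>t. if t \<in> {..v} then (1::real) else 0) has_integral v) {0..1}"
    by (simp only: has_integral_restrict_Int)
  moreover have "(\<lambda>t. if t \<in> {..v} then (1::real) else 0) = (\<lambda>t. of_bool (t \<le> v))" by auto
  ultimately show ?thesis by simp
qed

lemma sum_of_bool_eq_card: "finite S \<Longrightarrow> (\<Sum>x\<in>S. of_bool (P x) :: real) = real (card {x\<in>S. P x})"
  by (simp add: sum.If_cases of_bool_def Int_def)

text \<open>For t in [0, 1] the level sets of \<open>f\<close> and \<open>g\<close> are nonempty
  because both functions attain 1, and their sumset lies in the level set of \<open>h\<close>.
  Integrating \<open>card_sumset_int_ge\<close> over t gives the claim; its extra 1 integrates to 1,
  which the maximum of \<open>h\<close> dominates.\<close>

lemma sum_plus_sum_le_sum_plus_Max: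
  fixes f g h :: "int \<Rightarrow> real"
  assumes fin: "finite S" and x0: "x0 \<in> S" "f x0 = 1" and y0: "y0 \<in> S" "g y0 = 1"
    and f: "\<And>x. x \<in> S \<Longrightarrow> 0 \<le> f x \<and> f x \<le> 1"
    and g: "\<And>x. x \<in> S \<Longrightarrow> 0 \<le> g x \<and> g x \<le> 1"
    and h0: "\<And>z. 0 \<le> h z"
    and h: "\<And>x y. x \<in> S \<Longrightarrow> y \<in> S \<Longrightarrow> min (f x) (g y) \<le> h (x + y)"
  shows "sum f S + sum g S \<le> sum h (S + S) + Max (h ` (S + S))"
proof -
  define T where "T = S + S"
  have finT: "finite T" unfolding T_def using fin by (intro finite_set_plus)
  define mh where "mh = Max (h ` T)"
  have z0: "x0 + y0 \<in> T" using x0 y0 by (auto simp: T_def)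
  have "1 \<le> h (x0 + y0)" using h[OF x0(1) y0(1)] x0 y0 by simp
  also have "\<dots> \<le> mh" unfolding mh_def using finT z0 by auto
  finally have mh1: "1 \<le> mh" .
  define L where "L = (\<lambda>t. (\<Sum>x\<in>S. of_bool (t \<le> f x)) + (\<Sum>x\<in>S. of_bool (t \<le> g x)) :: real)"
  \<comment> \<open>\<open>h\<close> is truncated at 1 because only levels in [0, 1] are
    integrated.\<close>
  define R where "R = (\<lambda>t. (\<Sum>z\<in>T. of_bool (t \<le> min (h z) 1)) + 1 :: real)"
  have L: "(L has_integral (sum f S + sum g S)) {0..1}"
    unfolding L_def using fin f g
    by (intro has_integral_add has_integral_sum has_integral_of_bool_le) auto
  have R: "(R has_integral ((\<Sum>z\<in>T. min (h z) 1) + 1)) {0..1}"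
    unfolding R_def using finT h0 has_integral_const_real[of "1::real" 0 1]
    by (intro has_integral_add has_integral_sum has_integral_of_bool_le) auto
  have le: "L t \<le> R t" if t: "t \<in> {0..1}" for t
  proof -
    let ?A = "{x\<in>S. t \<le> f x}" and ?B = "{x\<in>S. t \<le> g x}" and ?C = "{z\<in>T. t \<le> min (h z) 1}"
    have "?A + ?B \<subseteq> ?C"
    proof
      fix z assume "z \<in> ?A + ?B"
      then obtain x y where xy: "z = x + y" "x \<in> ?A" "y \<in> ?B" by (rule set_plus_elim)
      then have "t \<le> min (f x) (g y)" by simp
      also have "\<dots> \<le> h z" using h xy by auto
      finally show "z \<in> ?C" using t xy by (auto simp: T_def)
    qed
    then have "card (?A + ?B) \<le> card ?C" using finT by (intro card_mono) auto
    moreover have "card ?A + card ?B \<le> card (?A + ?B) + 1"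
    proof (rule card_sumset_int_ge)
      show "?A \<noteq> {}" using x0 t by fastforce
      show "?B \<noteq> {}" using y0 t by fastforce
    qed (use fin in auto)
    ultimately have "card ?A + card ?B \<le> card ?C + 1" by linarith
    then have "real (card ?A) + real (card ?B) \<le> real (card ?C) + 1" by linarith
    then show ?thesis
      unfolding L_def R_def sum_of_bool_eq_card[OF fin] sum_of_bool_eq_card[OF finT] .
  qed
  have "sum f S + sum g S \<le> (\<Sum>z\<in>T. min (h z) 1) + 1"
    using L R le by (rule has_integral_le)
  also have "\<dots> \<le> sum h T + mh" using mh1 by (intro add_mono sum_mono) auto
  finally show ?thesis by (simp add: T_def mh_def)
qed

lemma min_le_powr_mult_powr:
  fixes a b \<theta> :: real
  assumes "0 \<le> a" "0 \<le> b" "0 < \<theta>" "\<theta> < 1"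
  shows "min a b \<le> a powr (1 - \<theta>) * b powr \<theta>"
proof (cases "min a b = 0")
  case False
  then have m: "min a b > 0" using assms by auto
  have "min a b = min a b powr (1 - \<theta>) * min a b powr \<theta>"
    using m by (simp flip: powr_add)
  also have "\<dots> \<le> a powr (1 - \<theta>) * b powr \<theta>"
    using m assms by (intro mult_mono powr_mono2) auto
  finally show ?thesis .
qed (use assms in auto)

text \<open>The exponential of the entropy of (1 - \<theta>, \<theta>), which is the best constant c
  in u + v \<ge> c u^(1-\<theta>) v^\<theta>. It enters because sums are taken instead of weighted
  means.\<close>

definition entropy_factor :: "real \<Rightarrow> real" where
  "entropy_factor \<theta> = 1 / ((1 - \<theta>) powr (1 - \<theta>) * \<theta> powr \<theta>)"

lemma entropy_factor_pos: "0 < \<theta> \<Longrightarrow> \<theta> < 1 \<Longrightarrow> 0 < entropy_factor \<theta>"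
  by (simp add: entropy_factor_def)

text \<open>Dividing \<open>f\<close> and \<open>g\<close> by their maxima makes both peak at 1, and
  a minimum is at most a geometric mean, so \<open>sum_plus_sum_le_sum_plus_Max\<close> applies.
  Weighted AM-GM then returns to products, and the maxima recombine into \<open>R\<close>, which
  cancels.\<close>

lemma prekopa_leindler_int:
  fixes f g h :: "int \<Rightarrow> real"
  assumes fin: "finite S" and ne: "S \<noteq> {}" and \<theta>: "0 < \<theta>" "\<theta> < 1"
    and f0: "\<And>x. 0 \<le> f x" and g0: "\<And>x. 0 \<le> g x" and h0: "\<And>x. 0 \<le> h x"
    and h: "\<And>x y. x \<in> S \<Longrightarrow> y \<in> S \<Longrightarrow> f x powr (1 - \<theta>) * g y powr \<theta> \<le> h (x + y)"
  shows "entropy_factor \<theta> * (sum f S powr (1 - \<theta>) * sum g S powr \<theta>)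
         \<le> sum h (S + S) + Max (h ` (S + S))"
proof (cases "sum f S = 0 \<or> sum g S = 0")
  case True
  have "finite (S + S)" "S + S \<noteq> {}" using fin ne by (auto intro: finite_set_plus simp: set_plus_def)
  then have "0 \<le> Max (h ` (S + S))" using h0
    by (metis Max_ge all_not_in_conv finite_imageI image_eqI order_trans)
  moreover have "0 \<le> sum h (S + S)" using h0 by (intro sum_nonneg)
  ultimately show ?thesis using True \<theta> by auto
next
  case False
  define F where "F = Max (f ` S)"
  define G where "G = Max (g ` S)"
  have "F \<in> f ` S" "G \<in> g ` S" unfolding F_def G_def using fin ne by (auto intro: Max_in)
  then obtain x0 y0 where x0: "x0 \<in> S" "F = f x0" and y0: "y0 \<in> S" "G = g y0" by auto
  have Fge: "f x \<le> F" if "x \<in> S" for x unfolding F_def using fin that by auto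
  have Gge: "g x \<le> G" if "x \<in> S" for x unfolding G_def using fin that by auto
  have Fpos: "F > 0"
  proof (rule ccontr)
    assume "\<not> ?thesis"
    then have "\<And>x. x \<in> S \<Longrightarrow> f x = 0" using Fge f0 by (smt (verit))
    then show False using False by simp
  qed
  have Gpos: "G > 0"
  proof (rule ccontr)
    assume "\<not> ?thesis"
    then have "\<And>x. x \<in> S \<Longrightarrow> g x = 0" using Gge g0 by (smt (verit))
    then show False using False by simp
  qed
  define R where "R = F powr (1 - \<theta>) * G powr \<theta>"
  have Rpos: "R > 0" using Fpos Gpos by (simp add: R_def)
  have finT: "finite (S + S)" "S + S \<noteq> {}" using fin ne by (auto intro: finite_set_plus simp: set_plus_def)
  have "sum (\<lambda>x. f x / F) S + sum (\<lambda>x. g x / G) S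
        \<le> sum (\<lambda>z. h z / R) (S + S) + Max ((\<lambda>z. h z / R) ` (S + S))"
  proof (rule sum_plus_sum_le_sum_plus_Max)
    fix x y assume xy: "x \<in> S" "y \<in> S"
    have "min (f x / F) (g y / G) \<le> (f x / F) powr (1 - \<theta>) * (g y / G) powr \<theta>"
      using f0 g0 Fpos Gpos \<theta> by (intro min_le_powr_mult_powr) auto
    also have "\<dots> = f x powr (1 - \<theta>) * g y powr \<theta> / R"
      using f0[of x] g0[of y] Fpos Gpos by (simp add: R_def powr_divide)
    also have "\<dots> \<le> h (x + y) / R" using h[OF xy] Rpos by (intro divide_right_mono) auto
    finally show "min (f x / F) (g y / G) \<le> h (x + y) / R" .
  qed (use fin x0 y0 Fpos Gpos f0 g0 h0 Fge Gge Rpos in auto)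
  also have "(\<lambda>z. h z / R) ` (S + S) = (\<lambda>t. t / R) ` h ` (S + S)" by (simp add: image_image)
  also have "Max ((\<lambda>t. t / R) ` h ` (S + S)) = Max (h ` (S + S)) / R"
    using finT Rpos by (subst mono_Max_commute[symmetric]) (auto intro!: monoI divide_right_mono)
  finally have 1: "sum f S / F + sum g S / G \<le> (sum h (S + S) + Max (h ` (S + S))) / R"
    by (simp add: sum_divide_distrib add_divide_distrib)
  have sp: "sum f S > 0" "sum g S > 0"
    using False f0 g0 by (metis less_eq_real_def sum_nonneg)+
  define a where "a = sum f S / (F * (1 - \<theta>))"
  define b where "b = sum g S / (G * \<theta>)"
  have "a > 0" "b > 0" using sp Fpos Gpos \<theta> by (auto simp: a_def b_def)
  then have "a powr (1 - \<theta>) * b powr \<theta> \<le> (1 - \<theta>) * a + \<theta> * b"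
    using \<theta> by (intro Youngs_inequality_0) auto
  also have "\<dots> = sum f S / F + sum g S / G" using \<theta> by (simp add: a_def b_def)
  also note 1
  also have "a powr (1 - \<theta>) * b powr \<theta> = entropy_factor \<theta> * (sum f S powr (1 - \<theta>) * sum g S powr \<theta>) / R"
    using sp Fpos Gpos \<theta> by (simp add: a_def b_def entropy_factor_def R_def powr_divide powr_mult)
  finally show ?thesis using Rpos by (simp add: divide_le_cancel)
qed

section \<open>Passage to several dimensions\<close>

abbreviation lists_of :: "nat \<Rightarrow> 'a set \<Rightarrow> 'a list set" where
  "lists_of d S \<equiv> {xs. set xs \<subseteq> S \<and> length xs = d}"

lemma lists_of_0: "lists_of 0 S = {[]}"
  by auto

lemma lists_of_Suc: "lists_of (Suc d) S = (\<lambda>(x, t). t # x) ` (lists_of d S \<times> S)"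
  by (auto simp: length_Suc_conv image_iff)

lemma sum_lists_of_Suc:
  "sum f (lists_of (Suc d) S) = (\<Sum>xs\<in>lists_of d S. \<Sum>t\<in>S. f (t # xs))"
  unfolding lists_of_Suc
  by (subst sum.reindex) (auto simp: inj_on_def sum.cartesian_product intro!: sum.cong)

text \<open>
  Adding the maximum over each coordinate line replaces thickening by a unit cube: it compensates the
  \<open>-1\<close> in \<open>|A + B| \<ge> |A| + |B| - 1\<close>, so that the one-dimensional inequality tensorizes.
\<close>

fun sum_max :: "nat \<Rightarrow> int set \<Rightarrow> (int list \<Rightarrow> real) \<Rightarrow> real" where
  "sum_max 0 S h = h []"
| "sum_max (Suc d) S h = sum_max d S (\<lambda>xs. (\<Sum>t\<in>S. h (t # xs)) + Max ((\<lambda>t. h (t # xs)) ` S))"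

text \<open>Induction on the dimension: by the one-dimensional inequality in the head coordinate,
  the fibre sums of \<open>f\<close> and \<open>g\<close> satisfy the hypothesis again, with the
  fibre sum plus fibre maximum in place of \<open>h\<close>.\<close>

lemma prekopa_leindler_lists:
  fixes f g h :: "int list \<Rightarrow> real"
  assumes fin: "finite S" and ne: "S \<noteq> {}" and \<theta>: "0 < \<theta>" "\<theta> < 1"
    and "\<And>x. 0 \<le> f x" "\<And>x. 0 \<le> g x" "\<And>x. 0 \<le> h x"
    and "\<And>x y. x \<in> lists_of d S \<Longrightarrow> y \<in> lists_of d S \<Longrightarrow>
           f x powr (1 - \<theta>) * g y powr \<theta> \<le> h (map2 (+) x y)"
  shows "entropy_factor \<theta> ^ d * (sum f (lists_of d S) powr (1 - \<theta>) * sum g (lists_of d S) powr \<theta>)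
         \<le> sum_max d (S + S) h"
  using assms(5-)
proof (induction d arbitrary: f g h)
  case 0
  then show ?case unfolding lists_of_0 by simp
next
  case (Suc d)
  let ?c = "entropy_factor \<theta>"
  have c: "?c > 0" using \<theta> by (rule entropy_factor_pos)
  \<comment> \<open>Both fibre sums carry the factor \<open>?c\<close>, so that their weighted
    product carries c^(1-\<theta>) c^\<theta> = c.\<close>
  define f' where "f' = (\<lambda>xs. ?c * (\<Sum>t\<in>S. f (t # xs)))"
  define g' where "g' = (\<lambda>xs. ?c * (\<Sum>t\<in>S. g (t # xs)))"
  define h' where "h' = (\<lambda>xs. (\<Sum>t\<in>S + S. h (t # xs)) + Max ((\<lambda>t. h (t # xs)) ` (S + S)))"
  have finT: "finite (S + S)" "S + S \<noteq> {}" using fin ne by (auto intro: finite_set_plus simp: set_plus_def)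
  have cc: "(?c * a) powr (1 - \<theta>) * (?c * b) powr \<theta> = ?c * (a powr (1 - \<theta>) * b powr \<theta>)"
    if "0 \<le> a" "0 \<le> b" for a b
  proof -
    have "(?c * a) powr (1 - \<theta>) * (?c * b) powr \<theta> = (?c powr (1 - \<theta>) * ?c powr \<theta>) * (a powr (1 - \<theta>) * b powr \<theta>)"
      using that c by (simp add: powr_mult)
    also have "?c powr (1 - \<theta>) * ?c powr \<theta> = ?c" using c by (simp flip: powr_add)
    finally show ?thesis .
  qed
  have nn: "0 \<le> (\<Sum>t\<in>S. f (t # xs))" "0 \<le> (\<Sum>t\<in>S. g (t # xs))" for xs
    using Suc.prems by (auto intro: sum_nonneg)
  have "?c ^ d * (sum f' (lists_of d S) powr (1 - \<theta>) * sum g' (lists_of d S) powr \<theta>)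
         \<le> sum_max d (S + S) h'"
  proof (rule Suc.IH)
    show "0 \<le> f' xs" "0 \<le> g' xs" for xs using nn c by (auto simp: f'_def g'_def)
    show "0 \<le> h' xs" for xs
    proof -
      have "0 \<le> Max ((\<lambda>t. h (t # xs)) ` (S + S))" using finT Suc.prems(3)
        by (metis Max_ge all_not_in_conv finite_imageI image_eqI order_trans)
      moreover have "0 \<le> (\<Sum>t\<in>S + S. h (t # xs))" using Suc.prems(3) by (intro sum_nonneg)
      ultimately show ?thesis by (simp add: h'_def)
    qed
    fix xs ys assume xy: "xs \<in> lists_of d S" "ys \<in> lists_of d S"
    have "f' xs powr (1 - \<theta>) * g' ys powr \<theta>
        = ?c * ((\<Sum>t\<in>S. f (t # xs)) powr (1 - \<theta>) * (\<Sum>t\<in>S. g (t # ys)) powr \<theta>)"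
      unfolding f'_def g'_def using nn by (intro cc)
    also have "\<dots> \<le> (\<Sum>t\<in>S + S. h (t # map2 (+) xs ys)) + Max ((\<lambda>t. h (t # map2 (+) xs ys)) ` (S + S))"
    proof (rule prekopa_leindler_int[OF fin ne \<theta>])
      fix s t assume "s \<in> S" "t \<in> S"
      with xy Suc.prems(4)[of "s # xs" "t # ys"]
      show "f (s # xs) powr (1 - \<theta>) * g (t # ys) powr \<theta> \<le> h ((s + t) # map2 (+) xs ys)" by simp
    qed (use Suc.prems in auto)
    finally show "f' xs powr (1 - \<theta>) * g' ys powr \<theta> \<le> h' (map2 (+) xs ys)" by (simp add: h'_def)
  qed
  also have "sum f' (lists_of d S) = ?c * sum f (lists_of (Suc d) S)"
    unfolding f'_def sum_lists_of_Suc by (rule sum_distrib_left[symmetric])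
  also have "sum g' (lists_of d S) = ?c * sum g (lists_of (Suc d) S)"
    unfolding g'_def sum_lists_of_Suc by (rule sum_distrib_left[symmetric])
  also have "(?c * sum f (lists_of (Suc d) S)) powr (1 - \<theta>) * (?c * sum g (lists_of (Suc d) S)) powr \<theta>
      = ?c * (sum f (lists_of (Suc d) S) powr (1 - \<theta>) * sum g (lists_of (Suc d) S) powr \<theta>)"
    using Suc.prems by (intro cc sum_nonneg) auto
  finally show ?case by (simp add: h'_def mult.assoc mult.left_commute)
qed

text \<open>For the indicator of a subset of the grid this counts the lines in coordinate direction
  \<open>i\<close> that meet the subset. The value is 0 when i \<ge> d, where no such direction
  exists.\<close>

fun line_sum :: "nat \<Rightarrow> nat \<Rightarrow> int set \<Rightarrow> (int list \<Rightarrow> real) \<Rightarrow> real" where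
  "line_sum i 0 S h = 0"
| "line_sum 0 (Suc d) S h = (\<Sum>xs\<in>lists_of d S. Max ((\<lambda>t. h (t # xs)) ` S))"
| "line_sum (Suc i) (Suc d) S h = (\<Sum>t\<in>S. line_sum i d S (\<lambda>xs. h (t # xs)))"

text \<open>The hypothesis has the shape that arises in \<open>sum_max_le\<close>: there
  \<open>k\<close> is a fibre sum plus a fibre maximum, and the maximum is at most the sum, whence
  the factor 2.\<close>

lemma line_sum_le:
  assumes fin: "finite S" and ne: "S \<noteq> {}" and finI: "finite I"
    and "\<And>xs. k xs \<le> 2 * (\<Sum>t\<in>I. \<phi> t xs)"
  shows "line_sum i d S k \<le> 2 * (\<Sum>t\<in>I. line_sum i d S (\<phi> t))"
  using assms(1,2,4)
proof (induction i d S k arbitrary: \<phi> rule: line_sum.induct)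
  case (1 i S h)
  show ?case by simp
next
  case (2 d S h)
  have "Max ((\<lambda>t. h (t # xs)) ` S) \<le> 2 * (\<Sum>t\<in>I. Max ((\<lambda>s. \<phi> t (s # xs)) ` S))" for xs
  proof (rule Max.boundedI)
    fix a assume "a \<in> (\<lambda>t. h (t # xs)) ` S"
      then obtain s where s: "s \<in> S" "a = h (s # xs)" by auto
      have "a \<le> 2 * (\<Sum>t\<in>I. \<phi> t (s # xs))" using s 2 by auto
      also have "\<dots> \<le> 2 * (\<Sum>t\<in>I. Max ((\<lambda>s. \<phi> t (s # xs)) ` S))"
        using s 2 by (intro mult_left_mono sum_mono Max_ge) auto
      finally show "a \<le> 2 * (\<Sum>t\<in>I. Max ((\<lambda>s. \<phi> t (s # xs)) ` S))" .
  qed (use 2 in auto)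
  then have "line_sum 0 (Suc d) S h \<le> (\<Sum>xs\<in>lists_of d S. 2 * (\<Sum>t\<in>I. Max ((\<lambda>s. \<phi> t (s # xs)) ` S)))"
    by (auto intro: sum_mono)
  also have "\<dots> = 2 * (\<Sum>t\<in>I. line_sum 0 (Suc d) S (\<phi> t))"
    by (simp add: sum_distrib_left sum.swap[of _ _ I])
  finally show ?case .
next
  case (3 i d S h)
  have "line_sum (Suc i) (Suc d) S h \<le> (\<Sum>s\<in>S. 2 * (\<Sum>t\<in>I. line_sum i d S (\<lambda>xs. \<phi> t (s # xs))))"
    unfolding line_sum.simps by (intro sum_mono 3)
  also have "\<dots> = 2 * (\<Sum>t\<in>I. line_sum (Suc i) (Suc d) S (\<phi> t))"
    by (simp add: sum_distrib_left sum.swap[of _ _ I])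
  finally show ?case .
qed

text \<open>Processing a coordinate adds its line maxima to the plain sum. In the line sums of the
  other directions the maximum over this coordinate is bounded by the sum, which costs a factor 2
  each time.\<close>

lemma sum_max_le:
  assumes fin: "finite S" and ne: "S \<noteq> {}" and "\<And>xs. 0 \<le> h xs"
  shows "sum_max d S h \<le> sum h (lists_of d S) + 2 ^ d * (\<Sum>i<d. line_sum i d S h)"
  using assms(3)
proof (induction d arbitrary: h)
  case 0
  then show ?case unfolding lists_of_0 by simp
next
  case (Suc d)
  define h' where "h' = (\<lambda>xs. (\<Sum>t\<in>S. h (t # xs)) + Max ((\<lambda>t. h (t # xs)) ` S))"
  have Max_le: "0 \<le> Max ((\<lambda>t. h (t # xs)) ` S) \<and> Max ((\<lambda>t. h (t # xs)) ` S) \<le> (\<Sum>t\<in>S. h (t # xs))" for xs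
  proof -
    have "Max ((\<lambda>t. h (t # xs)) ` S) \<in> (\<lambda>t. h (t # xs)) ` S" using fin ne by (intro Max_in) auto
    then obtain s where s: "s \<in> S" "Max ((\<lambda>t. h (t # xs)) ` S) = h (s # xs)" by auto
    then show ?thesis using member_le_sum[of s S "\<lambda>t. h (t # xs)"] fin Suc.prems by auto
  qed
  have h'2: "h' xs \<le> 2 * (\<Sum>t\<in>S. h (t # xs))" for xs
    using Max_le[of xs] by (simp add: h'_def)
  have h'0: "0 \<le> h' xs" for xs
    using Max_le[of xs] by (simp add: h'_def sum_nonneg Suc.prems)
  have ls: "line_sum i d S h' \<le> 2 * line_sum (Suc i) (Suc d) S h" for i
    using line_sum_le[OF fin ne fin h'2, of i d] by simp
  have "sum_max (Suc d) S h = sum_max d S h'" by (simp add: h'_def)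
  also have "\<dots> \<le> sum h' (lists_of d S) + 2 ^ d * (\<Sum>i<d. line_sum i d S h')"
    by (intro Suc.IH h'0)
  also have "\<dots> \<le> sum h' (lists_of d S) + 2 ^ d * (\<Sum>i<d. 2 * line_sum (Suc i) (Suc d) S h)"
    by (intro add_left_mono mult_left_mono sum_mono ls) auto
  also have "sum h' (lists_of d S) = sum h (lists_of (Suc d) S) + line_sum 0 (Suc d) S h"
    unfolding h'_def sum_lists_of_Suc by (simp add: sum.distrib)
  also have "\<dots> \<le> sum h (lists_of (Suc d) S) + 2 ^ Suc d * line_sum 0 (Suc d) S h"
  proof -
    have "0 \<le> line_sum 0 (Suc d) S h" using Max_le by (auto intro!: sum_nonneg)
    then have "1 * line_sum 0 (Suc d) S h \<le> 2 ^ Suc d * line_sum 0 (Suc d) S h"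
      by (intro mult_right_mono) (auto simp: one_le_power simp del: power_Suc)
    then show ?thesis by simp
  qed
  also have "sum h (lists_of (Suc d) S) + 2 ^ Suc d * line_sum 0 (Suc d) S h +
      2 ^ d * (\<Sum>i<d. 2 * line_sum (Suc i) (Suc d) S h)
      = sum h (lists_of (Suc d) S) + 2 ^ Suc d * (\<Sum>i<Suc d. line_sum i (Suc d) S h)"
    by (subst sum.lessThan_Suc_shift) (simp add: sum_distrib_left algebra_simps del: line_sum.simps)
  finally show ?case by simp
qed

text \<open>Overwriting coordinate \<open>i\<close> by 0 labels the line in direction
  \<open>i\<close> through a point, so the right side counts the lines that meet
  \<open>W\<close>.\<close>

lemma line_sum_of_bool_le:
  assumes fin: "finite S" and ne: "S \<noteq> {}" and "W \<subseteq> lists_of d S"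
  shows "line_sum i d S (\<lambda>xs. of_bool (xs \<in> W)) \<le> real (card ((\<lambda>xs. xs[i := 0]) ` W))"
  using assms(3)
proof (induction d arbitrary: i W)
  case 0
  then show ?case by simp
next
  case (Suc d)
  have finL: "finite (lists_of k S)" for k using fin by (rule finite_lists_length_eq)
  have finW: "finite W" using Suc.prems finL finite_subset by blast
  show ?case
  proof (cases i)
    case 0
    define V where "V = {xs \<in> lists_of d S. \<exists>t\<in>S. t # xs \<in> W}"
    have "Max ((\<lambda>t. of_bool (t # xs \<in> W)) ` S) \<le> (of_bool (\<exists>t\<in>S. t # xs \<in> W) :: real)" for xs
      using fin ne by (intro Max.boundedI) auto
    then have "line_sum 0 (Suc d) S (\<lambda>xs. of_bool (xs \<in> W)) \<le> (\<Sum>xs\<in>lists_of d S. of_bool (\<exists>t\<in>S. t # xs \<in> W))"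
      by (auto intro: sum_mono)
    also have "\<dots> = real (card V)" unfolding V_def using finL by (rule sum_of_bool_eq_card)
    also have "card V = card ((\<lambda>xs. 0 # xs) ` V)" by (simp add: card_image)
    also have "\<dots> \<le> card ((\<lambda>xs. xs[0 := 0]) ` W)"
    proof (rule card_mono)
      show "(\<lambda>xs. 0 # xs) ` V \<subseteq> (\<lambda>xs. xs[0 := 0]) ` W"
      proof clarify
        fix xs assume "xs \<in> V"
        then obtain t where "t # xs \<in> W" by (auto simp: V_def)
        then show "0 # xs \<in> (\<lambda>xs. xs[0 := 0]) ` W" by (force intro: image_eqI[of _ _ "t # xs"])
      qed
    qed (use finW in auto)
    finally show ?thesis using 0 by simp
  next
    case (Suc i')
    define Wt where "Wt = (\<lambda>t. {xs. t # xs \<in> W})"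
    have Wt: "Wt t \<subseteq> lists_of d S" for t
    proof
      fix xs assume "xs \<in> Wt t"
      then have "t # xs \<in> W" by (simp add: Wt_def)
      with Suc.prems have "t # xs \<in> lists_of (Suc d) S" by blast
      then show "xs \<in> lists_of d S" by simp
    qed
    have finWt: "finite (Wt t)" for t using Wt finL finite_subset by blast
    have "line_sum (Suc i') (Suc d) S (\<lambda>xs. of_bool (xs \<in> W))
        = (\<Sum>t\<in>S. line_sum i' d S (\<lambda>xs. of_bool (xs \<in> Wt t)))" by (simp add: Wt_def)
    also have "\<dots> \<le> (\<Sum>t\<in>S. real (card ((\<lambda>xs. xs[i' := 0]) ` Wt t)))"
      by (intro sum_mono Suc.IH Wt)
    also have "\<dots> = real (\<Sum>t\<in>S. card ((#) t ` (\<lambda>xs. xs[i' := 0]) ` Wt t))"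
      by (simp add: card_image)
    also have "(\<Sum>t\<in>S. card ((#) t ` (\<lambda>xs. xs[i' := 0]) ` Wt t))
        = card (\<Union>t\<in>S. (#) t ` (\<lambda>xs. xs[i' := 0]) ` Wt t)"
      using fin finWt by (intro card_UN_disjoint[symmetric]) auto
    also have "\<dots> \<le> card ((\<lambda>xs. xs[Suc i' := 0]) ` W)"
    proof (rule card_mono)
      show "(\<Union>t\<in>S. (#) t ` (\<lambda>xs. xs[i' := 0]) ` Wt t) \<subseteq> (\<lambda>xs. xs[Suc i' := 0]) ` W"
        by (force simp: Wt_def intro: image_eqI)
    qed (use finW in auto)
    finally show ?thesis using Suc by simp
  qed
qed

text \<open>Prekopa-Leindler for indicators leaves the weight \<theta> free. With \<open>a\<close>
  and \<open>b\<close> the d-th roots of the two sizes, \<theta> = b / (a + b) is the equality case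
  of weighted AM-GM, so the product of powers becomes exactly (a + b)^d. The cost of discreteness is
  the number of coordinate lines that meet the sumset.\<close>

lemma brunn_minkowski_lists:
  fixes X Y :: "int list set"
  assumes fin: "finite X" "finite Y" and ne: "X \<noteq> {}" "Y \<noteq> {}" and d: "d > 0"
    and len: "\<And>x. x \<in> X \<union> Y \<Longrightarrow> length x = d"
  defines "W \<equiv> (\<lambda>(x, y). map2 (+) x y) ` (X \<times> Y)"
  shows "(real (card X) powr (1 / real d) + real (card Y) powr (1 / real d)) ^ d
         \<le> real (card W) + 2 ^ d * (\<Sum>i<d. real (card ((\<lambda>xs. xs[i := 0]) ` W)))"
proof -
  define S where "S = (\<Union>x\<in>X \<union> Y. set x)"
  have finS: "finite S" unfolding S_def using fin by auto
  have XY: "X \<subseteq> lists_of d S" "Y \<subseteq> lists_of d S" using len by (auto simp: S_def)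
  have neS: "S \<noteq> {}"
  proof -
    obtain x where "x \<in> X" using ne by auto
    with len[of x] d have "x \<noteq> []" "set x \<subseteq> S" by (auto simp: S_def)
    then show ?thesis by (cases x) auto
  qed
  have finT: "finite (S + S)" "S + S \<noteq> {}" using finS neS by (auto intro: finite_set_plus simp: set_plus_def)
  have WT: "W \<subseteq> lists_of d (S + S)"
  proof
    fix w assume "w \<in> W"
    then obtain x y where xy: "x \<in> X" "y \<in> Y" "w = map2 (+) x y" by (auto simp: W_def)
    have "set (map2 (+) x y) \<subseteq> S + S"
    proof
      fix z assume "z \<in> set (map2 (+) x y)"
      then obtain a b where "(a, b) \<in> set (zip x y)" "z = a + b" by auto
      then show "z \<in> S + S" using set_zip_leftD set_zip_rightD xy XY by fast
    qed
    then show "w \<in> lists_of d (S + S)" using xy len by auto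
  qed
  have finW: "finite W" unfolding W_def using fin by auto
  define a where "a = real (card X) powr (1 / real d)"
  define b where "b = real (card Y) powr (1 / real d)"
  have pos: "card X > 0" "card Y > 0" using fin ne by (auto simp: card_gt_0_iff)
  then have ab: "a > 0" "b > 0" by (auto simp: a_def b_def)
  have ad: "a ^ d = real (card X)" "b ^ d = real (card Y)"
    using pos d by (auto simp: a_def b_def powr_powr simp flip: powr_realpow)
  define \<theta> where "\<theta> = b / (a + b)"
  have \<theta>: "0 < \<theta>" "\<theta> < 1" using ab by (auto simp: \<theta>_def)
  have \<theta>': "1 - \<theta> = a / (a + b)" using ab by (simp add: \<theta>_def field_simps)
  have "entropy_factor \<theta> * (a powr (1 - \<theta>) * b powr \<theta>) = (a / (1 - \<theta>)) powr (1 - \<theta>) * (b / \<theta>) powr \<theta>"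
    using ab \<theta> by (simp add: entropy_factor_def powr_divide)
  also have "a / (1 - \<theta>) = a + b" unfolding \<theta>' using ab by simp
  also have "b / \<theta> = a + b" unfolding \<theta>_def using ab by simp
  also have "(a + b) powr (1 - \<theta>) * (a + b) powr \<theta> = a + b" using ab by (simp flip: powr_add)
  finally have c: "entropy_factor \<theta> * (a powr (1 - \<theta>) * b powr \<theta>) = a + b" .
  have "(a + b) ^ d = entropy_factor \<theta> ^ d * (real (card X) powr (1 - \<theta>) * real (card Y) powr \<theta>)"
    unfolding c[symmetric] ad[symmetric] using ab
    by (simp add: power_mult_distrib powr_power powr_powr mult.commute flip: powr_realpow)
  also have "real (card X) = sum (\<lambda>x. of_bool (x \<in> X)) (lists_of d S)"
    using sum_of_bool_eq_card[of "lists_of d S" "\<lambda>x. x \<in> X"] finite_lists_length_eq[OF finS, of d] XY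
    by (simp add: Int_absorb1 Int_def[symmetric] Collect_conj_eq)
  also have "real (card Y) = sum (\<lambda>x. of_bool (x \<in> Y)) (lists_of d S)"
    using sum_of_bool_eq_card[of "lists_of d S" "\<lambda>x. x \<in> Y"] finite_lists_length_eq[OF finS, of d] XY
    by (simp add: Int_absorb1 Int_def[symmetric] Collect_conj_eq)
  also have "entropy_factor \<theta> ^ d * (sum (\<lambda>x. of_bool (x \<in> X)) (lists_of d S) powr (1 - \<theta>) *
        sum (\<lambda>x. of_bool (x \<in> Y)) (lists_of d S) powr \<theta>) \<le> sum_max d (S + S) (\<lambda>x. of_bool (x \<in> W))"
    using \<theta> by (intro prekopa_leindler_lists finS neS) (auto simp: W_def)
  also have "\<dots> \<le> sum (\<lambda>x. of_bool (x \<in> W)) (lists_of d (S + S)) +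
      2 ^ d * (\<Sum>i<d. line_sum i d (S + S) (\<lambda>x. of_bool (x \<in> W)))"
    using finT by (intro sum_max_le) auto
  also have "sum (\<lambda>x. of_bool (x \<in> W)) (lists_of d (S + S)) = real (card W)"
    using sum_of_bool_eq_card[of "lists_of d (S + S)" "\<lambda>x. x \<in> W"] finite_lists_length_eq[OF finT(1), of d] WT
    by (simp add: Int_absorb1 Int_def[symmetric] Collect_conj_eq)
  also have "real (card W) + 2 ^ d * (\<Sum>i<d. line_sum i d (S + S) (\<lambda>x. of_bool (x \<in> W)))
      \<le> real (card W) + 2 ^ d * (\<Sum>i<d. real (card ((\<lambda>xs. xs[i := 0]) ` W)))"
    using finT WT by (intro add_left_mono mult_left_mono sum_mono line_sum_of_bool_le) auto
  finally show ?thesis unfolding a_def b_def .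
qed


section \<open>The field generated by an algebraic number\<close>

abbreviation ieval :: "int poly \<Rightarrow> real \<Rightarrow> real" where
  "ieval q x \<equiv> poly (map_poly real_of_int q) x"

lemma ieval_simps [simp]:
  "ieval 0 x = 0"
  "ieval 1 x = 1"
  "ieval [:c:] x = of_int c"
  "ieval (q + r) x = ieval q x + ieval r x"
  "ieval (q - r) x = ieval q x - ieval r x"
  "ieval (q * r) x = ieval q x * ieval r x"
  "ieval (smult c q) x = of_int c * ieval q x"
  "ieval (monom c n) x = of_int c * x ^ n"
proof -
  have "map_poly real_of_int (q + r) = map_poly real_of_int q + map_poly real_of_int r"
    "map_poly real_of_int (q - r) = map_poly real_of_int q - map_poly real_of_int r"
    "map_poly real_of_int (q * r) = map_poly real_of_int q * map_poly real_of_int r"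
    "map_poly real_of_int (smult c q) = smult (of_int c) (map_poly real_of_int q)"
    by (auto intro!: poly_eqI simp: coeff_map_poly coeff_mult)
  then show "ieval (q + r) x = ieval q x + ieval r x"
    "ieval (q - r) x = ieval q x - ieval r x"
    "ieval (q * r) x = ieval q x * ieval r x"
    "ieval (smult c q) x = of_int c * ieval q x" by simp_all
qed (simp_all add: map_poly_pCons map_poly_monom poly_monom)

lemma ieval_sum [simp]: "ieval (sum f I) x = (\<Sum>i\<in>I. ieval (f i) x)"
  by (induction I rule: infinite_finite_induct) auto

lemma reflect_poly_map_poly_of_int:
  "reflect_poly (map_poly real_of_int q) = map_poly real_of_int (reflect_poly q)"
  by (rule poly_eqI) (simp add: coeff_reflect_poly coeff_map_poly degree_map_poly)

lemma ieval_reflect_poly: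
  assumes "x \<noteq> 0"
  shows "ieval (reflect_poly q) x = x ^ degree q * ieval q (inverse x)"
  using poly_reflect_poly_nz[OF assms, of "map_poly real_of_int q"]
  by (simp add: reflect_poly_map_poly_of_int degree_map_poly)

lemma pseudo_division:
  fixes f g :: "'a::idom poly"
  assumes "g \<noteq> 0"
  obtains c a r where "c \<noteq> 0" "smult c f = g * a + r" "r = 0 \<or> degree r < degree g"
proof -
  obtain a r where ar: "pseudo_divmod f g = (a, r)" by fastforce
  show thesis
    using that pseudo_divmod[OF assms ar] assms by (metis leading_coeff_0_iff power_eq_0_iff)
qed

section \<open>The minimal polynomial and its field\<close>

locale int_min_poly =
  fixes p :: "int poly" and l :: real
  assumes min_poly: "is_int_min_poly p l"
begin

lemma p_nz: "p \<noteq> 0" and ieval_p [simp]: "ieval p l = 0"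
  and degree_le: "q \<noteq> 0 \<Longrightarrow> ieval q l = 0 \<Longrightarrow> degree p \<le> degree q"
  using min_poly by (auto simp: is_int_min_poly_def)

lemma degree_pos: "degree p > 0"
proof (rule ccontr)
  assume "\<not> ?thesis"
  then obtain c where c: "p = [:c:]" using degree_eq_zeroE by blast
  with ieval_p p_nz show False by simp
qed

lemma eq_zero_of_degree_less: "degree q < degree p \<Longrightarrow> ieval q l = 0 \<Longrightarrow> q = 0"
  using degree_le by fastforce

lemma content_p: "Polynomial.content p = 1"
proof -
  have "is_unit (Polynomial.content p)"
  proof (rule ccontr)
    assume "\<not> ?thesis"
    moreover have "Polynomial.content p \<noteq> 0" using p_nz by simp
    ultimately obtain r where r: "r dvd Polynomial.content p" "prime r"
      using prime_divisor_exists by blast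
    then have "\<forall>i. r dvd coeff p i" by (meson content_dvd_coeff dvd_trans)
    with r min_poly show False by (auto simp: is_int_min_poly_def)
  qed
  then show ?thesis by (metis is_unit_normalize normalize_content)
qed

text \<open>Gauss's lemma: pseudo-division leaves no remainder by minimality of the degree, and as
  \<open>p\<close> is primitive the scalar \<open>c\<close> divides the content of the
  quotient.\<close>

lemma p_dvd:
  assumes "ieval q l = 0"
  shows "p dvd q"
proof -
  obtain c a r where c: "c \<noteq> 0" "smult c q = p * a + r" "r = 0 \<or> degree r < degree p"
    using pseudo_division[OF p_nz] .
  have "ieval (smult c q) l = ieval (p * a + r) l" using c by simp
  then have "ieval r l = 0" using assms by simp
  then have "r = 0" using c(3) eq_zero_of_degree_less by blast
  then have eq: "smult c q = p * a" using c by simp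
  have "Polynomial.content (smult c q) = Polynomial.content p * Polynomial.content a" unfolding eq by (rule content_mult)
  then have "c dvd Polynomial.content a" 
    by (metis content_p content_smult dvd_triv_left mult_1 normalize_dvd_iff)
  then have "[:c:] dvd a" by (simp add: const_poly_dvd_iff_dvd_content)
  then obtain b where "a = smult c b" by (auto elim!: dvdE)
  then have "smult c q = smult c (p * b)" using eq by simp
  then have "q = p * b" using c(1) by (metis smult_cancel)
  then show ?thesis by simp
qed

lemma lead_coeff_dvd:
  assumes "ieval q l = 0"
  shows "lead_coeff p dvd lead_coeff q"
  using p_dvd[OF assms] by (auto simp: lead_coeff_mult elim!: dvdE)

text \<open>The field generated by \<open>l\<close>. Elements are given by an integer polynomial and
  an integer denominator, so that divisibility of coefficients stays within reach.\<close>

definition K :: "real set" where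
  "K = {x. \<exists>q t. t \<noteq> 0 \<and> of_int t * x = ieval q l}"

lemma K_I: "t \<noteq> 0 \<Longrightarrow> of_int t * x = ieval q l \<Longrightarrow> x \<in> K"
  unfolding K_def by blast

lemma K_E:
  assumes "x \<in> K"
  obtains q t where "t \<noteq> 0" "of_int t * x = ieval q l"
  using assms unfolding K_def by blast

lemma K_add: "x \<in> K \<Longrightarrow> y \<in> K \<Longrightarrow> x + y \<in> K"
proof -
  assume "x \<in> K" "y \<in> K"
  then obtain q t r s where *: "t \<noteq> 0" "of_int t * x = ieval q l" "s \<noteq> 0" "of_int s * y = ieval r l"
    by (metis K_E)
  have "of_int (s * t) * (x + y) = of_int s * (of_int t * x) + of_int t * (of_int s * y)"
    by (simp add: algebra_simps)
  also have "\<dots> = ieval (smult s q + smult t r) l" using * by simp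
  finally show ?thesis using * by (intro K_I[of "s * t" _ "smult s q + smult t r"]) auto
qed

lemma K_mult: "x \<in> K \<Longrightarrow> y \<in> K \<Longrightarrow> x * y \<in> K"
proof -
  assume "x \<in> K" "y \<in> K"
  then obtain q t r s where *: "t \<noteq> 0" "of_int t * x = ieval q l" "s \<noteq> 0" "of_int s * y = ieval r l"
    by (metis K_E)
  have "of_int (t * s) * (x * y) = (of_int t * x) * (of_int s * y)"
    by (simp add: algebra_simps)
  also have "\<dots> = ieval (q * r) l" using * by simp
  finally show ?thesis using * by (intro K_I[of "t * s" _ "q * r"]) auto
qed

lemma K_of_int [simp]: "of_int c \<in> K"
  by (rule K_I[of 1 _ "[:c:]"]) auto

lemma K_01 [simp]: "0 \<in> K" "1 \<in> K"
  using K_of_int[of 0] K_of_int[of 1] by auto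

lemma K_l [simp]: "l \<in> K"
  by (rule K_I[of 1 _ "monom 1 1"]) (auto simp: map_poly_monom poly_monom)

lemma K_uminus [simp]: "- x \<in> K \<longleftrightarrow> x \<in> K"
  using K_mult[OF K_of_int[of "-1"], of x] K_mult[OF K_of_int[of "-1"], of "- x"] by auto

lemma K_diff: "x \<in> K \<Longrightarrow> y \<in> K \<Longrightarrow> x - y \<in> K"
  using K_add[of x "- y"] by simp

text \<open>A Bezout identity over the integers: an element \<open>w\<close> of least degree in the
  ideal of \<open>q\<close> and \<open>p\<close> divides both up to integer factors. Were its degree
  positive, its cofactor in \<open>p\<close> would have too small a degree to vanish at
  \<open>l\<close>, so \<open>w\<close>, and with it \<open>q\<close>, would vanish there.\<close>

lemma ex_int_multiple:
  assumes "ieval q l \<noteq> 0"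
  obtains u m where "m \<noteq> 0" "ieval u l * ieval q l = of_int m"
proof -
  define J where "J = {w. w \<noteq> 0 \<and> (\<exists>u v. w = u * q + v * p)}"
  have "p = 0 * q + 1 * p" by simp
  then have "p \<in> J" unfolding J_def using p_nz by blast
  then obtain w where w: "w \<in> J" and wmin: "\<And>w'. w' \<in> J \<Longrightarrow> degree w \<le> degree w'"
    using ex_has_least_nat[of "\<lambda>w. w \<in> J" p degree] by blast
  then obtain u v where uv: "w = u * q + v * p" and w0: "w \<noteq> 0" by (auto simp: J_def)
  have dvd: "\<exists>c a. c \<noteq> 0 \<and> smult c f = w * a" if f: "\<exists>u v. f = u * q + v * p" for f
  proof -
    obtain c a r where c: "c \<noteq> 0" "smult c f = w * a + r" "r = 0 \<or> degree r < degree w"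
      using pseudo_division[OF w0] .
    obtain u' v' where f': "f = u' * q + v' * p" using f by blast
    have "r = smult c f - w * a" using c by simp
    also have "\<dots> = (smult c u' - u * a) * q + (smult c v' - v * a) * p"
      by (simp add: f' uv algebra_simps smult_add_right)
    finally have "r = 0 \<or> r \<in> J" by (auto simp: J_def)
    then have "r = 0" using c(3) wmin by fastforce
    with c show ?thesis by auto
  qed
  have "degree w = 0"
  proof (rule ccontr)
    assume dw: "degree w \<noteq> 0"
    obtain c a where c: "c \<noteq> 0" "smult c p = w * a"
      using dvd[of p] by (metis add_0 mult_1 mult_zero_left)
    then have a0: "a \<noteq> 0" using p_nz by auto
    have "degree p = degree w + degree a"
      using c w0 a0 by (metis degree_mult_eq degree_smult_eq)
    then have "ieval a l \<noteq> 0" using dw a0 eq_zero_of_degree_less[of a] by auto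
    moreover have "ieval (smult c p) l = ieval (w * a) l" using c by simp
    ultimately have wl: "ieval w l = 0" by simp
    obtain c' a' where c': "c' \<noteq> 0" "smult c' q = w * a'"
      using dvd[of q] by (metis add.right_neutral mult_1 mult_zero_left)
    then have "of_int c' * ieval q l = ieval w l * ieval a' l" by (metis ieval_simps(6,7))
    with wl c'(1) assms show False by simp
  qed
  then obtain m where m: "w = [:m:]" using degree_eq_zeroE by blast
  have "ieval w l = ieval (u * q + v * p) l" using uv by simp
  then have "ieval u l * ieval q l = of_int m" using m by simp
  moreover have "m \<noteq> 0" using m w0 by auto
  ultimately show thesis using that by blast
qed

lemma K_inverse:
  assumes "x \<in> K"
  shows "inverse x \<in> K"
proof (cases "x = 0")
  case False
  obtain q t where q: "t \<noteq> 0" "of_int t * x = ieval q l" using assms by (rule K_E)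
  with False have "ieval q l \<noteq> 0" by auto
  then obtain u m where m: "m \<noteq> 0" "ieval u l * ieval q l = of_int m" by (rule ex_int_multiple)
  have "of_int m * inverse x = ieval u l * (of_int t * x) * inverse x" using m(2) q(2) by simp
  also have "\<dots> = ieval (smult t u) l" using False by simp
  finally have "of_int m * inverse x = ieval (smult t u) l" .
  then show ?thesis using m by (intro K_I)
qed simp

lemma K_divide: "x \<in> K \<Longrightarrow> y \<in> K \<Longrightarrow> x / y \<in> K"
  using K_mult[OF _ K_inverse] by (simp add: divide_inverse)

lemma K_reduced:
  assumes "x \<in> K"
  obtains q t where "t \<noteq> 0" "of_int t * x = ieval q l" "degree q < degree p"
proof -
  obtain q t where q: "t \<noteq> 0" "of_int t * x = ieval q l" using assms by (rule K_E)
  obtain c a r where c: "c \<noteq> 0" "smult c q = p * a + r" "r = 0 \<or> degree r < degree p"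
    using pseudo_division[OF p_nz] .
  have "ieval (smult c q) l = ieval (p * a + r) l" using c by simp
  then have "of_int (c * t) * x = ieval r l" using q by (simp add: mult.assoc)
  moreover have "degree r < degree p" using c(3) degree_pos by auto
  ultimately show thesis using that[of "c * t" r] c q by auto
qed

text \<open>Places \<open>F\<close> in 1/t times the lattice spanned by e, l e, ..., l^(d-1) e,
  which provides integer coordinates adapted to a prescribed direction e.\<close>

lemma common_denominator:
  assumes "finite F" "F \<subseteq> K" "e \<in> K" "e \<noteq> 0"
  shows "\<exists>t. t \<noteq> 0 \<and> (\<forall>z\<in>F. \<exists>q. degree q < degree p \<and> of_int t * z = ieval q l * e)"
  using assms(1,2)
proof (induction F rule: finite_induct)
  case empty
  show ?case by (intro exI[of _ 1]) auto
next
  case (insert z F)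
  then obtain t where t: "t \<noteq> 0" "\<And>z. z \<in> F \<Longrightarrow> \<exists>q. degree q < degree p \<and> of_int t * z = ieval q l * e"
    by auto
  have "z / e \<in> K" using insert assms by (auto intro: K_divide)
  then obtain q s where s: "s \<noteq> 0" "of_int s * (z / e) = ieval q l" "degree q < degree p"
    by (rule K_reduced)
  show ?case
  proof (intro exI[of _ "s * t"] conjI ballI)
    show "s * t \<noteq> 0" using s t by simp
    fix y assume "y \<in> insert z F"
    then consider "y = z" | "y \<in> F" by auto
    then show "\<exists>q. degree q < degree p \<and> of_int (s * t) * y = ieval q l * e"
    proof cases
      case 1
      have "of_int s * z = ieval q l * e" using s(2) assms(4) by (simp add: field_simps)
      then have "of_int (s * t) * y = ieval (smult t q) l * e" using 1 by simp
      moreover have "degree (smult t q) < degree p" using s(3) degree_smult_le le_less_trans by blast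
      ultimately show ?thesis by blast
    next
      case 2
      then obtain r where r: "degree r < degree p" "of_int t * y = ieval r l * e" using t by blast
      then have "of_int (s * t) * y = ieval (smult s r) l * e" by (simp add: mult.assoc)
      moreover have "degree (smult s r) < degree p" using r(1) degree_smult_le le_less_trans by blast
      ultimately show ?thesis by blast
    qed
  qed
qed

text \<open>Every bound in terms of the leading coefficient becomes, through 1 / l, one in terms of
  the constant coefficient.\<close>

lemma reflect_min_poly:
  assumes "l \<noteq> 0"
  shows "is_int_min_poly (reflect_poly p) (1 / l)" "degree (reflect_poly p) = degree p"
    "lead_coeff (reflect_poly p) = coeff p 0"
proof -
  have c0: "coeff p 0 \<noteq> 0"
  proof
    assume "coeff p 0 = 0"
    then obtain q where q: "p = pCons 0 q" by (metis coeff_pCons_0 pCons_cases)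
    then have "ieval p l = l * ieval q l" by (simp add: map_poly_pCons)
    then have "ieval q l = 0" using assms by simp
    moreover have "q \<noteq> 0" using q p_nz by auto
    ultimately have "degree p \<le> degree q" by (rule degree_le[rotated])
    with q \<open>q \<noteq> 0\<close> show False by simp
  qed
  then show deg: "degree (reflect_poly p) = degree p" by (rule degree_reflect_poly_eq)
  show "lead_coeff (reflect_poly p) = coeff p 0"
    using deg by (simp add: coeff_reflect_poly)
  show "is_int_min_poly (reflect_poly p) (1 / l)"
    unfolding is_int_min_poly_def
  proof (intro conjI allI impI notI)
    show "reflect_poly p = 0 \<Longrightarrow> False" using p_nz by simp
    show "ieval (reflect_poly p) (1 / l) = 0" using assms by (simp add: ieval_reflect_poly)
  next
    fix q assume q: "q \<noteq> 0 \<and> ieval q (1 / l) = 0"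
    then have "ieval (reflect_poly q) l = 0" using assms by (simp add: ieval_reflect_poly divide_inverse)
    then have "degree p \<le> degree (reflect_poly q)" using q by (intro degree_le) auto
    also have "\<dots> \<le> degree q" by (rule degree_reflect_poly_le)
    finally show "degree (reflect_poly p) \<le> degree q" by (simp add: deg)
  next
    fix r :: int assume r: "prime r" "\<forall>i. r dvd coeff (reflect_poly p) i"
    have "r dvd coeff p i" for i
    proof (cases "i \<le> degree p")
      case True
      then have "coeff (reflect_poly p) (degree p - i) = coeff p i" by (auto simp: coeff_reflect_poly)
      then show ?thesis using r(2) by metis
    qed (simp add: coeff_eq_0)
    with r min_poly show False by (auto simp: is_int_min_poly_def)
  qed
qed

end


section \<open>Indices of dilated lattices\<close>

context int_min_poly
begin

text \<open>The polynomial \<open>q\<close> vanishes at \<open>l\<close>, so its leading coefficient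
  is a multiple of that of \<open>p\<close>. As \<open>r\<close> has degree below d, that
  coefficient is a difference of two digits, too small to be a nonzero multiple.\<close>

lemma diff_of_residues:
  fixes c c' :: "nat \<Rightarrow> nat"
  assumes c: "\<And>i. i < k \<Longrightarrow> int (c i) < \<bar>lead_coeff p\<bar>" "\<And>i. i < k \<Longrightarrow> int (c' i) < \<bar>lead_coeff p\<bar>"
    and r: "degree r < degree p"
    and eq: "(\<Sum>i<k. (real (c i) - real (c' i)) * l ^ (degree p + i)) = ieval r l"
    and i: "i < k"
  shows "c i = c' i"
proof (rule ccontr)
  assume ne: "c i \<noteq> c' i"
  let ?d = "degree p"
  define q where "q = (\<Sum>i<k. monom (int (c i) - int (c' i)) (?d + i)) - r"
  have "ieval q l = 0" unfolding q_def using eq by simp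
  then have dvd: "lead_coeff p dvd lead_coeff q" by (rule lead_coeff_dvd)
  have cf: "coeff q (?d + j) = (if j < k then int (c j) - int (c' j) else 0)" for j
  proof -
    have "coeff q (?d + j) = (\<Sum>i<k. coeff (monom (int (c i) - int (c' i)) (?d + i)) (?d + j))"
      unfolding q_def using r by (simp add: coeff_sum coeff_eq_0)
    also have "\<dots> = (\<Sum>i<k. if i = j then int (c i) - int (c' i) else 0)"
      by (intro sum.cong) auto
    also have "\<dots> = (if j < k then int (c j) - int (c' j) else 0)" by (simp add: sum.delta)
    finally show ?thesis .
  qed
  have "coeff q (?d + i) \<noteq> 0" using cf[of i] ne i by simp
  then have "?d + i \<le> degree q" and q0: "q \<noteq> 0" by (auto intro: le_degree)
  then obtain j where j: "degree q = ?d + j" by (metis le_add1 le_iff_add le_trans)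
  have lc: "lead_coeff q \<noteq> 0" using q0 by simp
  then have jk: "j < k" "lead_coeff q = int (c j) - int (c' j)" using cf[of j] j by (auto split: if_splits)
  have "\<bar>lead_coeff q\<bar> < \<bar>lead_coeff p\<bar>" using c[OF jk(1)] jk by auto
  with dvd lc show False by (meson dvd_imp_le_int not_le)
qed

text \<open>Horner's scheme modulo \<Gamma>: the top element z is replaced by a representative
  \<rho> in \<open>G\<close>, and l (z - \<rho>), being in \<Gamma>, is absorbed by the next lower
  term. So \<open>k\<close> representatives determine the whole sum modulo \<Gamma>.\<close>

lemma reduce_to_residues:
  assumes \<Gamma>0: "\<And>x y. x \<in> \<Gamma> \<Longrightarrow> y \<in> \<Gamma> \<Longrightarrow> x - y \<in> \<Gamma>"
    and G: "\<And>z. z \<in> \<Gamma> \<Longrightarrow> \<exists>\<rho>\<in>G. l * (z - \<rho>) \<in> \<Gamma>" and G\<Gamma>: "G \<subseteq> \<Gamma>"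
    and z: "\<And>i. i \<le> k \<Longrightarrow> z i \<in> \<Gamma>"
  shows "\<exists>\<rho>\<in>PiE {..<k} (\<lambda>_. G). (\<Sum>i\<le>k. l ^ i * z i) - (\<Sum>i<k. l ^ Suc i * \<rho> i) \<in> \<Gamma>"
  using z
proof (induction k arbitrary: z)
  case 0
  then show ?case by simp
next
  case (Suc k)
  have \<Gamma>add: "x + y \<in> \<Gamma>" if "x \<in> \<Gamma>" "y \<in> \<Gamma>" for x y
    using \<Gamma>0[OF that(1) \<Gamma>0[OF \<Gamma>0[OF that(2) that(2)] that(2)]] by simp
  obtain \<rho>0 where \<rho>0: "\<rho>0 \<in> G" "l * (z (Suc k) - \<rho>0) \<in> \<Gamma>" using G Suc.prems[of "Suc k"] by auto
  define z' where "z' = z(k := z k + l * (z (Suc k) - \<rho>0))"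
  have z': "\<And>i. i \<le> k \<Longrightarrow> z' i \<in> \<Gamma>"
    using Suc.prems \<rho>0 \<Gamma>add by (auto simp: z'_def)
  from Suc.IH[of z'] z' obtain \<rho> where \<rho>: "\<rho> \<in> PiE {..<k} (\<lambda>_. G)"
    "(\<Sum>i\<le>k. l ^ i * z' i) - (\<Sum>i<k. l ^ Suc i * \<rho> i) \<in> \<Gamma>" by blast
  have s1: "(\<Sum>i\<le>k. l ^ i * z' i) = (\<Sum>i\<le>k. l ^ i * z i) + l ^ k * (l * (z (Suc k) - \<rho>0))"
  proof -
    have "(\<Sum>i\<le>k. l ^ i * z' i) = (\<Sum>i\<le>k. l ^ i * z i + (if i = k then l ^ k * (l * (z (Suc k) - \<rho>0)) else 0))"
      by (intro sum.cong) (auto simp: z'_def algebra_simps)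
    then show ?thesis by (simp add: sum.distrib)
  qed
  define \<rho>' where "\<rho>' = \<rho>(k := \<rho>0)"
  have "\<rho>' \<in> PiE {..<Suc k} (\<lambda>_. G)"
    using \<rho>(1) \<rho>0 unfolding \<rho>'_def lessThan_Suc by (intro PiE_fun_upd)
  moreover have "(\<Sum>i<Suc k. l ^ Suc i * \<rho>' i) = (\<Sum>i<k. l ^ Suc i * \<rho> i) + l ^ Suc k * \<rho>0"
    by (simp add: \<rho>'_def)
  then have "(\<Sum>i\<le>Suc k. l ^ i * z i) - (\<Sum>i<Suc k. l ^ Suc i * \<rho>' i)
      = (\<Sum>i\<le>k. l ^ i * z' i) - (\<Sum>i<k. l ^ Suc i * \<rho> i)"
    unfolding s1 by (simp add: algebra_simps)
  ultimately show ?case using \<rho>(2) by metis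
qed

text \<open>
  If there were only \<open>s < |a\<^sub>d|\<close> classes, then \<open>\<Gamma> + l\<Gamma> + \<dots> + l\<^sup>k\<Gamma>\<close> would have at most \<open>s\<^sup>k\<close> cosets of \<open>\<Gamma>\<close>,
  but the digit sums \<open>\<Sum> c\<^sub>i l\<^sup>i g\<close> with \<open>0 \<le> c\<^sub>i < |a\<^sub>d|\<close> and \<open>i \<ge> d\<close> are incongruent modulo the lattice
  spanned by \<open>g, \<dots>, l\<^sup>d\<^sup>-\<^sup>1g\<close>.
\<close>

lemma index_ge_lead_coeff:
  assumes \<Gamma>0: "\<And>x y. x \<in> \<Gamma> \<Longrightarrow> y \<in> \<Gamma> \<Longrightarrow> x - y \<in> \<Gamma>"
    and g: "g \<in> \<Gamma>" "g \<noteq> 0" and t: "t \<noteq> 0"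
    and rep: "\<And>z. z \<in> \<Gamma> \<Longrightarrow> \<exists>q. degree q < degree p \<and> of_int t * z = ieval q l * g"
  obtains G where "G \<subseteq> \<Gamma>" "finite G" "card G = nat \<bar>lead_coeff p\<bar>"
    "\<And>x y. x \<in> G \<Longrightarrow> y \<in> G \<Longrightarrow> x \<noteq> y \<Longrightarrow> l * (x - y) \<notin> \<Gamma>"
proof (rule ccontr)
  assume nth: "\<not> thesis"
  note witness = that
  let ?d = "degree p"
  define a where "a = nat \<bar>lead_coeff p\<bar>"
  have a0: "a > 0" using p_nz by (simp add: a_def)
  have zero: "0 \<in> \<Gamma>" using \<Gamma>0[OF g(1) g(1)] by simp
  have neg: "- x \<in> \<Gamma>" if "x \<in> \<Gamma>" for x using \<Gamma>0[OF zero that] by simp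
  have add: "x + y \<in> \<Gamma>" if "x \<in> \<Gamma>" "y \<in> \<Gamma>" for x y using \<Gamma>0[OF that(1) neg[OF that(2)]] by simp
  have nat_mult: "real n * x \<in> \<Gamma>" if "x \<in> \<Gamma>" for n x
    using that by (induction n) (auto simp: zero algebra_simps intro: add)
  \<comment> \<open>A largest set of pairwise incongruent elements; by maximality it represents
    every class.\<close>
  define P where "P = (\<lambda>G. G \<subseteq> \<Gamma> \<and> finite G \<and> (\<forall>x\<in>G. \<forall>y\<in>G. x \<noteq> y \<longrightarrow> l * (x - y) \<notin> \<Gamma>))"
  have bound: "card G < a" if "P G" for G
  proof (rule ccontr)
    assume "\<not> card G < a"
    then obtain H where H: "H \<subseteq> G" "card H = a"
      using that by (metis not_less obtain_subset_with_card_n)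
    have "H \<subseteq> \<Gamma>" "finite H" "\<And>x y. x \<in> H \<Longrightarrow> y \<in> H \<Longrightarrow> x \<noteq> y \<Longrightarrow> l * (x - y) \<notin> \<Gamma>"
      using that H unfolding P_def by (auto intro: finite_subset)
    then have thesis using H(2) unfolding a_def by (intro witness) auto
    with nth show False ..
  qed
  have P0: "P {0}" using zero by (simp add: P_def)
  obtain G where G: "P G" and Gmax: "\<And>G'. P G' \<Longrightarrow> card G' \<le> card G"
    using Lattices_Big.ex_has_greatest_nat[of P "{0}" card a] P0 bound by blast
  define s where "s = card G"
  have sa: "s < a" using bound[OF G] by (simp add: s_def)
  have s0: "s > 0" using Gmax[OF P0] by (simp add: s_def)
  have finG: "finite G" and G\<Gamma>: "G \<subseteq> \<Gamma>" using G by (auto simp: P_def)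
  have cover: "\<exists>\<rho>\<in>G. l * (z - \<rho>) \<in> \<Gamma>" if z: "z \<in> \<Gamma>" for z
  proof (cases "z \<in> G")
    case True
    then show ?thesis using zero by (auto intro!: bexI[of _ z])
  next
    case False
    show ?thesis
    proof (rule ccontr)
      assume n: "\<not> ?thesis"
      have "l * (\<rho> - z) \<notin> \<Gamma>" if "\<rho> \<in> G" for \<rho>
        using n that neg[of "l * (\<rho> - z)"] by (auto simp: algebra_simps)
      then have "P (insert z G)" using n G z by (auto simp: P_def)
      from Gmax[OF this] False finG show False by simp
    qed
  qed
  define m where "m = nat \<bar>t\<bar>"
  have m0: "m > 0" using t by (simp add: m_def)
  \<comment> \<open>\<open>k\<close> is so large that the a^k digit strings outnumber the s^(d+k)
    m^d colours.\<close>
  obtain k where k: "real s ^ ?d * real m ^ ?d < (real a / real s) ^ k"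
    using real_arch_pow[of "real a / real s" "real s ^ ?d * real m ^ ?d"] sa s0 by auto
  have "real (s ^ (?d + k) * m ^ ?d) = (real s ^ ?d * real m ^ ?d) * real s ^ k"
    by (simp add: power_add)
  also have "\<dots> < (real a / real s) ^ k * real s ^ k" using k s0 by (intro mult_strict_right_mono) auto
  also have "\<dots> = real (a ^ k)" using s0 by (simp add: power_divide)
  finally have big: "s ^ (?d + k) * m ^ ?d < a ^ k" using of_nat_less_iff by blast
  define C where "C = PiE {..<k} (\<lambda>_. {..<a})"
  define y where "y = (\<lambda>c. \<Sum>i<k. real (c i) * l ^ (?d + i) * g)"
  define good where "good = (\<lambda>c \<rho> q. \<rho> \<in> PiE {..<?d + k} (\<lambda>_. G) \<and> degree q < ?d \<and>
      of_int t * (y c - (\<Sum>i<?d + k. l ^ Suc i * \<rho> i)) = ieval q l * g)"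
  have "\<exists>\<rho> q. good c \<rho> q" for c
  proof -
    \<comment> \<open>The digits occupy the powers d, ..., d + k - 1. Slot d + k is padded with 0
      because \<open>reduce_to_residues\<close> sums up to and including its parameter.\<close>
    define z where "z = (\<lambda>i. if i < ?d \<or> i = ?d + k then 0 else real (c (i - ?d)) * g)"
    have "z i \<in> \<Gamma>" for i using zero nat_mult g by (auto simp: z_def)
    then obtain \<rho> where \<rho>: "\<rho> \<in> PiE {..<?d + k} (\<lambda>_. G)"
      "(\<Sum>i\<le>?d + k. l ^ i * z i) - (\<Sum>i<?d + k. l ^ Suc i * \<rho> i) \<in> \<Gamma>"
      using reduce_to_residues[OF \<Gamma>0 cover G\<Gamma>, of "?d + k" z] by blast
    have "(\<Sum>i\<le>?d + k. l ^ i * z i) = (\<Sum>i\<in>{?d..<?d + k}. l ^ i * z i)"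
      by (intro sum.mono_neutral_right) (auto simp: z_def)
    also have "\<dots> = (\<Sum>i\<in>{0 + ?d..<k + ?d}. l ^ i * z i)" by (simp add: add.commute)
    also have "\<dots> = (\<Sum>i\<in>{0..<k}. l ^ (i + ?d) * z (i + ?d))" by (rule sum.shift_bounds_nat_ivl)
    also have "\<dots> = y c" unfolding y_def lessThan_atLeast0
      by (intro sum.cong) (auto simp: z_def add.commute)
    finally have "y c - (\<Sum>i<?d + k. l ^ Suc i * \<rho> i) \<in> \<Gamma>" using \<rho>(2) by (simp only:)
    from rep[OF this] \<rho>(1) show ?thesis unfolding good_def by blast
  qed
  then obtain R Q where "\<And>c. good c (R c) (Q c)" by metis
  then have RQ: "\<And>c. R c \<in> PiE {..<?d + k} (\<lambda>_. G)" "\<And>c. degree (Q c) < ?d"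
    "\<And>c. of_int t * (y c - (\<Sum>i<?d + k. l ^ Suc i * R c i)) = ieval (Q c) l * g"
    unfolding good_def by blast+
  \<comment> \<open>\<Gamma> is only known to lie in 1/t times the lattice of \<open>g\<close>.
    Besides the representatives the colour therefore records the coefficients modulo
    \<open>t\<close>; equal colours give a difference in the lattice itself.\<close>
  define col where "col = (\<lambda>c. (R c, \<lambda>i\<in>{..<?d}. nat (coeff (Q c) i mod \<bar>t\<bar>)))"
  define T where "T = PiE {..<?d + k} (\<lambda>_. G) \<times> PiE {..<?d} (\<lambda>_. {..<m})"
  have "col ` C \<subseteq> T"
    unfolding col_def T_def using RQ(1) t
    by (intro image_subsetI SigmaI restrict_PiE_iff[THEN iffD2] ballI) (auto simp: m_def)
  moreover have "finite T" unfolding T_def using finG by (intro finite_cartesian_product finite_PiE) auto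
  ultimately have "card (col ` C) \<le> card T" by (intro card_mono)
  also have "card T = s ^ (?d + k) * m ^ ?d"
    unfolding T_def s_def by (simp add: card_cartesian_product card_PiE)
  also note big
  also have "a ^ k = card C" unfolding C_def by (simp add: card_PiE)
  finally have "\<not> inj_on col C" using card_image by fastforce
  then obtain c c' where cc: "c \<in> C" "c' \<in> C" "c \<noteq> c'" "col c = col c'" by (auto simp: inj_on_def)
  then have Req: "R c = R c'" and
    Qeq: "(\<lambda>i\<in>{..<?d}. nat (coeff (Q c) i mod \<bar>t\<bar>)) = (\<lambda>i\<in>{..<?d}. nat (coeff (Q c') i mod \<bar>t\<bar>))"
    by (auto simp: col_def)
  have "t dvd coeff (Q c - Q c') i" for i
  proof (cases "i < ?d")
    case True
    then have "nat (coeff (Q c) i mod \<bar>t\<bar>) = nat (coeff (Q c') i mod \<bar>t\<bar>)"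
      using fun_cong[OF Qeq, of i] by simp
    moreover have "coeff (Q c) i mod \<bar>t\<bar> \<ge> 0" "coeff (Q c') i mod \<bar>t\<bar> \<ge> 0" using t by auto
    ultimately have "coeff (Q c) i mod \<bar>t\<bar> = coeff (Q c') i mod \<bar>t\<bar>" by linarith
    then show ?thesis by (simp add: mod_eq_dvd_iff)
  next
    case False
    then show ?thesis using RQ(2)[of c] RQ(2)[of c'] by (simp add: coeff_eq_0)
  qed
  then have "[:t:] dvd Q c - Q c'" by (simp add: const_poly_dvd_iff)
  then obtain r where r: "Q c - Q c' = smult t r" by (auto elim!: dvdE)
  have "degree (Q c - Q c') < ?d" using RQ(2) by (intro degree_diff_less)
  then have rd: "degree r < ?d" using r t by simp
  have "of_int t * (y c - y c') = (ieval (Q c) l - ieval (Q c') l) * g"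
    using RQ(3)[of c] RQ(3)[of c'] Req by (simp add: algebra_simps)
  also have "ieval (Q c) l - ieval (Q c') l = of_int t * ieval r l"
    using r by (metis ieval_simps(5,7))
  finally have "y c - y c' = ieval r l * g" using t by simp
  moreover have "y c - y c' = (\<Sum>i<k. (real (c i) - real (c' i)) * l ^ (?d + i)) * g"
    unfolding y_def sum_distrib_right sum_subtractf[symmetric] by (intro sum.cong) (auto simp: algebra_simps)
  ultimately have eq: "(\<Sum>i<k. (real (c i) - real (c' i)) * l ^ (?d + i)) = ieval r l" using g(2) by simp
  have "c i = c' i" if "i < k" for i
  proof (rule diff_of_residues[OF _ _ rd eq that])
    show "int (c i) < \<bar>lead_coeff p\<bar>" "int (c' i) < \<bar>lead_coeff p\<bar>" if "i < k" for i
      using that cc a0 unfolding C_def a_def by (auto dest!: PiE_mem)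
  qed
  then have "c = c'" using cc unfolding C_def by (intro PiE_ext) auto
  with cc show False by simp
qed

end


section \<open>Iterated dilates\<close>

lemma card_set_plus_le:
  assumes "finite X" "finite Y"
  shows "card (X + Y) \<le> card X * card Y"
proof -
  have "X + Y = (\<lambda>(x, y). x + y) ` (X \<times> Y)" by (auto simp: set_plus_def)
  then show ?thesis using assms by (metis card_cartesian_product card_image_le finite_cartesian_product)
qed

definition dil :: "real \<Rightarrow> real set \<Rightarrow> real set" where
  "dil c A = (\<lambda>x. c * x) ` A"

lemma finite_dil [simp]: "finite A \<Longrightarrow> finite (dil c A)"
  by (simp add: dil_def)

lemma dil_empty_iff [simp]: "dil c A = {} \<longleftrightarrow> A = {}"
  by (simp add: dil_def)

lemma card_dil [simp]: "c \<noteq> 0 \<Longrightarrow> card (dil c A) = card A"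
  unfolding dil_def by (rule card_image) (auto simp: inj_on_def)

lemma dil_mono: "A \<subseteq> B \<Longrightarrow> dil c A \<subseteq> dil c B"
  by (auto simp: dil_def)

lemma dil_plus: "dil c (A + B) = dil c A + dil c B"
  by (force simp: dil_def set_plus_def algebra_simps image_iff)

lemma dil_uminus: "dil c (uminus ` A) = uminus ` dil c A"
  by (auto simp: dil_def image_image)

lemma dil_iterated_sum: "dil c (iterated_sum h A) = iterated_sum h (dil c A)"
  by (induction h) (auto simp: dil_plus, auto simp: dil_def)

lemma dil_dil: "dil c (dil c' A) = dil (c * c') A"
  by (auto simp: dil_def image_image mult.assoc)

lemma set_plus_subset: "X \<subseteq> X' \<Longrightarrow> Y \<subseteq> Y' \<Longrightarrow> X + Y \<subseteq> X' + Y'"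
  by (auto simp: set_plus_def)

text \<open>Covering by translates of h(A - A) is stable under sums, negation and, when A + l A is
  small, dilation by \<open>l\<close>, with constants independent of \<open>A\<close>. Bounds on
  cardinalities alone would not survive adding a dilate.\<close>

definition covered :: "real set \<Rightarrow> real \<Rightarrow> nat \<Rightarrow> real set \<Rightarrow> bool" where
  "covered A c h Y \<longleftrightarrow>
     (\<exists>F. finite F \<and> real (card F) \<le> c \<and> Y \<subseteq> F + iterated_sum h (A + uminus ` A))"

lemma covered_plus:
  assumes "covered A c h Y" "covered A c' h' Y'"
  shows "covered A (c * c') (h + h') (Y + Y')"
proof -
  let ?D = "A + uminus ` A"
  obtain F F' where F: "finite F" "real (card F) \<le> c" "Y \<subseteq> F + iterated_sum h ?D"
    "finite F'" "real (card F') \<le> c'" "Y' \<subseteq> F' + iterated_sum h' ?D"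
    using assms unfolding covered_def by blast
  have "Y + Y' \<subseteq> (F + iterated_sum h ?D) + (F' + iterated_sum h' ?D)"
    using F by (intro set_plus_subset)
  also have "\<dots> = (F + F') + iterated_sum (h + h') ?D"
    by (simp add: iterated_sum_add ac_simps)
  finally have "Y + Y' \<subseteq> (F + F') + iterated_sum (h + h') ?D" .
  moreover have "real (card (F + F')) \<le> c * c'"
  proof -
    have "real (card (F + F')) \<le> real (card F) * real (card F')"
      using card_set_plus_le[OF F(1,4)] by (metis of_nat_le_iff of_nat_mult)
    also have "\<dots> \<le> c * c'" using F by (intro mult_mono) auto
    finally show ?thesis .
  qed
  moreover have "finite (F + F')" using F by (intro finite_set_plus)
  ultimately show ?thesis unfolding covered_def by blast
qed

lemma covered_uminus:
  assumes "covered A c h Y"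
  shows "covered A c h (uminus ` Y)"
proof -
  let ?D = "A + uminus ` A"
  obtain F where F: "finite F" "real (card F) \<le> c" "Y \<subseteq> F + iterated_sum h ?D"
    using assms unfolding covered_def by blast
  have um: "uminus ` (U + V) = uminus ` U + uminus ` V" for U V :: "real set"
    by (force simp: set_plus_def image_iff)
  have D: "uminus ` ?D = ?D" unfolding um by (simp add: image_image add.commute)
  have "uminus ` Y \<subseteq> uminus ` (F + iterated_sum h ?D)" using F by auto
  also have "\<dots> = uminus ` F + uminus ` iterated_sum h ?D" by (rule um)
  also have "uminus ` iterated_sum h ?D = iterated_sum h ?D"
    by (simp only: D flip: iterated_sum_uminus)
  finally have "uminus ` Y \<subseteq> uminus ` F + iterated_sum h ?D" .
  moreover have "card (uminus ` F) = card F" by (simp add: card_image)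
  ultimately show ?thesis using F unfolding covered_def by (metis finite_imageI)
qed

lemma covered_iterated_sum:
  assumes "covered A c h Y"
  shows "covered A (c ^ k) (k * h) (iterated_sum k Y)"
proof (induction k)
  case 0
  have "{0} \<subseteq> {0} + iterated_sum 0 (A + uminus ` A)" by simp
  then show ?case unfolding covered_def by (intro exI[of _ "{0}"]) simp
next
  case (Suc k)
  from covered_plus[OF assms Suc] show ?case by simp
qed

lemma covered_mono: "covered A c h Y \<Longrightarrow> Y' \<subseteq> Y \<Longrightarrow> covered A c h Y'"
  unfolding covered_def by blast

section \<open>Consequences of a small sumset A + l A\<close>

context
  fixes A :: "real set" and l K :: real
  assumes fin: "finite A" and ne: "A \<noteq> {}" and l: "l \<noteq> 0"
    and K: "real (card (A + dil l A)) \<le> K * real (card A)"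
begin

lemma covered_self: "covered A 1 1 A"
proof -
  obtain a where a: "a \<in> A" using ne by auto
  have "A \<subseteq> {a} + iterated_sum 1 (A + uminus ` A)"
  proof
    fix x assume "x \<in> A"
    then have "x + - a \<in> A + uminus ` A" using a by (intro set_plus_intro imageI)
    then have "a + (x + - a) \<in> {a} + iterated_sum 1 (A + uminus ` A)"
      by (intro set_plus_intro) auto
    then show "x \<in> {a} + iterated_sum 1 (A + uminus ` A)" by simp
  qed
  then show ?thesis unfolding covered_def by (intro exI[of _ "{a}"]) simp
qed

lemma covered_dil_self: "covered A K 1 (dil l A)"
proof -
  obtain X where X: "X \<subseteq> dil l A" "card X * card A \<le> card (dil l A + A)"
    "dil l A \<subseteq> X + (A + uminus ` A)"
    using ruzsa_covering[of "dil l A" A] fin ne by auto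
  have "finite X" using X fin by (meson finite_dil finite_subset)
  moreover have "real (card X) * real (card A) \<le> K * real (card A)"
    using X(2) K by (metis add.commute le_trans of_nat_le_iff of_nat_mult order_trans)
  then have "real (card X) \<le> K" using fin ne by (simp add: card_gt_0_iff)
  ultimately show ?thesis using X(3) unfolding covered_def by (auto intro!: exI[of _ X])
qed

text \<open>Dilation turns h(A - A) into h(l A - l A), and l A is covered by at most
  \<open>K\<close> translates of A - A.\<close>

lemma covered_dil:
  assumes "covered A c h Y"
  shows "covered A (c * (K * K) ^ h) (2 * h) (dil l Y)"
proof -
  let ?D = "A + uminus ` A"
  obtain F where F: "finite F" "real (card F) \<le> c" "Y \<subseteq> F + iterated_sum h ?D"
    using assms unfolding covered_def by blast
  have "covered A c 0 (dil l F)"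
    unfolding covered_def using F(1,2) l by (intro exI[of _ "dil l F"]) simp
  moreover have "covered A (K * K) 2 (dil l ?D)"
    using covered_plus[OF covered_dil_self covered_uminus[OF covered_dil_self]]
    by (simp add: dil_plus dil_uminus numeral_2_eq_2)
  ultimately have "covered A (c * (K * K) ^ h) (0 + h * 2) (dil l F + iterated_sum h (dil l ?D))"
    by (intro covered_plus covered_iterated_sum)
  then have "covered A (c * (K * K) ^ h) (2 * h) (dil l (F + iterated_sum h ?D))"
    by (simp add: dil_plus dil_iterated_sum mult.commute)
  then show ?thesis using dil_mono[OF F(3)] by (rule covered_mono)
qed

lemma card_iterated_sum_le: "real (card (iterated_sum h (A + uminus ` A))) \<le> K ^ (2 * h) * real (card A)"
  using plunnecke[of A "dil l A" K h] fin ne K l by (simp add: add.commute)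

lemma card_covered_le:
  assumes "covered A c h Y"
  shows "real (card Y) \<le> c * K ^ (2 * h) * real (card A)"
proof -
  let ?D = "A + uminus ` A"
  obtain F where F: "finite F" "real (card F) \<le> c" "Y \<subseteq> F + iterated_sum h ?D"
    using assms unfolding covered_def by blast
  have finI: "finite (iterated_sum h ?D)" using fin by (intro finite_iterated_sum finite_set_plus) auto
  have "card Y \<le> card (F + iterated_sum h ?D)" using F finI by (intro card_mono finite_set_plus)
  also have "\<dots> \<le> card F * card (iterated_sum h ?D)" using F finI by (intro card_set_plus_le)
  finally have "real (card Y) \<le> real (card F) * real (card (iterated_sum h ?D))"
    by (metis of_nat_le_iff of_nat_mult)
  also have "\<dots> \<le> c * (K ^ (2 * h) * real (card A))"
    using F(2) card_iterated_sum_le by (intro mult_mono) auto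
  finally show ?thesis by (simp add: mult.assoc)
qed

text \<open>With D = A - A, both D + D + A and 3D have at most K^6 |A| points. The translate A - a
  lies in \<open>D\<close>, and adding any 2^i e from 2D keeps it in 3D; these are the pairs that
  \<open>ex_rich_coset\<close> asks for.\<close>

lemma ex_rich_direction:
  assumes j: "(K ^ 6) ^ j < real (card A)"
  obtains e b L where "e \<noteq> 0" "e \<in> iterated_sum 2 (A + uminus ` A)"
    "L \<subseteq> iterated_sum 3 (A + uminus ` A)"
    "\<And>x. x \<in> L \<Longrightarrow> \<exists>k::int. x = b + of_int k * e" "2 powr (real j / K ^ 6) \<le> real (card L)"
proof -
  define D where "D = A + uminus ` A"
  have finD: "finite D" unfolding D_def using fin by (auto intro: finite_set_plus)
  have cA: "card A > 0" using fin ne by (simp add: card_gt_0_iff)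
  obtain a where a: "a \<in> A" using ne by auto
  define T where "T = (\<lambda>x. x - a) ` A"
  have TD: "T \<subseteq> D"
  proof
    fix x assume "x \<in> T"
    then obtain y where y: "y \<in> A" "x = y + - a" by (auto simp: T_def)
    show "x \<in> D" unfolding D_def y(2) using a y(1) by (intro set_plus_intro imageI)
  qed
  have zeroD: "0 \<in> D" using TD a by (force simp: T_def)
  have cT: "card T = card A" unfolding T_def by (simp add: card_image inj_on_def)
  have it2: "iterated_sum 2 D = D + D" by (simp add: numeral_2_eq_2)
  have it3: "iterated_sum 3 D = D + (D + D)" by (simp add: numeral_3_eq_3)
  have K6: "real (card (iterated_sum 3 D)) \<le> K ^ 6 * real (card A)"
    using card_iterated_sum_le[of 3] by (simp add: D_def)
  have "covered A 1 3 (D + D + A)"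
  proof -
    have "covered A 1 1 D"
      unfolding covered_def D_def by (intro exI[of _ "{0}"]) simp
    from covered_plus[OF covered_plus[OF this this] covered_self] show ?thesis by (simp add: numeral_3_eq_3)
  qed
  from card_covered_le[OF this] have "real (card (D + D + A)) \<le> K ^ 6 * real (card A)" by simp
  then obtain e where e: "e \<noteq> 0" "\<And>i. i \<le> j \<Longrightarrow> 2 ^ i * e \<in> D + D"
    using ex_dyadic_multiples[OF fin ne D_def _ j] by blast
  have e2: "e \<in> iterated_sum 2 D" using e(2)[of 0] unfolding it2 by simp
  have shift: "t + 2 ^ i * e \<in> iterated_sum 3 D" if "i < j" "t \<in> T" for i t
    unfolding it3 using TD that e(2)[of i] by (intro set_plus_intro) auto
  have "T \<subseteq> iterated_sum 3 D"
  proof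
    fix t assume "t \<in> T"
    then have "t + (0 + 0) \<in> D + (D + D)" using TD zeroD by (intro set_plus_intro) auto
    then show "t \<in> iterated_sum 3 D" unfolding it3 by simp
  qed
  moreover have "T \<noteq> {}" using a by (auto simp: T_def)
  moreover have "finite (iterated_sum 3 D)" using finD by simp
  ultimately obtain b L where "L \<subseteq> iterated_sum 3 D" "\<And>x. x \<in> L \<Longrightarrow> \<exists>k::int. x = b + of_int k * e"
    "2 powr (real j / K ^ 6) \<le> real (card L)"
    using ex_rich_coset[of "iterated_sum 3 D" e T j "K ^ 6"] e(1) shift K6 cT by metis
  with e(1) e2 show thesis unfolding D_def by (intro that)
qed

end

text \<open>\<open>c\<close> and \<open>h\<close> are chosen before \<open>A\<close>: each dilation
  replaces them by c (K^2)^h and 2h, so they depend on \<open>i\<close> and \<open>K\<close>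
  only.\<close>

lemma covered_dil_power:
  fixes l K :: real
  assumes l: "l \<noteq> 0"
  shows "\<exists>c h. \<forall>A. finite A \<longrightarrow> A \<noteq> {} \<longrightarrow> real (card (A + dil l A)) \<le> K * real (card A) \<longrightarrow>
           covered A c h (dil (l ^ i) (iterated_sum 3 (A + uminus ` A)))"
proof (induction i)
  case 0
  have "covered A 1 3 (dil (l ^ 0) (iterated_sum 3 (A + uminus ` A)))" for A
    unfolding covered_def by (intro exI[of _ "{0}"]) (simp add: dil_def)
  then show ?case by blast
next
  case (Suc i)
  then obtain c h where ch: "\<And>A. finite A \<Longrightarrow> A \<noteq> {} \<Longrightarrow> real (card (A + dil l A)) \<le> K * real (card A) \<Longrightarrow>
           covered A c h (dil (l ^ i) (iterated_sum 3 (A + uminus ` A)))" by blast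
  have "covered A (c * (K * K) ^ h) (2 * h) (dil (l ^ Suc i) (iterated_sum 3 (A + uminus ` A)))"
    if A: "finite A" "A \<noteq> {}" "real (card (A + dil l A)) \<le> K * real (card A)" for A
    using covered_dil[OF A(1,2) l A(3) ch[OF A]] by (simp add: dil_dil)
  then show ?case by blast
qed

text \<open>Serves to count lines: for a rich line \<open>L\<close> in 3(A - A) with direction e,
  every line in direction l^i e that meets A + l A contributes |L| points to the set bounded
  here.\<close>

lemma card_sum_dil_power_le:
  fixes l K :: real
  assumes l: "l \<noteq> 0"
  shows "\<exists>C. \<forall>A. finite A \<longrightarrow> A \<noteq> {} \<longrightarrow> real (card (A + dil l A)) \<le> K * real (card A) \<longrightarrow>
           (\<forall>i<d. real (card (A + dil l A + dil (l ^ i) (iterated_sum 3 (A + uminus ` A)))) \<le> C * real (card A))"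
proof -
  let ?small = "\<lambda>A. finite A \<and> A \<noteq> {} \<and> real (card (A + dil l A)) \<le> K * real (card A)"
  let ?m = "\<lambda>i A. real (card (A + dil l A + dil (l ^ i) (iterated_sum 3 (A + uminus ` A))))"
  have "\<forall>i. \<exists>C. \<forall>A. ?small A \<longrightarrow> ?m i A \<le> C * real (card A)"
  proof
    fix i
    obtain c h where ch: "\<And>A. ?small A \<Longrightarrow> covered A c h (dil (l ^ i) (iterated_sum 3 (A + uminus ` A)))"
      using covered_dil_power[OF l, of K i] by blast
    have "?m i A \<le> (1 * K * c) * K ^ (2 * (1 + 1 + h)) * real (card A)" if "?small A" for A
      using card_covered_le[OF _ _ l _ covered_plus[OF covered_plus[OF covered_self covered_dil_self] ch]] that l
      by blast
    then show "\<exists>C. \<forall>A. ?small A \<longrightarrow> ?m i A \<le> C * real (card A)" by blast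
  qed
  then obtain C where C: "\<And>i A. ?small A \<Longrightarrow> ?m i A \<le> C i * real (card A)" by metis
  have le: "C i \<le> (\<Sum>i<d. \<bar>C i\<bar>)" if "i < d" for i
    using member_le_sum[of i "{..<d}" "\<lambda>i. \<bar>C i\<bar>"] that by auto
  have "?m i A \<le> (\<Sum>i<d. \<bar>C i\<bar>) * real (card A)" if A: "?small A" and i: "i < d" for i A
  proof -
    have "?m i A \<le> C i * real (card A)" using C[OF A] .
    also have "\<dots> \<le> (\<Sum>i<d. \<bar>C i\<bar>) * real (card A)" using le[OF i] by (intro mult_right_mono) auto
    finally show ?thesis .
  qed
  then show ?thesis by blast
qed


section \<open>Brunn-Minkowski with few lines\<close>

lemma ex_power_bracket:
  fixes M n :: real
  assumes "M > 1" "n > 1"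
  obtains j where "M ^ j < n" "n \<le> M ^ Suc j"
proof -
  obtain k where k: "n < M ^ k" using real_arch_pow[OF assms(1)] by blast
  define m where "m = (LEAST m. n \<le> M ^ m)"
  have m: "n \<le> M ^ m" unfolding m_def by (rule LeastI[of "\<lambda>m. n \<le> M ^ m" k]) (use k in simp)
  have "m \<noteq> 0" using m assms by (intro notI) simp
  then obtain j where j: "m = Suc j" using not0_implies_Suc by blast
  have "\<not> n \<le> M ^ j" using not_less_Least[of j "\<lambda>m. n \<le> M ^ m"] j unfolding m_def by simp
  then show thesis using that[of j] m j by simp
qed

text \<open>The origin of the power saving: with n about M^j, a rich line of 2^(j/M) points has
  about n^\<sigma> points for \<sigma> = log_M(2) / M. The factor 2 covers the passage from j + 1 to
  j.\<close>

lemma powr_le_two_powr: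
  fixes M n :: real
  assumes M: "M \<ge> 2" and n: "0 < n" "n \<le> M ^ Suc j"
  shows "n powr (log M 2 / M) \<le> 2 * 2 powr (real j / M)"
proof -
  have s0: "0 \<le> log M 2 / M" using M by simp
  have "n powr (log M 2 / M) \<le> (M ^ Suc j) powr (log M 2 / M)"
    using n s0 by (intro powr_mono2) auto
  also have "\<dots> = (M powr real (Suc j)) powr (log M 2 / M)"
    using M by (simp add: powr_realpow del: of_nat_Suc)
  also have "\<dots> = (M powr log M 2) powr (real (Suc j) / M)"
    unfolding powr_powr by (simp add: mult.commute)
  also have "\<dots> = 2 powr (real j / M) * 2 powr (1 / M)"
    using M by (simp add: add_divide_distrib powr_add)
  also have "\<dots> \<le> 2 powr (real j / M) * 2"
    using M powr_mono[of "1 / M" 1 2] by (intro mult_left_mono) auto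
  finally show ?thesis by simp
qed

context int_min_poly
begin

definition list_eval :: "int list \<Rightarrow> real" where
  "list_eval xs = (\<Sum>i<degree p. of_int (xs ! i) * l ^ i)"

lemma list_eval_map2:
  assumes "length xs = degree p" "length ys = degree p"
  shows "list_eval (map2 (+) xs ys) = list_eval xs + list_eval ys"
  unfolding list_eval_def sum.distrib[symmetric] using assms
  by (intro sum.cong) (auto simp: algebra_simps)

lemma ieval_eq_sum:
  assumes "degree q < degree p"
  shows "ieval q l = (\<Sum>i<degree p. of_int (coeff q i) * l ^ i)"
proof -
  have "ieval q l = (\<Sum>i\<le>degree q. of_int (coeff q i) * l ^ i)"
    by (simp add: poly_altdef coeff_map_poly degree_map_poly)
  also have "\<dots> = (\<Sum>i<degree p. of_int (coeff q i) * l ^ i)"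
    using assms by (intro sum.mono_neutral_left) (auto simp: coeff_eq_0)
  finally show ?thesis .
qed

text \<open>Linear independence of 1, l, ..., l^(d-1) over the integers.\<close>

lemma list_eval_inj:
  assumes "length xs = degree p" "length ys = degree p" "list_eval xs = list_eval ys"
  shows "xs = ys"
proof -
  define q where "q = (\<Sum>i<degree p. monom (xs ! i - ys ! i) i)"
  have cq: "coeff q j = (if j < degree p then xs ! j - ys ! j else 0)" for j
  proof -
    have "coeff q j = (\<Sum>i<degree p. if i = j then xs ! i - ys ! i else 0)"
      unfolding q_def coeff_sum by (intro sum.cong) auto
    then show ?thesis by (simp add: sum.delta)
  qed
  have "degree q < degree p" using cq degree_pos by (intro degree_lessI) auto
  moreover have "ieval q l = 0"
    using assms(3) by (simp add: q_def list_eval_def left_diff_distrib sum_subtractf)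
  ultimately have "q = 0" by (rule eq_zero_of_degree_less)
  then have "xs ! j = ys ! j" if "j < degree p" for j using cq[of j] that by simp
  then show ?thesis using assms by (intro nth_equalityI) auto
qed

lemma list_eval_update:
  assumes "length xs = degree p" "i < degree p"
  shows "list_eval (xs[i := xs ! i + c]) = list_eval xs + of_int c * l ^ i"
proof -
  have "list_eval (xs[i := xs ! i + c]) = (\<Sum>j<degree p. of_int (xs ! j) * l ^ j + (if j = i then of_int c * l ^ i else 0))"
    unfolding list_eval_def using assms
    by (intro sum.cong) (auto simp: nth_list_update algebra_simps)
  then show ?thesis using assms by (simp add: list_eval_def sum.distrib)
qed

text \<open>Pick one point of \<open>W\<close> on each line and add l^i L. If two of these sums
  agree, the chosen points differ by an integer multiple of the i-th basis vector l^i e / t, because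
  elements of \<open>L\<close> differ by integer multiples of e; so they lie on the same
  line.\<close>

lemma card_lines_le:
  assumes t: "t \<noteq> 0" and e: "e \<noteq> 0" and i: "i < degree p" and l: "l \<noteq> 0"
    and W: "finite W" "\<And>xs. xs \<in> W \<Longrightarrow> length xs = degree p"
    and L: "finite L" "\<And>x. x \<in> L \<Longrightarrow> \<exists>k::int. x = b + of_int k * e"
  shows "card ((\<lambda>xs. xs[i := 0]) ` W) * card L
         \<le> card ((\<lambda>xs. list_eval xs * e / of_int t) ` W + dil (l ^ i) L)"
proof -
  let ?dec = "\<lambda>xs. list_eval xs * e / of_int t"
  let ?I = "(\<lambda>xs. xs[i := 0]) ` W"
  define w where "w = inv_into W (\<lambda>xs. xs[i := 0])"
  have w: "w u \<in> W" "(w u)[i := 0] = u" if "u \<in> ?I" for u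
    unfolding w_def using inv_into_into[OF that] f_inv_into_f[OF that] .
  define f where "f = (\<lambda>(u, x). ?dec (w u) + l ^ i * x)"
  have "inj_on f (?I \<times> L)"
  proof (rule inj_onI)
    fix v v' assume v: "v \<in> ?I \<times> L" "v' \<in> ?I \<times> L" "f v = f v'"
    obtain u x u' x' where vv: "v = (u, x)" "v' = (u', x')" by (metis surj_pair)
    with v have u: "u \<in> ?I" "u' \<in> ?I" and x: "x \<in> L" "x' \<in> L" and eq: "f (u, x) = f (u', x')"
      by simp_all
    obtain k k' :: int where k: "x = b + of_int k * e" "x' = b + of_int k' * e" using L x by blast
    have "list_eval (w u) * e / of_int t - list_eval (w u') * e / of_int t = l ^ i * (of_int (k' - k) * e)"
      using eq by (simp add: f_def k algebra_simps)
    then have "(list_eval (w u) - list_eval (w u')) * e = (of_int (t * (k' - k)) * l ^ i) * e"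
      using t by (simp add: field_simps)
    then have "list_eval (w u) = list_eval (w u') + of_int (t * (k' - k)) * l ^ i" using e by simp
    also have "\<dots> = list_eval ((w u')[i := w u' ! i + t * (k' - k)])"
      using list_eval_update[of "w u'" i] W w u i by simp
    finally have "w u = (w u')[i := w u' ! i + t * (k' - k)]"
      using W w u by (intro list_eval_inj) auto
    then have "u = u'" using w u by (metis list_update_overwrite)
    with eq l show "v = v'" by (simp add: f_def vv)
  qed
  moreover have "f ` (?I \<times> L) \<subseteq> ?dec ` W + dil (l ^ i) L"
    using w by (force simp: f_def dil_def)
  ultimately have "card (?I \<times> L) \<le> card (?dec ` W + dil (l ^ i) L)"
    using W L by (intro card_inj_on_le[of f] finite_set_plus) auto
  then show ?thesis by (simp add: card_cartesian_product)
qed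

text \<open>Coordinates are taken with respect to e, l e, ..., l^(d-1) e for a rich direction e,
  which makes all d coordinate directions rich. Each line that meets the sumset then accounts for
  about n^\<sigma> points of a set of size O(n), so there are O(n^(1-\<sigma>)) lines.\<close>

lemma brunn_minkowski_dil:
  assumes l: "l \<noteq> 0" and K2: "K0 \<ge> 2"
  shows "\<exists>C>0. \<exists>\<sigma>>0. \<sigma> < 1 \<and> (\<forall>A X Y. finite A \<longrightarrow> A \<subseteq> K \<longrightarrow> real (card (A + dil l A)) \<le> K0 * real (card A) \<longrightarrow>
    X \<subseteq> A \<longrightarrow> Y \<subseteq> A \<longrightarrow> X \<noteq> {} \<longrightarrow> Y \<noteq> {} \<longrightarrow>
    (real (card X) powr (1 / real (degree p)) + real (card Y) powr (1 / real (degree p))) ^ degree p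
      \<le> real (card (X + dil l Y)) + C * real (card A) powr (1 - \<sigma>))"
proof -
  let ?d = "degree p"
  define M where "M = K0 ^ 6"
  have M2: "M \<ge> 2"
  proof -
    have "2 \<le> (2::real) ^ 6" by simp
    also have "\<dots> \<le> M" unfolding M_def using K2 by (intro power_mono) auto
    finally show ?thesis .
  qed
  define \<sigma> where "\<sigma> = log M 2 / M"
  have "log M 2 \<le> 1" using M2 by simp
  then have "log M 2 < M" using M2 by linarith
  then have \<sigma>: "0 < \<sigma>" "\<sigma> < 1" unfolding \<sigma>_def using M2 by (simp_all add: divide_less_eq)
  obtain C0 where C0: "\<And>A i. finite A \<Longrightarrow> A \<noteq> {} \<Longrightarrow> real (card (A + dil l A)) \<le> K0 * real (card A) \<Longrightarrow> i < ?d \<Longrightarrow>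
      real (card (A + dil l A + dil (l ^ i) (iterated_sum 3 (A + uminus ` A)))) \<le> C0 * real (card A)"
    using card_sum_dil_power_le[OF l, of K0 ?d] by blast
  \<comment> \<open>The first summand collects d directions with at most 2|C0| n^(1-\<sigma>) lines
    each. The second handles n = 1, where no \<open>j\<close> with M^j < n exists.\<close>
  define C where "C = 2 ^ ?d * (real ?d * (2 * \<bar>C0\<bar>)) + 2 ^ ?d"
  have C: "C > 0" "C \<ge> 2 ^ ?d" by (auto simp: C_def intro: add_nonneg_pos)
  have "(real (card X) powr (1 / real ?d) + real (card Y) powr (1 / real ?d)) ^ ?d
      \<le> real (card (X + dil l Y)) + C * real (card A) powr (1 - \<sigma>)"
    if A: "finite A" "A \<subseteq> K" and K0: "real (card (A + dil l A)) \<le> K0 * real (card A)"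
      and XY: "X \<subseteq> A" "Y \<subseteq> A" "X \<noteq> {}" "Y \<noteq> {}" for A X Y
  proof -
    define n where "n = real (card A)"
    have neA: "A \<noteq> {}" using XY by auto
    have finXY: "finite X" "finite Y" using XY A by (auto intro: finite_subset)
    have cA: "card A > 0" using A neA by (simp add: card_gt_0_iff)
    have le1: "card X \<le> card A" "card Y \<le> card A" using XY A by (auto intro: card_mono)
    show ?thesis
    proof (cases "card A = 1")
      case True
      have "card X > 0" "card Y > 0" using finXY XY by (auto simp: card_gt_0_iff)
      with True le1 have "card X = 1" "card Y = 1" by auto
      then have "(real (card X) powr (1 / real ?d) + real (card Y) powr (1 / real ?d)) ^ ?d = 2 ^ ?d" by simp
      also have "\<dots> \<le> C" by (rule C)
      finally show ?thesis using True by simp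
    next
      case False
      then have n1: "n > 1" using cA by (simp add: n_def)
      obtain j where j: "M ^ j < n" "n \<le> M ^ Suc j" using ex_power_bracket[of M n] M2 n1 by auto
      obtain e b L where e: "e \<noteq> 0" "e \<in> iterated_sum 2 (A + uminus ` A)"
        and L: "L \<subseteq> iterated_sum 3 (A + uminus ` A)" "\<And>x. x \<in> L \<Longrightarrow> \<exists>k::int. x = b + of_int k * e"
          "2 powr (real j / K0 ^ 6) \<le> real (card L)"
        using ex_rich_direction[OF A(1) neA l K0, of j] j unfolding n_def M_def by metis
      have n\<sigma>: "n powr \<sigma> \<le> 2 * real (card L)"
        using powr_le_two_powr[OF M2 _ j(2)] n1 L(3) unfolding \<sigma>_def M_def by linarith
      have finL: "finite L" using L(1) A by (meson finite_imageI finite_iterated_sum finite_set_plus finite_subset)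
      have "iterated_sum 2 (A + uminus ` A) \<subseteq> K"
        using A(2) by (auto simp: numeral_2_eq_2 elim!: set_plus_elim intro!: K_add)
      then have eK: "e \<in> K" using e by auto
      \<comment> \<open>\<open>X\<close> and l Y are encoded with one common denominator, so that
        their coordinates can be added.\<close>
      define F where "F = X \<union> dil l Y"
      have FK: "finite F" "F \<subseteq> K" using finXY XY A by (auto simp: F_def dil_def intro!: K_mult)
      obtain t where t: "t \<noteq> 0" "\<And>z. z \<in> F \<Longrightarrow> \<exists>q. degree q < ?d \<and> of_int t * z = ieval q l * e"
        using common_denominator[OF FK eK e(1)] by blast
      define dec where "dec = (\<lambda>xs. list_eval xs * e / of_int t)"
      have "\<exists>xs. length xs = ?d \<and> dec xs = z" if zF: "z \<in> F" for z
      proof -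
        obtain q where q: "degree q < ?d" "of_int t * z = ieval q l * e" using t(2)[OF zF] by blast
        have "list_eval (map (coeff q) [0..<?d]) = ieval q l"
          unfolding ieval_eq_sum[OF q(1)] list_eval_def by (intro sum.cong) auto
        then have "dec (map (coeff q) [0..<?d]) = z" using q(2) t(1) by (simp add: dec_def field_simps)
        then show ?thesis by (intro exI[of _ "map (coeff q) [0..<?d]"]) simp
      qed
      then obtain enc where enc: "\<And>z. z \<in> F \<Longrightarrow> length (enc z) = ?d" "\<And>z. z \<in> F \<Longrightarrow> dec (enc z) = z"
        by metis
      have enc_inj: "inj_on enc S" if "S \<subseteq> F" for S
        using enc(2) that by (metis (no_types, lifting) inj_onI subsetD)
      have dec_inj: "xs = ys" if "length xs = ?d" "length ys = ?d" "dec xs = dec ys" for xs ys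
        using that t(1) e(1) by (intro list_eval_inj) (auto simp: dec_def)
      have dec_add: "dec (map2 (+) xs ys) = dec xs + dec ys" if "length xs = ?d" "length ys = ?d" for xs ys
        using list_eval_map2[OF that] by (simp add: dec_def add_divide_distrib distrib_right)
      define X' where "X' = enc ` X"
      define Y' where "Y' = enc ` dil l Y"
      define W where "W = (\<lambda>(x, y). map2 (+) x y) ` (X' \<times> Y')"
      have cX: "card X' = card X" unfolding X'_def by (intro card_image enc_inj) (auto simp: F_def)
      have cY: "card Y' = card Y"
        unfolding Y'_def using l by (subst card_image[OF enc_inj]) (auto simp: F_def)
      have lenXY: "length x = ?d" if "x \<in> X' \<union> Y'" for x
        using that enc(1) by (auto simp: X'_def Y'_def F_def)
      have lenW: "length w = ?d" if "w \<in> W" for w using that lenXY by (auto simp: W_def)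
      have finW: "finite W" unfolding W_def X'_def Y'_def using finXY by auto
      have decW: "dec ` W = X + dil l Y"
      proof -
        have "dec ` W = (\<lambda>(x, y). dec (map2 (+) (enc x) (enc y))) ` (X \<times> dil l Y)"
          unfolding W_def X'_def Y'_def by (force simp: image_iff)
        also have "\<dots> = (\<lambda>(x, y). x + y) ` (X \<times> dil l Y)"
          by (intro image_cong refl) (auto simp: F_def dec_add enc)
        also have "\<dots> = X + dil l Y" by (auto simp: set_plus_def)
        finally show ?thesis .
      qed
      have cW: "card W = card (X + dil l Y)"
        unfolding decW[symmetric] by (rule card_image[symmetric]) (auto intro!: inj_onI dec_inj simp: lenW)
      have lines: "real (card ((\<lambda>xs. xs[i := 0]) ` W)) \<le> 2 * \<bar>C0\<bar> * n powr (1 - \<sigma>)" if i: "i < ?d" for i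
      proof -
        let ?I = "(\<lambda>xs. xs[i := 0]) ` W"
        have "card ?I * card L \<le> card (dec ` W + dil (l ^ i) L)"
          unfolding dec_def using t(1) e(1) i l finW lenW finL L(2) by (rule card_lines_le)
        also have "\<dots> \<le> card (A + dil l A + dil (l ^ i) (iterated_sum 3 (A + uminus ` A)))"
        proof (rule card_mono)
          show "finite (A + dil l A + dil (l ^ i) (iterated_sum 3 (A + uminus ` A)))"
            using A by (intro finite_set_plus finite_dil finite_iterated_sum finite_imageI)
          show "dec ` W + dil (l ^ i) L \<subseteq> A + dil l A + dil (l ^ i) (iterated_sum 3 (A + uminus ` A))"
            unfolding decW using XY L(1) by (intro set_plus_subset dil_mono)
        qed
        finally have "real (card ?I) * real (card L) \<le> real (card (A + dil l A + dil (l ^ i) (iterated_sum 3 (A + uminus ` A))))"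
          by (metis of_nat_le_iff of_nat_mult)
        also have "\<dots> \<le> C0 * n" unfolding n_def using C0[OF A(1) neA K0 i] .
        also have "\<dots> \<le> \<bar>C0\<bar> * n" using n1 by (intro mult_right_mono) auto
        finally have 1: "real (card ?I) * real (card L) \<le> \<bar>C0\<bar> * n" .
        have "real (card ?I) * n powr \<sigma> \<le> real (card ?I) * (2 * real (card L))"
          using n\<sigma> by (intro mult_left_mono) auto
        also have "\<dots> \<le> 2 * \<bar>C0\<bar> * n" using 1 by simp
        also have "2 * \<bar>C0\<bar> * n = (2 * \<bar>C0\<bar> * n powr (1 - \<sigma>)) * n powr \<sigma>"
        proof -
          have "n powr (1 - \<sigma>) * n powr \<sigma> = n" using n1 by (simp flip: powr_add)
          then show ?thesis by (simp add: mult.assoc)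
        qed
        finally have "real (card ?I) * n powr \<sigma> \<le> (2 * \<bar>C0\<bar> * n powr (1 - \<sigma>)) * n powr \<sigma>" .
        then show ?thesis using n1 by (simp add: mult_le_cancel_right)
      qed
      have "(real (card X') powr (1 / real ?d) + real (card Y') powr (1 / real ?d)) ^ ?d
         \<le> real (card W) + 2 ^ ?d * (\<Sum>i<?d. real (card ((\<lambda>xs. xs[i := 0]) ` W)))"
        unfolding W_def
      proof (rule brunn_minkowski_lists)
        show "finite X'" "finite Y'" "X' \<noteq> {}" "Y' \<noteq> {}" using finXY XY by (auto simp: X'_def Y'_def)
      qed (use degree_pos lenXY in auto)
      also have "\<dots> \<le> real (card W) + 2 ^ ?d * (\<Sum>i<?d. 2 * \<bar>C0\<bar> * n powr (1 - \<sigma>))"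
        by (intro add_left_mono mult_left_mono sum_mono lines) auto
      also have "\<dots> \<le> real (card W) + C * n powr (1 - \<sigma>)"
        by (simp add: C_def algebra_simps)
      finally show ?thesis unfolding cX cY cW n_def .
    qed
  qed
  with C(1) \<sigma> show ?thesis by blast
qed

end


section \<open>Splitting into classes\<close>

text \<open>Jensen's inequality for a concave power, with the tangent at the mean supplied by
  Young's inequality. The loss |I|^\<sigma> tends to 1 as \<sigma> tends to 0, which is why
  splitting is cheap.\<close>

lemma sum_powr_le:
  fixes x :: "'i \<Rightarrow> real"
  assumes fin: "finite I" and x: "\<And>i. i \<in> I \<Longrightarrow> 0 \<le> x i" and \<sigma>: "0 < \<sigma>" "\<sigma> < 1"
  shows "(\<Sum>i\<in>I. x i powr (1 - \<sigma>)) \<le> real (card I) powr \<sigma> * (\<Sum>i\<in>I. x i) powr (1 - \<sigma>)"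
proof (cases "(\<Sum>i\<in>I. x i) = 0")
  case True
  then have "x i = 0" if "i \<in> I" for i using fin x that by (simp add: sum_nonneg_eq_0_iff)
  then show ?thesis using \<sigma> by simp
next
  case False
  define n where "n = (\<Sum>i\<in>I. x i)"
  have n: "n > 0" using False x unfolding n_def by (metis less_eq_real_def sum_nonneg)
  define m where "m = real (card I)"
  have m: "m > 0" using False fin unfolding m_def by (cases "I = {}") (auto simp: card_gt_0_iff)
  have 1: "(x i * m / n) powr (1 - \<sigma>) \<le> (1 - \<sigma>) * (x i * m / n) + \<sigma>" if "i \<in> I" for i
  proof (cases "x i = 0")
    case False
    then have "x i * m / n > 0" using x[OF that] m n by simp
    from Youngs_inequality_0[of "1 - \<sigma>" \<sigma> "x i * m / n" 1, OF _ _ _ this] \<sigma> show ?thesis by simp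
  qed (use \<sigma> in auto)
  have "(\<Sum>i\<in>I. x i powr (1 - \<sigma>)) * (m / n) powr (1 - \<sigma>) = (\<Sum>i\<in>I. (x i * m / n) powr (1 - \<sigma>))"
    unfolding sum_distrib_right using x m n
    by (intro sum.cong refl) (simp add: powr_mult powr_divide)
  also have "\<dots> \<le> (\<Sum>i\<in>I. (1 - \<sigma>) * (x i * m / n) + \<sigma>)" by (intro sum_mono 1)
  also have "\<dots> = (1 - \<sigma>) * (n * m / n) + m * \<sigma>"
    unfolding sum.distrib by (simp add: n_def m_def sum_distrib_left sum_distrib_right sum_divide_distrib)
  also have "\<dots> = m" using n by (simp add: algebra_simps)
  finally have "(\<Sum>i\<in>I. x i powr (1 - \<sigma>)) \<le> m / (m / n) powr (1 - \<sigma>)"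
    using m n by (simp add: pos_le_divide_eq)
  also have "\<dots> = m powr 1 * n powr (1 - \<sigma>) / m powr (1 - \<sigma>)" using m n by (simp add: powr_divide)
  also have "\<dots> = m powr \<sigma> * n powr (1 - \<sigma>)" using m by (simp add: powr_diff)
  finally show ?thesis by (simp add: m_def n_def)
qed

text \<open>Used with \<open>l\<close> for the classes P and with 1 / l for the classes Q, so that
  facts on one partition hold for the other.\<close>

definition dclass :: "real \<Rightarrow> real set \<Rightarrow> real set \<Rightarrow> real \<Rightarrow> real set" where
  "dclass l \<Gamma> A x = {y \<in> A. l * (x - y) \<in> \<Gamma>}"

definition dclasses :: "real \<Rightarrow> real set \<Rightarrow> real set \<Rightarrow> real set set" where
  "dclasses l \<Gamma> A = dclass l \<Gamma> A ` A"

section \<open>Partitions by a group containing A - A\<close>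

locale diff_group =
  fixes \<Gamma> A :: "real set"
  assumes diff_mem: "x \<in> \<Gamma> \<Longrightarrow> y \<in> \<Gamma> \<Longrightarrow> x - y \<in> \<Gamma>"
    and diff_A: "x \<in> A \<Longrightarrow> y \<in> A \<Longrightarrow> x - y \<in> \<Gamma>"
    and fin: "finite A" and ne: "A \<noteq> {}"
begin

lemma zero_mem: "0 \<in> \<Gamma>"
  using diff_A ne by fastforce

lemma uminus_mem: "x \<in> \<Gamma> \<Longrightarrow> - x \<in> \<Gamma>"
  using diff_mem[OF zero_mem] by simp

lemma add_mem: "x \<in> \<Gamma> \<Longrightarrow> y \<in> \<Gamma> \<Longrightarrow> x + y \<in> \<Gamma>"
  using diff_mem[OF _ uminus_mem] by fastforce

lemma dclass_eq:
  assumes "y \<in> dclass l \<Gamma> A x"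
  shows "dclass l \<Gamma> A y = dclass l \<Gamma> A x"
proof -
  have xy: "l * (x - y) \<in> \<Gamma>" using assms by (simp add: dclass_def)
  have "l * (y - z) \<in> \<Gamma> \<longleftrightarrow> l * (x - z) \<in> \<Gamma>" for z
    using add_mem[OF xy, of "l * (y - z)"] diff_mem[OF _ xy, of "l * (x - z)"] by (auto simp: algebra_simps)
  then show ?thesis by (simp add: dclass_def)
qed

lemma dclass_self: "x \<in> A \<Longrightarrow> x \<in> dclass l \<Gamma> A x"
  using zero_mem by (simp add: dclass_def)

lemma dclasses_eqI:
  assumes "P \<in> dclasses l \<Gamma> A" "P' \<in> dclasses l \<Gamma> A" "x \<in> P" "y \<in> P'" "l * (x - y) \<in> \<Gamma>"
  shows "P = P'"
proof -
  obtain u v where uv: "P = dclass l \<Gamma> A u" "P' = dclass l \<Gamma> A v" using assms(1,2) by (auto simp: dclasses_def)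
  have "P = dclass l \<Gamma> A x" "P' = dclass l \<Gamma> A y" using dclass_eq assms(3,4) uv by metis+
  moreover have "y \<in> dclass l \<Gamma> A x" using assms uv by (auto simp: dclass_def)
  ultimately show ?thesis using dclass_eq by metis
qed

lemma dclasses_diff:
  assumes "P \<in> dclasses l \<Gamma> A" "x \<in> P" "y \<in> P"
  shows "l * (x - y) \<in> \<Gamma>"
proof -
  obtain u where u: "P = dclass l \<Gamma> A u" using assms(1) by (auto simp: dclasses_def)
  then have "l * (u - y) \<in> \<Gamma>" "l * (u - x) \<in> \<Gamma>" using assms by (auto simp: dclass_def)
  from diff_mem[OF this] show ?thesis by (simp add: algebra_simps)
qed

lemma dclasses_disjoint: "P \<in> dclasses l \<Gamma> A \<Longrightarrow> P' \<in> dclasses l \<Gamma> A \<Longrightarrow> P \<noteq> P' \<Longrightarrow> P \<inter> P' = {}"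
  using dclasses_eqI[of P l P'] zero_mem by fastforce

lemma dclasses_subset: "P \<in> dclasses l \<Gamma> A \<Longrightarrow> P \<subseteq> A"
  by (auto simp: dclasses_def dclass_def)

lemma dclasses_nonempty: "P \<in> dclasses l \<Gamma> A \<Longrightarrow> P \<noteq> {}"
  using dclass_self by (auto simp: dclasses_def)

lemma dclasses_finite: "P \<in> dclasses l \<Gamma> A \<Longrightarrow> finite P"
  using dclasses_subset fin finite_subset by blast

lemma finite_dclasses: "finite (dclasses l \<Gamma> A)"
  using fin by (simp add: dclasses_def)

lemma dclasses_ne: "dclasses l \<Gamma> A \<noteq> {}"
  using ne by (simp add: dclasses_def)

lemma Union_dclasses: "\<Union> (dclasses l \<Gamma> A) = A"
  using dclass_self by (auto simp: dclasses_def dclass_def)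

lemma card_eq_sum_dclasses:
  assumes "B \<subseteq> A"
  shows "card B = (\<Sum>P\<in>dclasses l \<Gamma> A. card (B \<inter> P))"
proof -
  have "B = (\<Union>P\<in>dclasses l \<Gamma> A. B \<inter> P)" using Union_dclasses[of l] assms by blast
  also have "card \<dots> = (\<Sum>P\<in>dclasses l \<Gamma> A. card (B \<inter> P))"
    using finite_dclasses dclasses_finite dclasses_disjoint by (intro card_UN_disjoint) blast+
  finally show ?thesis .
qed

text \<open>The sums A + l P over distinct classes P are disjoint, since a coincidence would put l
  (x - x') in A - A; each has at least |A| points. The second bound treats l A + Q in the same
  way.\<close>

lemma card_dclasses_le:
  assumes l: "l \<noteq> 0"
  shows "card (dclasses l \<Gamma> A) * card A \<le> card (A + dil l A)"
    and "card (dclasses (1 / l) \<Gamma> A) * card A \<le> card (A + dil l A)"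
proof -
  have finS: "finite (A + dil l A)" using fin by (intro finite_set_plus finite_dil)
  have "card (dclasses l \<Gamma> A) * card A = (\<Sum>P\<in>dclasses l \<Gamma> A. card A)" by simp
  also have "\<dots> \<le> (\<Sum>P\<in>dclasses l \<Gamma> A. card (A + dil l P))"
    using fin dclasses_finite dclasses_nonempty by (intro sum_mono card_le_card_set_plus) auto
  also have "\<dots> = card (\<Union>P\<in>dclasses l \<Gamma> A. A + dil l P)"
  proof (rule card_UN_disjoint[symmetric])
    show "\<forall>P\<in>dclasses l \<Gamma> A. finite (A + dil l P)"
      using fin dclasses_finite by (auto intro!: finite_set_plus)
    show "\<forall>P\<in>dclasses l \<Gamma> A. \<forall>P'\<in>dclasses l \<Gamma> A. P \<noteq> P' \<longrightarrow> (A + dil l P) \<inter> (A + dil l P') = {}"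
    proof (intro ballI impI, rule ccontr)
      fix P P' assume P: "P \<in> dclasses l \<Gamma> A" "P' \<in> dclasses l \<Gamma> A" "P \<noteq> P'"
        and "(A + dil l P) \<inter> (A + dil l P') \<noteq> {}"
      then obtain a a' x x' where *: "a \<in> A" "a' \<in> A" "x \<in> P" "x' \<in> P'" "a + l * x = a' + l * x'"
        by (auto simp: dil_def elim!: set_plus_elim)
      then have "l * (x - x') = a' - a" by (simp add: algebra_simps)
      with * have "l * (x - x') \<in> \<Gamma>" using diff_A by simp
      with dclasses_eqI P * show False by blast
    qed
  qed (rule finite_dclasses)
  also have "\<dots> \<le> card (A + dil l A)"
    using finS dclasses_subset dil_mono by (intro card_mono UN_least set_plus_subset) auto
  finally show "card (dclasses l \<Gamma> A) * card A \<le> card (A + dil l A)" .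
  have "card (dclasses (1 / l) \<Gamma> A) * card A = (\<Sum>Q\<in>dclasses (1 / l) \<Gamma> A. card (dil l A))" using l by simp
  also have "\<dots> \<le> (\<Sum>Q\<in>dclasses (1 / l) \<Gamma> A. card (dil l A + Q))"
    using fin dclasses_finite dclasses_nonempty by (intro sum_mono card_le_card_set_plus) auto
  also have "\<dots> = card (\<Union>Q\<in>dclasses (1 / l) \<Gamma> A. dil l A + Q)"
  proof (rule card_UN_disjoint[symmetric])
    show "\<forall>Q\<in>dclasses (1 / l) \<Gamma> A. finite (dil l A + Q)"
      using fin dclasses_finite by (auto intro!: finite_set_plus)
    show "\<forall>P\<in>dclasses (1 / l) \<Gamma> A. \<forall>P'\<in>dclasses (1 / l) \<Gamma> A. P \<noteq> P' \<longrightarrow> (dil l A + P) \<inter> (dil l A + P') = {}"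
    proof (intro ballI impI, rule ccontr)
      fix P P' assume P: "P \<in> dclasses (1 / l) \<Gamma> A" "P' \<in> dclasses (1 / l) \<Gamma> A" "P \<noteq> P'"
        and "(dil l A + P) \<inter> (dil l A + P') \<noteq> {}"
      then obtain a a' x x' where *: "a \<in> A" "a' \<in> A" "x \<in> P" "x' \<in> P'" "l * a + x = l * a' + x'"
        by (auto simp: dil_def elim!: set_plus_elim)
      then have "1 / l * (x - x') = a' - a" using l by (simp add: field_simps)
      with * have "1 / l * (x - x') \<in> \<Gamma>" using diff_A by simp
      with dclasses_eqI P * show False by blast
    qed
  qed (rule finite_dclasses)
  also have "\<dots> \<le> card (dil l A + A)"
    using fin dclasses_subset by (intro card_mono UN_least set_plus_subset finite_set_plus) auto
  finally show "card (dclasses (1 / l) \<Gamma> A) * card A \<le> card (A + dil l A)" by (simp add: add.commute)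
qed

text \<open>Both classes can be read off a sum: u + l v = u' + l v' gives l (v - v') = u' - u and (u
  - u') / l = v' - v, both in \<Gamma>, so v, v' share a class P and u, u' share a class Q.\<close>

lemma sum_card_dclasses_le:
  assumes l: "l \<noteq> 0"
  shows "(\<Sum>(P, Q)\<in>dclasses l \<Gamma> A \<times> dclasses (1 / l) \<Gamma> A. card (Q + dil l P)) \<le> card (A + dil l A)"
proof -
  let ?T = "dclasses l \<Gamma> A \<times> dclasses (1 / l) \<Gamma> A"
  have "(\<Sum>x\<in>?T. card (snd x + dil l (fst x))) = card (\<Union>x\<in>?T. snd x + dil l (fst x))"
  proof (rule card_UN_disjoint[symmetric])
    show "finite ?T" using finite_dclasses by simp
    show "\<forall>x\<in>?T. finite (snd x + dil l (fst x))" using dclasses_finite by (auto intro!: finite_set_plus)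
    show "\<forall>x\<in>?T. \<forall>y\<in>?T. x \<noteq> y \<longrightarrow> (snd x + dil l (fst x)) \<inter> (snd y + dil l (fst y)) = {}"
    proof (intro ballI impI, rule ccontr)
      fix x y assume xy: "x \<in> ?T" "y \<in> ?T" "x \<noteq> y" and "(snd x + dil l (fst x)) \<inter> (snd y + dil l (fst y)) \<noteq> {}"
      then obtain u v u' v' where *: "u \<in> snd x" "v \<in> fst x" "u' \<in> snd y" "v' \<in> fst y" "u + l * v = u' + l * v'"
        by (auto simp: dil_def elim!: set_plus_elim)
      have A: "u \<in> A" "v \<in> A" "u' \<in> A" "v' \<in> A" using * xy dclasses_subset by fastforce+
      have "l * (v - v') = u' - u" using *(5) by (simp add: algebra_simps)
      then have "l * (v - v') \<in> \<Gamma>" using A diff_A by simp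
      then have 1: "fst x = fst y" using dclasses_eqI[of "fst x" l "fst y" v v'] xy * by auto
      have "1 / l * (u - u') = v' - v" using *(5) l by (simp add: field_simps)
      then have "1 / l * (u - u') \<in> \<Gamma>" using A diff_A by simp
      then have "snd x = snd y" using dclasses_eqI[of "snd x" "1 / l" "snd y" u u'] xy * by auto
      with 1 xy(3) show False by (simp add: prod_eq_iff)
    qed
  qed
  also have "\<dots> \<le> card (A + dil l A)"
  proof (rule card_mono)
    show "finite (A + dil l A)" using fin by (intro finite_set_plus finite_dil)
    show "(\<Union>x\<in>?T. snd x + dil l (fst x)) \<subseteq> A + dil l A"
    proof (rule UN_least)
      fix x assume "x \<in> ?T"
      then have "fst x \<subseteq> A" "snd x \<subseteq> A"
        using dclasses_subset[of "fst x" l] dclasses_subset[of "snd x" "1 / l"] by auto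
      then show "snd x + dil l (fst x) \<subseteq> A + dil l A" by (intro set_plus_subset dil_mono)
    qed
  qed
  finally show ?thesis by (simp add: case_prod_unfold)
qed

text \<open>\<open>E0\<close> is the excess allowed to \<open>A\<close> itself: 0 at the first
  level, the bound inherited from it at the second. All pieces but one obey the lower bound, so the
  remaining one exceeds it by at most \<open>E\<close>, which is \<open>E0\<close> plus the growth
  of the error terms under splitting into at most (2H)(2H) pieces. As to sizes, some class P0 has n
  / (2H) points; |P0| \<le> |Q + l P0| then forces |Q| \<ge> n / (4H^2) for every Q, and |Q| \<le>
  |Q + l P| forces |P \<inter> Q| \<ge> n / (8H^3).\<close>

lemma split_bounds:
  fixes H D \<sigma> E0 l :: real
  defines "g \<equiv> \<lambda>x. H * x - D * x powr (1 - \<sigma>)"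
  defines "E \<equiv> E0 + ((4 * H\<^sup>2) powr \<sigma> - 1) * (D * real (card A) powr (1 - \<sigma>))"
  assumes l: "l \<noteq> 0" and H: "H \<ge> 1" and D: "D \<ge> 0" and \<sigma>: "0 < \<sigma>" "\<sigma> < 1"
    and IH: "\<And>B. B \<subset> A \<Longrightarrow> g (real (card B)) \<le> real (card (B + dil l B))"
    and up: "real (card (A + dil l A)) \<le> g (real (card A)) + E0"
    and E0_nonneg: "0 \<le> E0" and E0: "E0 \<le> H * real (card A)" and E: "E \<le> real (card A) / (8 * H\<^sup>2)"
    and P: "P \<in> dclasses l \<Gamma> A" and Q: "Q \<in> dclasses (1 / l) \<Gamma> A"
  shows "real (card (Q + dil l P)) \<le> g (real (card (P \<inter> Q))) + E"
    and "real (card A) / (8 * H ^ 3) \<le> real (card (P \<inter> Q))"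
    and "real (card (Q + dil l P)) \<le> real (card ((P \<inter> Q) + dil l (P \<inter> Q))) + E"
proof -
  let ?I = "dclasses l \<Gamma> A" and ?J = "dclasses (1 / l) \<Gamma> A"
  define n where "n = real (card A)"
  have n: "n > 0" using fin ne by (simp add: n_def card_gt_0_iff)
  have Dn: "0 \<le> D * x powr (1 - \<sigma>)" for x using D by simp
  have sum2H: "real (card (A + dil l A)) \<le> 2 * H * n"
    using up E0 Dn[of n] unfolding g_def n_def by linarith
  have "real (card ?I) * n \<le> 2 * H * n"
    using card_dclasses_le(1)[OF l] sum2H unfolding n_def by (metis of_nat_le_iff of_nat_mult order_trans)
  then have cI: "real (card ?I) \<le> 2 * H" using n by simp
  have "real (card ?J) * n \<le> 2 * H * n"
    using card_dclasses_le(2)[OF l] sum2H unfolding n_def by (metis of_nat_le_iff of_nat_mult order_trans)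
  then have cJ: "real (card ?J) \<le> 2 * H" using n by simp
  have "real (card (?I \<times> ?J)) \<le> (2 * H) * (2 * H)"
    unfolding card_cartesian_product of_nat_mult using cI cJ H by (intro mult_mono) auto
  then have m: "real (card (?I \<times> ?J)) \<le> 4 * H\<^sup>2" by (simp add: power2_eq_square)
  have finT: "finite (?I \<times> ?J)" using finite_dclasses by simp
  have sumn: "(\<Sum>x\<in>?I \<times> ?J. real (card (fst x \<inter> snd x))) = n"
  proof -
    have "(\<Sum>x\<in>?I \<times> ?J. card (fst x \<inter> snd x)) = (\<Sum>P\<in>?I. \<Sum>Q\<in>?J. card (P \<inter> Q))"
      by (simp add: sum.cartesian_product case_prod_unfold)
    also have "\<dots> = (\<Sum>P\<in>?I. card P)" using card_eq_sum_dclasses dclasses_subset by (intro sum.cong) auto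
    also have "\<dots> = (\<Sum>P\<in>?I. card (A \<inter> P))" using dclasses_subset by (intro sum.cong refl) (simp add: Int_absorb1)
    also have "\<dots> = card A" using card_eq_sum_dclasses[of A l] by simp
    finally show ?thesis by (simp add: n_def flip: of_nat_sum)
  qed
  have sub: "real (card ((P \<inter> Q) + dil l (P \<inter> Q))) \<le> real (card (Q + dil l P))" if "P \<in> ?I" "Q \<in> ?J" for P Q
  proof -
    have "finite (Q + dil l P)" using that dclasses_finite by (intro finite_set_plus) auto
    then show ?thesis using card_mono set_plus_subset[of "P \<inter> Q" Q "dil l (P \<inter> Q)" "dil l P"] dil_mono[of "P \<inter> Q" P l]
      by (metis Int_lower1 Int_lower2 of_nat_le_iff)
  qed
  \<comment> \<open>A piece equal to \<open>A\<close> is the only piece; this is the one case in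
    which the hypothesis on proper subsets says nothing.\<close>
  have triv: "P = A \<and> Q = A \<and> ?I = {A} \<and> ?J = {A}" if "P \<in> ?I" "Q \<in> ?J" "P \<inter> Q = A" for P Q
  proof -
    have PA: "P = A" "Q = A" using that dclasses_subset by blast+
    have "P' = A" if "P' \<in> ?I" for P'
      using that \<open>P \<in> ?I\<close> PA dclasses_disjoint[of P' l P] dclasses_nonempty[of P' l] dclasses_subset[of P' l] by blast
    moreover have "Q' = A" if "Q' \<in> ?J" for Q'
      using that \<open>Q \<in> ?J\<close> PA dclasses_disjoint[of Q' "1 / l" Q] dclasses_nonempty[of Q' "1 / l"] dclasses_subset[of Q' "1 / l"] by blast
    ultimately show ?thesis using PA that by blast
  qed
  have b1: "real (card (Q + dil l P)) \<le> g (real (card (P \<inter> Q))) + E" if P: "P \<in> ?I" and Q: "Q \<in> ?J" for P Q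
  proof -
    let ?R = "?I \<times> ?J - {(P, Q)}"
    have PQ: "(P, Q) \<in> ?I \<times> ?J" using P Q by simp
    have oth: "g (real (card (fst x \<inter> snd x))) \<le> real (card (snd x + dil l (fst x)))" if x: "x \<in> ?R" for x
    proof -
      have xI: "fst x \<in> ?I" "snd x \<in> ?J" using x by auto
      have "fst x \<inter> snd x \<noteq> A"
      proof
        assume "fst x \<inter> snd x = A"
        from triv[OF xI this] P Q x show False by (auto simp: prod_eq_iff)
      qed
      then have "fst x \<inter> snd x \<subset> A" using xI dclasses_subset by blast
      from IH[OF this] sub[OF xI] show ?thesis by linarith
    qed
    have "real (card (Q + dil l P)) + (\<Sum>x\<in>?R. g (real (card (fst x \<inter> snd x))))
        \<le> real (card (Q + dil l P)) + (\<Sum>x\<in>?R. real (card (snd x + dil l (fst x))))"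
      using oth by (intro add_left_mono sum_mono)
    also have "\<dots> = (\<Sum>x\<in>?I \<times> ?J. real (card (snd x + dil l (fst x))))"
      using sum.remove[OF finT PQ, of "\<lambda>x. real (card (snd x + dil l (fst x)))"] by simp
    also have "\<dots> \<le> real (card (A + dil l A))"
      using sum_card_dclasses_le[OF l] by (simp add: case_prod_unfold flip: of_nat_sum)
    also have "\<dots> \<le> g n + E0" using up by (simp add: n_def)
    finally have 1: "real (card (Q + dil l P)) + (\<Sum>x\<in>?R. g (real (card (fst x \<inter> snd x)))) \<le> g n + E0" .
    have "(\<Sum>x\<in>?R. g (real (card (fst x \<inter> snd x)))) = (\<Sum>x\<in>?I \<times> ?J. g (real (card (fst x \<inter> snd x)))) - g (real (card (P \<inter> Q)))"
      using sum.remove[OF finT PQ, of "\<lambda>x. g (real (card (fst x \<inter> snd x)))"] by simp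
    moreover have "(\<Sum>x\<in>?I \<times> ?J. g (real (card (fst x \<inter> snd x))))
        = H * n - D * (\<Sum>x\<in>?I \<times> ?J. real (card (fst x \<inter> snd x)) powr (1 - \<sigma>))"
      unfolding g_def sum_subtractf sum_distrib_left[symmetric] sumn ..
    moreover have "D * (\<Sum>x\<in>?I \<times> ?J. real (card (fst x \<inter> snd x)) powr (1 - \<sigma>)) \<le> D * ((4 * H\<^sup>2) powr \<sigma> * n powr (1 - \<sigma>))"
    proof (rule mult_left_mono[OF _ D])
      have "(\<Sum>x\<in>?I \<times> ?J. real (card (fst x \<inter> snd x)) powr (1 - \<sigma>))
          \<le> real (card (?I \<times> ?J)) powr \<sigma> * n powr (1 - \<sigma>)"
        unfolding sumn[symmetric] using finT \<sigma> by (intro sum_powr_le) auto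
      also have "\<dots> \<le> (4 * H\<^sup>2) powr \<sigma> * n powr (1 - \<sigma>)"
        using m \<sigma> by (intro mult_right_mono powr_mono2) auto
      finally show "(\<Sum>x\<in>?I \<times> ?J. real (card (fst x \<inter> snd x)) powr (1 - \<sigma>)) \<le> (4 * H\<^sup>2) powr \<sigma> * n powr (1 - \<sigma>)" .
    qed
    ultimately show ?thesis using 1 unfolding g_def E_def n_def[symmetric] by (simp add: algebra_simps)
  qed
  show "real (card (Q + dil l P)) \<le> g (real (card (P \<inter> Q))) + E" using b1[OF P Q] .
  show "real (card (Q + dil l P)) \<le> real (card ((P \<inter> Q) + dil l (P \<inter> Q))) + E"
  proof (cases "P \<inter> Q = A")
    case True
    have "1 \<le> (4 * H\<^sup>2) powr \<sigma>"
    proof (rule ge_one_powr_ge_zero)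
      have "1 \<le> H\<^sup>2" using H by (rule one_le_power)
      then show "1 \<le> 4 * H\<^sup>2" by simp
    qed (use \<sigma> in simp)
    then have "0 \<le> E" unfolding E_def using E0_nonneg D by (intro add_nonneg_nonneg mult_nonneg_nonneg) auto
    then show ?thesis using triv[OF P Q True] by simp
  next
    case False
    then have "P \<inter> Q \<subset> A" using P dclasses_subset by blast
    from IH[OF this] b1[OF P Q] show ?thesis by linarith
  qed
  have b2: "real (card (Q + dil l P)) \<le> H * real (card (P \<inter> Q)) + n / (8 * H\<^sup>2)" if "P \<in> ?I" "Q \<in> ?J" for P Q
    using b1[OF that] E Dn[of "real (card (P \<inter> Q))"] unfolding g_def n_def by linarith
  obtain P0 where P0: "P0 \<in> ?I" "n \<le> 2 * H * real (card P0)"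
  proof -
    define mx where "mx = Max (card ` ?I)"
    have "mx \<in> card ` ?I" unfolding mx_def using finite_dclasses dclasses_ne by (intro Max_in) auto
    then obtain P0 where P0: "P0 \<in> ?I" "mx = card P0" by auto
    have "card A = (\<Sum>P\<in>?I. card (A \<inter> P))" by (rule card_eq_sum_dclasses) simp
    also have "\<dots> \<le> (\<Sum>P\<in>?I. mx)"
      unfolding mx_def using finite_dclasses dclasses_subset by (intro sum_mono) (simp add: Int_absorb1)
    finally have "n \<le> real (card ?I) * real (card P0)" by (simp add: n_def P0(2) flip: of_nat_mult)
    also have "\<dots> \<le> 2 * H * real (card P0)" using cI by (intro mult_right_mono) auto
    finally show thesis using that P0 by blast
  qed
  \<comment> \<open>The error is weakened to half of n / (2H), the lower bound for |P0|, so that it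
    can be absorbed.\<close>
  have Hn: "n / (8 * H\<^sup>2) \<le> n / (4 * H)"
    using H n by (intro divide_left_mono) (auto simp: power2_eq_square)
  have cQ: "n / (4 * H\<^sup>2) \<le> real (card Q)"
  proof -
    have "real (card P0) \<le> real (card (Q + dil l P0))"
      using card_le_card_set_plus[of "dil l P0" Q] dclasses_finite[OF P0(1)] dclasses_finite[OF Q] dclasses_nonempty[OF Q] l
      by (simp add: add.commute)
    also have "\<dots> \<le> H * real (card (P0 \<inter> Q)) + n / (8 * H\<^sup>2)" using b2[OF P0(1) Q] .
    also have "\<dots> \<le> H * real (card Q) + n / (4 * H)"
      using Hn H dclasses_finite[OF Q] by (intro add_mono mult_left_mono) (auto intro: card_mono)
    finally have "n / (2 * H) \<le> H * real (card Q) + n / (4 * H)"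
      using P0(2) H by (simp add: field_simps)
    then have "n / (4 * H) \<le> H * real (card Q)" using H by (simp add: field_simps)
    then show ?thesis using H by (simp add: field_simps power2_eq_square)
  qed
  have "real (card Q) \<le> real (card (Q + dil l P))"
    using card_le_card_set_plus[of Q "dil l P"] dclasses_finite[OF P] dclasses_finite[OF Q] dclasses_nonempty[OF P] by simp
  also have "\<dots> \<le> H * real (card (P \<inter> Q)) + n / (8 * H\<^sup>2)" using b2[OF P Q] .
  finally have "n / (8 * H\<^sup>2) \<le> H * real (card (P \<inter> Q))" using cQ H by (simp add: field_simps)
  then show "real (card A) / (8 * H ^ 3) \<le> real (card (P \<inter> Q))"
    using H by (simp add: field_simps power2_eq_square power3_eq_cube n_def)
qed

end


section \<open>Rigidity of near-extremal sets\<close>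

context diff_group
begin

text \<open>Let N consist of the w in \<Gamma> with l w in \<Gamma>. For p in \<open>P\<close> and a
  in \<open>A\<close>, with P' the class of a, the translate of P' \<inter> Q by l p lies in Q + l P
  and has more than \<open>E\<close> points, so it meets B + l B, where B = P \<inter> Q. Modulo N
  the coincidence says that l (b - b0) is congruent to l (p - b0) + (a - b0). Hence the residues
  attained by l (P - b0) are closed under adding A - b0; being finite in number, they are closed
  under all of \<Gamma>, which A - A generates.\<close>

lemma dclasses_nonexpanding_surj:
  assumes l: "l \<noteq> 0" and gen: "\<Gamma> = group_closure {x - y |x y. x \<in> A \<and> y \<in> A}"
    and P: "P \<in> dclasses l \<Gamma> A" and Q: "Q \<in> dclasses (1 / l) \<Gamma> A" and b0: "b0 \<in> P \<inter> Q"
    and E: "\<And>P'. P' \<in> dclasses l \<Gamma> A \<Longrightarrow> E < real (card (P' \<inter> Q))"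
    and gain: "real (card (Q + dil l P)) \<le> real (card ((P \<inter> Q) + dil l (P \<inter> Q))) + E"
    and z: "z \<in> \<Gamma>"
  shows "\<exists>b\<in>P \<inter> Q. l * (b - b0) - z \<in> \<Gamma> \<and> l * (l * (b - b0) - z) \<in> \<Gamma>"
proof -
  define N where "N = (\<lambda>w. w \<in> \<Gamma> \<and> l * w \<in> \<Gamma>)"
  have Nadd: "N (u + v)" if "N u" "N v" for u v using that add_mem by (simp add: N_def distrib_left)
  have Ndiff: "N (u - v)" if "N u" "N v" for u v using that diff_mem by (simp add: N_def right_diff_distrib)
  have N0: "N 0" using zero_mem by (simp add: N_def)
  have PA: "P \<subseteq> A" and QA: "Q \<subseteq> A" using P Q dclasses_subset by blast+
  have finPQ: "finite P" "finite Q" using dclasses_finite P Q by blast+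
  have step: "\<exists>b\<in>P \<inter> Q. N (l * (b - b0) - (l * (p - b0) + (a - b0)))" if p: "p \<in> P" and a: "a \<in> A" for p a
  proof -
    define P' where "P' = dclass l \<Gamma> A a"
    have P': "P' \<in> dclasses l \<Gamma> A" "a \<in> P'" using a dclass_self by (auto simp: P'_def dclasses_def)
    let ?B = "P \<inter> Q"
    define S where "S = (\<lambda>q. q + l * p) ` (P' \<inter> Q)"
    have cS: "card S = card (P' \<inter> Q)" unfolding S_def by (intro card_image) (simp add: inj_on_def)
    have finS: "finite S" unfolding S_def using finPQ by simp
    have fin1: "finite (Q + dil l P)" using finPQ by (intro finite_set_plus finite_dil)
    have "S \<subseteq> Q + dil l P" unfolding S_def dil_def using p by auto
    moreover have BB: "?B + dil l ?B \<subseteq> Q + dil l P" by (intro set_plus_subset dil_mono) auto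
    ultimately have "card ((?B + dil l ?B) \<union> S) \<le> card (Q + dil l P)"
      using fin1 by (intro card_mono) auto
    moreover have "card ((?B + dil l ?B) \<union> S) = card (?B + dil l ?B) + card S" if "(?B + dil l ?B) \<inter> S = {}"
      using that finS fin1 BB by (intro card_Un_disjoint) (auto intro: finite_subset)
    ultimately have "(?B + dil l ?B) \<inter> S \<noteq> {}" using gain E[OF P'(1)] cS by fastforce
    then obtain b b' q where *: "b \<in> ?B" "b' \<in> ?B" "q \<in> P' \<inter> Q" "b' + l * b = q + l * p"
      by (auto simp: S_def dil_def elim!: set_plus_elim)
    have "N (q - a)"
      unfolding N_def using * P' a diff_A QA dclasses_diff[OF P'(1), of q a] by auto
    moreover have "N (b' - b0)"
      unfolding N_def using * b0 PA diff_A dclasses_diff[OF P, of b' b0] by auto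
    ultimately have "N ((q - a) - (b' - b0))" by (rule Ndiff)
    also have "(q - a) - (b' - b0) = l * (b - b0) - (l * (p - b0) + (a - b0))"
      using *(4) by (simp add: algebra_simps)
    finally show ?thesis using *(1) by blast
  qed
  \<comment> \<open>Everything congruent modulo \<open>N\<close> to some l (p - b0) with p in
    \<open>P\<close>; the aim is that \<Gamma> is contained in it.\<close>
  define U where "U = {w. \<exists>p\<in>P. N (l * (p - b0) - w)}"
  have stepU: "\<exists>b\<in>P \<inter> Q. N (l * (b - b0) - (w + (a - b0)))" if w: "w \<in> U" and a: "a \<in> A" for w a
  proof -
    obtain p where p: "p \<in> P" "N (l * (p - b0) - w)" using w by (auto simp: U_def)
    obtain b where b: "b \<in> P \<inter> Q" "N (l * (b - b0) - (l * (p - b0) + (a - b0)))" using step[OF p(1) a] by blast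
    have "N ((l * (b - b0) - (l * (p - b0) + (a - b0))) + (l * (p - b0) - w))" using b(2) p(2) by (rule Nadd)
    then show ?thesis using b(1) by (intro bexI[of _ b]) (simp_all add: algebra_simps)
  qed
  have plusU: "w + (a - b0) \<in> U" if "w \<in> U" "a \<in> A" for w a
    using stepU[OF that] by (auto simp: U_def)
  have minusU: "w - (a - b0) \<in> U" if w: "w \<in> U" and a: "a \<in> A" for w a
  proof -
    let ?c = "a - b0"
    have mem: "w + real k * ?c \<in> U" for k
    proof (induction k)
      case (Suc k)
      from plusU[OF this a] show ?case by (simp add: algebra_simps)
    qed (use w in simp)
    then have "\<forall>k. \<exists>p. p \<in> P \<and> N (l * (p - b0) - (w + real k * ?c))" by (auto simp: U_def)
    then obtain f where f: "\<And>k. f k \<in> P" "\<And>k. N (l * (f k - b0) - (w + real k * ?c))" by metis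
    \<comment> \<open>As \<open>P\<close> is finite, two multiples of \<open>?c\<close> share a
      witness. So \<open>?c\<close> has finite order modulo \<open>N\<close>, and subtracting it
      amounts to adding it several times.\<close>
    have "\<not> inj f"
    proof
      assume "inj f"
      then have "infinite (range f)" by (simp add: finite_image_iff)
      moreover have "range f \<subseteq> P" using f(1) by auto
      ultimately show False using finPQ finite_subset by blast
    qed
    then obtain i j where ij: "f i = f j" "i < j" unfolding inj_def by (metis linorder_neqE_nat)
    have "N ((l * (f i - b0) - (w + real i * ?c)) - (l * (f j - b0) - (w + real j * ?c)))"
      using f(2) by (rule Ndiff[OF _ f(2)])
    then have Nc: "N (real (j - i) * ?c)" using ij by (simp add: of_nat_diff algebra_simps)
    obtain k where k: "j - i = Suc k" using ij by (metis Suc_diff_Suc)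
    have "N ((l * (f k - b0) - (w + real k * ?c)) + real (j - i) * ?c)" using f(2) Nc by (rule Nadd)
    then have "N (l * (f k - b0) - (w - ?c))" unfolding k by (simp add: algebra_simps)
    then show ?thesis using f(1) by (auto simp: U_def)
  qed
  have "\<forall>w\<in>U. w + h \<in> U \<and> w - h \<in> U" if "h \<in> \<Gamma>" for h
    using that unfolding gen
  proof (induction h rule: group_closure.induct)
    case (base s)
    then consider "s = 0" | x y where "s = x - y" "x \<in> A" "y \<in> A" by auto
    then show ?case
    proof cases
      case 2
      show ?thesis
      proof (intro ballI conjI)
        fix w assume w: "w \<in> U"
        have "(w + (x - b0)) - (y - b0) \<in> U" by (rule minusU[OF plusU[OF w 2(2)] 2(3)])
        then show "w + s \<in> U" unfolding 2(1) by (simp add: algebra_simps)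
        have "(w + (y - b0)) - (x - b0) \<in> U" by (rule minusU[OF plusU[OF w 2(3)] 2(2)])
        then show "w - s \<in> U" unfolding 2(1) by (simp add: algebra_simps)
      qed
    qed auto
  next
    case (diff s t)
    have "w + (s - t) = (w + s) - t" "w - (s - t) = (w + t) - s" for w by auto
    with diff show ?case by metis
  qed
  moreover have "0 \<in> U" unfolding U_def using b0 N0 by (auto intro!: bexI[of _ b0])
  ultimately have "z \<in> U" using z by force
  \<comment> \<open>One further step, with a = b0, moves the witness from \<open>P\<close> into P
    \<inter> Q.\<close>
  from stepU[OF this, of b0] b0 PA show ?thesis by (auto simp: N_def)
qed

text \<open>Each x in \<open>G\<close> receives some f x in \<open>B\<close> with l (f x - b0)
  congruent to x modulo \<Gamma>, even after multiplication by \<open>l\<close>. If f x and f y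
  share a class, then l (f x - f y) lies in \<Gamma>', so l times it lies in \<Gamma>, and so does l
  (x - y).\<close>

lemma card_le_card_dclasses:
  assumes B: "B \<subseteq> A" and b0: "b0 \<in> B"
    and surj: "\<And>z. z \<in> \<Gamma> \<Longrightarrow> \<exists>b\<in>B. l * (b - b0) - z \<in> \<Gamma> \<and> l * (l * (b - b0) - z) \<in> \<Gamma>"
    and G: "G \<subseteq> \<Gamma>" "\<And>x y. x \<in> G \<Longrightarrow> y \<in> G \<Longrightarrow> x \<noteq> y \<Longrightarrow> l * (x - y) \<notin> \<Gamma>"
    and \<Gamma>': "diff_group \<Gamma>' B" "\<And>z. z \<in> \<Gamma>' \<Longrightarrow> z \<in> \<Gamma> \<and> l * z \<in> \<Gamma>"
  shows "card G \<le> card (dclasses l \<Gamma>' B)"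
proof -
  interpret B: diff_group \<Gamma>' B by (rule \<Gamma>'(1))
  obtain f where f: "\<And>z. z \<in> \<Gamma> \<Longrightarrow> f z \<in> B"
    "\<And>z. z \<in> \<Gamma> \<Longrightarrow> l * (f z - b0) - z \<in> \<Gamma>" "\<And>z. z \<in> \<Gamma> \<Longrightarrow> l * (l * (f z - b0) - z) \<in> \<Gamma>"
    using surj by metis
  have "inj_on (\<lambda>x. dclass l \<Gamma>' B (f x)) G"
  proof (rule inj_onI, rule ccontr)
    fix x y assume xy: "x \<in> G" "y \<in> G" "dclass l \<Gamma>' B (f x) = dclass l \<Gamma>' B (f y)" "x \<noteq> y"
    have \<Gamma>: "x \<in> \<Gamma>" "y \<in> \<Gamma>" using xy G by auto
    have "f y \<in> dclass l \<Gamma>' B (f x)" using B.dclass_self[OF f(1)[OF \<Gamma>(2)]] xy(3) by simp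
    then have "l * (f x - f y) \<in> \<Gamma>'" by (simp add: dclass_def)
    then have 1: "l * (l * (f x - f y)) \<in> \<Gamma>" using \<Gamma>' by blast
    have 2: "l * (l * (f x - b0) - x) - l * (l * (f y - b0) - y) \<in> \<Gamma>" using f(3) \<Gamma> by (intro diff_mem)
    have "l * (x - y) = l * (l * (f x - f y)) - (l * (l * (f x - b0) - x) - l * (l * (f y - b0) - y))"
      by (simp add: algebra_simps)
    then have "l * (x - y) \<in> \<Gamma>" using diff_mem[OF 1 2] by simp
    with G(2) xy show False by blast
  qed
  moreover have "(\<lambda>x. dclass l \<Gamma>' B (f x)) ` G \<subseteq> dclasses l \<Gamma>' B"
    using f(1) G by (auto simp: dclasses_def)
  ultimately show ?thesis using B.finite_dclasses by (intro card_inj_on_le)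
qed

text \<open>Let U^d and V^d be the least sizes of a class P and of a class Q. Summing
  \<open>lt\<close> over all Q at the smallest P gives \<beta> (U + V) < (\<alpha> + \<beta>) U,
  that is \<beta> V < \<alpha> U; summing over all P at the smallest Q gives \<alpha> U < \<beta>
  V.\<close>

lemma not_all_pieces_large:
  assumes d: "d > 0" and \<alpha>: "\<alpha> > 0" "\<alpha> ^ d \<le> real (card (dclasses l \<Gamma> A))"
    and \<beta>: "\<beta> > 0" "\<beta> ^ d \<le> real (card (dclasses (1 / l) \<Gamma> A))"
    and lt: "\<And>P Q. P \<in> dclasses l \<Gamma> A \<Longrightarrow> Q \<in> dclasses (1 / l) \<Gamma> A \<Longrightarrow>
      (real (card Q) powr (1 / real d) + real (card P) powr (1 / real d)) ^ d < (\<alpha> + \<beta>) ^ d * real (card (P \<inter> Q))"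
  shows False
proof -
  let ?I = "dclasses l \<Gamma> A" and ?J = "dclasses (1 / l) \<Gamma> A"
  obtain P where P: "P \<in> ?I" "\<And>P'. P' \<in> ?I \<Longrightarrow> card P \<le> card P'"
    using ex_has_least_nat[of "\<lambda>P. P \<in> ?I" _ card] dclasses_ne[of l] by blast
  obtain Q where Q: "Q \<in> ?J" "\<And>Q'. Q' \<in> ?J \<Longrightarrow> card Q \<le> card Q'"
    using ex_has_least_nat[of "\<lambda>Q. Q \<in> ?J" _ card] dclasses_ne[of "1 / l"] by blast
  define U where "U = real (card P) powr (1 / real d)"
  define V where "V = real (card Q) powr (1 / real d)"
  have pos: "card P > 0" "card Q > 0"
    using P Q dclasses_nonempty dclasses_finite by (auto simp: card_gt_0_iff)
  then have UV: "U > 0" "V > 0" by (auto simp: U_def V_def)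
  have Ud: "U ^ d = real (card P)" "V ^ d = real (card Q)"
    using pos d by (auto simp: U_def V_def powr_powr simp flip: powr_realpow)
  have "\<beta> ^ d * (U + V) ^ d \<le> real (card ?J) * (U + V) ^ d"
    using \<beta> UV by (intro mult_right_mono) auto
  also have "\<dots> = (\<Sum>Q'\<in>?J. (V + U) ^ d)" by (simp add: add.commute)
  also have "\<dots> \<le> (\<Sum>Q'\<in>?J. (real (card Q') powr (1 / real d) + U) ^ d)"
    using Q(2) UV unfolding V_def by (intro sum_mono power_mono add_right_mono powr_mono2) (auto simp: U_def)
  also have "\<dots> < (\<Sum>Q'\<in>?J. (\<alpha> + \<beta>) ^ d * real (card (P \<inter> Q')))"
    using finite_dclasses dclasses_ne lt[OF P(1)] unfolding U_def by (intro sum_strict_mono) auto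
  also have "\<dots> = (\<alpha> + \<beta>) ^ d * real (card P)"
    using card_eq_sum_dclasses[OF dclasses_subset[OF P(1)], of "1 / l"] by (simp flip: sum_distrib_left)
  finally have "(\<beta> * (U + V)) ^ d < ((\<alpha> + \<beta>) * U) ^ d" by (simp add: power_mult_distrib Ud)
  then have 1: "\<beta> * (U + V) < (\<alpha> + \<beta>) * U" by (rule power_less_imp_less_base) (use \<alpha> \<beta> UV in simp)
  have "\<alpha> ^ d * (U + V) ^ d \<le> real (card ?I) * (U + V) ^ d"
    using \<alpha> UV by (intro mult_right_mono) auto
  also have "\<dots> = (\<Sum>P'\<in>?I. (V + U) ^ d)" by (simp add: add.commute)
  also have "\<dots> \<le> (\<Sum>P'\<in>?I. (V + real (card P') powr (1 / real d)) ^ d)"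
    using P(2) UV unfolding U_def by (intro sum_mono power_mono add_left_mono powr_mono2) (auto simp: V_def)
  also have "\<dots> < (\<Sum>P'\<in>?I. (\<alpha> + \<beta>) ^ d * real (card (Q \<inter> P')))"
    using finite_dclasses dclasses_ne lt[OF _ Q(1)] unfolding V_def by (intro sum_strict_mono) (auto simp: Int_commute)
  also have "\<dots> = (\<alpha> + \<beta>) ^ d * real (card Q)"
    using card_eq_sum_dclasses[OF dclasses_subset[OF Q(1)], of l] by (simp flip: sum_distrib_left)
  finally have "(\<alpha> * (U + V)) ^ d < ((\<alpha> + \<beta>) * V) ^ d" by (simp add: power_mult_distrib Ud)
  then have 2: "\<alpha> * (U + V) < (\<alpha> + \<beta>) * V" by (rule power_less_imp_less_base) (use \<alpha> \<beta> UV in simp)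
  from 1 2 show False by (simp add: algebra_simps)
qed

end


section \<open>Sets in the field\<close>

context int_min_poly
begin

text \<open>The group is finitely generated, so a denominator for the generators serves all of
  it.\<close>

lemma group_closure_common_denominator:
  assumes A: "finite A" "A \<subseteq> K" and g: "g \<in> K" "g \<noteq> 0"
  shows "\<exists>t. t \<noteq> 0 \<and> (\<forall>z\<in>group_closure {x - y |x y. x \<in> A \<and> y \<in> A}.
       \<exists>q. degree q < degree p \<and> of_int t * z = ieval q l * g)"
proof -
  let ?S = "{x - y |x y. x \<in> A \<and> y \<in> A}"
  have "?S = (\<lambda>(x, y). x - y) ` (A \<times> A)" by auto
  then have "finite ?S" using A by simp
  moreover have "?S \<subseteq> K" using A K_diff by blast
  ultimately obtain t where t: "t \<noteq> 0" "\<And>z. z \<in> ?S \<Longrightarrow> \<exists>q. degree q < degree p \<and> of_int t * z = ieval q l * g"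
    using common_denominator[of ?S g] g by blast
  have "\<exists>q. degree q < degree p \<and> of_int t * z = ieval q l * g" if "z \<in> group_closure ?S" for z
    using that
  proof (induction z rule: group_closure.induct)
    case (base s)
    then show ?case
    proof (cases "s = 0")
      case True
      then show ?thesis using degree_pos by (intro exI[of _ 0]) auto
    next
      case False
      with base have "s \<in> ?S" by blast
      then show ?thesis by (rule t(2))
    qed
  next
    case (diff s u)
    then obtain q r where *: "degree q < degree p" "of_int t * s = ieval q l * g"
      "degree r < degree p" "of_int t * u = ieval r l * g" by blast
    have "of_int t * (s - u) = ieval (q - r) l * g" using * by (simp add: algebra_simps)
    moreover have "degree (q - r) < degree p" using * by (intro degree_diff_less)
    ultimately show ?case by blast
  qed
  with t(1) show ?thesis by blast
qed

lemma group_closure_index: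
  assumes A: "finite A" "A \<subseteq> K" and x: "x \<in> A" "y \<in> A" "x \<noteq> y"
  defines "\<Gamma> \<equiv> group_closure {x - y |x y. x \<in> A \<and> y \<in> A}"
  shows "\<exists>G\<subseteq>\<Gamma>. card G = nat \<bar>lead_coeff p\<bar> \<and>
    (\<forall>x\<in>G. \<forall>y\<in>G. x \<noteq> y \<longrightarrow> l * (x - y) \<notin> \<Gamma>)"
proof -
  have gK: "x - y \<in> K" "x - y \<noteq> 0" using x A K_diff by auto
  obtain t where t: "t \<noteq> 0" "\<And>z. z \<in> \<Gamma> \<Longrightarrow> \<exists>q. degree q < degree p \<and> of_int t * z = ieval q l * (x - y)"
    unfolding \<Gamma>_def using group_closure_common_denominator[OF A gK] by blast
  show ?thesis
  proof (rule index_ge_lead_coeff[of \<Gamma> "x - y" t])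
    show "x - y \<in> \<Gamma>" unfolding \<Gamma>_def using x by (intro group_closure.base) blast
    show "u - v \<in> \<Gamma>" if "u \<in> \<Gamma>" "v \<in> \<Gamma>" for u v
      using that unfolding \<Gamma>_def by (rule group_closure.diff)
  qed (use gK t in blast)+
qed

lemma ieval_mem:
  assumes "y \<in> K"
  shows "ieval q y \<in> K"
proof (induction q)
  case (pCons c q)
  have "ieval (pCons c q) y = of_int c + y * ieval q y" by (simp add: map_poly_pCons)
  with pCons assms show ?case by (simp add: K_add K_mult)
qed simp

end

section \<open>The minimal counterexample\<close>

lemma ex_exponent:
  fixes M \<eta> \<sigma>0 :: real
  assumes "M > 1" "\<eta> > 0" "\<sigma>0 > 0"
  obtains \<sigma> where "0 < \<sigma>" "\<sigma> \<le> \<sigma>0" "M powr \<sigma> \<le> 1 + \<eta>"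
proof
  let ?s = "min \<sigma>0 (log M (1 + \<eta>))"
  show "0 < ?s" using assms by simp
  show "?s \<le> \<sigma>0" by simp
  have "M powr ?s \<le> M powr (log M (1 + \<eta>))" using assms by (intro powr_mono) auto
  also have "\<dots> = 1 + \<eta>" using assms by simp
  finally show "M powr ?s \<le> 1 + \<eta>" .
qed

lemma diff_group_group_closure:
  assumes "finite A" "A \<noteq> {}"
  shows "diff_group (group_closure {x - y |x y. x \<in> A \<and> y \<in> A}) A"
  using assms by unfold_locales (auto intro: group_closure.intros)

text \<open>Multiplication by \<open>l\<close> exchanges the two roles, so that results stated for
  \<open>l\<close> can be applied to 1 / l with P and Q swapped.\<close>

lemma card_plus_dil_inverse:
  assumes "l \<noteq> 0"
  shows "card (P + dil (1 / l) Q) = card (Q + dil l P)"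
proof -
  have "dil l (P + dil (1 / l) Q) = Q + dil l P"
    using assms by (simp add: dil_plus dil_dil add.commute) (simp add: dil_def)
  then show ?thesis using card_dil[OF assms] by metis
qed

context int_min_poly
begin

lemma card_sum_dil_ge:
  assumes l: "l \<noteq> 0"
  defines "\<alpha> \<equiv> \<bar>real_of_int (lead_coeff p)\<bar> powr (1 / real (degree p))"
    and "\<beta> \<equiv> \<bar>real_of_int (coeff p 0)\<bar> powr (1 / real (degree p))"
  shows "\<exists>D>0. \<exists>\<sigma>>0. \<forall>A. finite A \<longrightarrow> A \<subseteq> K \<longrightarrow>
    (\<alpha> + \<beta>) ^ degree p * real (card A) - D * real (card A) powr (1 - \<sigma>) \<le> real (card (A + dil l A))"
proof -
  let ?d = "degree p"
  interpret R: int_min_poly "reflect_poly p" "1 / l"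
    using reflect_min_poly(1)[OF l] by unfold_locales
  have lR: "l \<in> R.K" using R.K_inverse[OF R.K_l] by simp
  \<comment> \<open>1 / l generates the same field, so \<open>A\<close> is also admissible for the
    reflected polynomial.\<close>
  have KR: "K \<subseteq> R.K"
  proof
    fix x assume "x \<in> K"
    then obtain q t where q: "t \<noteq> 0" "of_int t * x = ieval q l" by (rule K_E)
    then have "x = ieval q l / of_int t" by (simp add: field_simps)
    then show "x \<in> R.K" using R.K_divide[OF R.ieval_mem[OF lR] R.K_of_int] by simp
  qed
  have c0: "coeff p 0 \<noteq> 0" using reflect_min_poly(3)[OF l] R.p_nz by (metis leading_coeff_0_iff)
  have lc: "lead_coeff p \<noteq> 0" using p_nz by simp
  have ge1: "1 \<le> \<bar>real_of_int c\<bar>" if "c \<noteq> 0" for c :: int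
    using that by (metis of_int_abs of_int_1_le_iff zero_less_abs_iff int_one_le_iff_zero_less)
  have ab: "\<alpha> \<ge> 1" "\<beta> \<ge> 1"
    unfolding \<alpha>_def \<beta>_def using ge1[OF c0] ge1[OF lc] by (auto intro!: ge_one_powr_ge_zero)
  have powd: "(x powr (1 / real ?d)) ^ ?d = x" if "x > 0" for x :: real
    using that degree_pos by (simp add: powr_powr flip: powr_realpow)
  have ad: "\<alpha> ^ ?d = real (nat \<bar>lead_coeff p\<bar>)" and bd: "\<beta> ^ ?d = real (nat \<bar>coeff p 0\<bar>)"
    unfolding \<alpha>_def \<beta>_def using c0 lc by (simp_all add: powd)
  define H where "H = (\<alpha> + \<beta>) ^ ?d"
  have H2: "H \<ge> 2"
  proof -
    have "2 \<le> (2::real) ^ ?d" using degree_pos self_le_power[of "2::real" ?d] by simp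
    also have "\<dots> \<le> H" unfolding H_def using ab by (intro power_mono) auto
    finally show ?thesis .
  qed
  then have H1: "H \<ge> 1" by simp
  have Hpow: "1 \<le> H ^ k" for k using H1 by (rule one_le_power)
  obtain C \<sigma>0 where C: "C > 0" and \<sigma>0: "\<sigma>0 > 0" "\<sigma>0 < 1"
    and BM: "\<And>A X Y. finite A \<Longrightarrow> A \<subseteq> K \<Longrightarrow> real (card (A + dil l A)) \<le> H * real (card A) \<Longrightarrow>
      X \<subseteq> A \<Longrightarrow> Y \<subseteq> A \<Longrightarrow> X \<noteq> {} \<Longrightarrow> Y \<noteq> {} \<Longrightarrow>
      (real (card X) powr (1 / real ?d) + real (card Y) powr (1 / real ?d)) ^ ?d
        \<le> real (card (X + dil l Y)) + C * real (card A) powr (1 - \<sigma>0)"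
    using brunn_minkowski_dil[OF l H2] by blast
  \<comment> \<open>The size is dictated by the final comparison 3 \<eta> M < M / (64 H^6) and by
    128 \<eta> H^6 \<le> 1 in the bound for \<open>E'\<close>.\<close>
  define \<eta> where "\<eta> = 1 / (1000 * H ^ 6)"
  have \<eta>: "\<eta> > 0" using H1 by (simp add: \<eta>_def)
  have \<eta>le: "\<eta> * H ^ k \<le> 1 / 1000" if "k \<le> 6" for k
  proof -
    have "H ^ k \<le> H ^ 6" using H1 that by (intro power_increasing)
    then show ?thesis using H1 by (simp add: \<eta>_def field_simps)
  qed
  have "4 * H\<^sup>2 > 1" using Hpow[of 2] by linarith
  then obtain \<sigma> where \<sigma>: "0 < \<sigma>" "\<sigma> \<le> \<sigma>0" and \<sigma>\<eta>: "(4 * H\<^sup>2) powr \<sigma> \<le> 1 + \<eta>"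
    using ex_exponent[of "4 * H\<^sup>2" \<eta> \<sigma>0] \<eta> \<sigma>0 by metis
  have \<sigma>1: "\<sigma> < 1" using \<sigma> \<sigma>0 by simp
  \<comment> \<open>The first summand makes the Brunn-Minkowski error at most \<eta> M; the second
    gives D \<ge> H, so that a singleton is no counterexample.\<close>
  define D where "D = C / \<eta> + H"
  have D: "D > 0" "C \<le> \<eta> * D" "D \<ge> H" using C \<eta> H1 by (auto simp: D_def field_simps intro: add_pos_pos)
  define g where "g = (\<lambda>x::real. H * x - D * x powr (1 - \<sigma>))"
  have main: "g (real (card A)) \<le> real (card (A + dil l A))" if "finite A" "A \<subseteq> K" for A
    using that
  proof (induction "card A" arbitrary: A rule: less_induct)
    case less
    show ?case
    proof (rule ccontr)
      assume "\<not> ?case"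
      then have lt: "real (card (A + dil l A)) < g (real (card A))" by simp
      have fin: "finite A" and AK: "A \<subseteq> K" using less.prems by auto
      have IH: "g (real (card B)) \<le> real (card (B + dil l B))" if "B \<subset> A" for B
        using that fin AK by (intro less.hyps psubset_card_mono) (auto intro: finite_subset)
      have ne: "A \<noteq> {}" using lt \<sigma>1 by (auto simp: g_def)
      define n where "n = real (card A)"
      have n1: "n \<ge> 1" using fin ne by (simp add: n_def Suc_le_eq card_gt_0_iff)
      define M where "M = D * n powr (1 - \<sigma>)"
      have M0: "M > 0" using D n1 by (simp add: M_def)
      have "0 < g n" using lt unfolding n_def by linarith
      then have MH: "M < H * n" by (simp add: g_def M_def)
      have "n > 1"
      proof (rule ccontr)
        assume "\<not> n > 1"
        then have "n = 1" using n1 by simp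
        then show False using MH D by (simp add: M_def)
      qed
      then have "card A \<noteq> 1" by (simp add: n_def)
      then obtain x y where xy: "x \<in> A" "y \<in> A" "x \<noteq> y"
        using ne by (metis card_1_singleton_iff is_singletonI' is_singleton_def One_nat_def)
      define \<Gamma> where "\<Gamma> = group_closure {x - y |x y. x \<in> A \<and> y \<in> A}"
      interpret A: diff_group \<Gamma> A unfolding \<Gamma>_def using fin ne by (rule diff_group_group_closure)
      let ?I = "dclasses l \<Gamma> A" and ?J = "dclasses (1 / l) \<Gamma> A"
      \<comment> \<open>The summand 0 is the excess \<open>E0\<close> of \<open>A\<close>, written
        out to match \<open>split_bounds\<close>.\<close>
      define E where "E = 0 + ((4 * H\<^sup>2) powr \<sigma> - 1) * (D * real (card A) powr (1 - \<sigma>))"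
      have E0: "E \<ge> 0"
      proof -
        have "1 \<le> (4 * H\<^sup>2) powr \<sigma>" using \<open>4 * H\<^sup>2 > 1\<close> \<sigma> by (intro ge_one_powr_ge_zero) auto
        then show ?thesis unfolding E_def using D by simp
      qed
      have EM: "E \<le> \<eta> * M"
        unfolding E_def M_def n_def using \<sigma>\<eta> D by (simp add: mult_right_mono)
      have \<eta>M: "\<eta> * M \<le> \<eta> * (H * n)" using MH \<eta> by (intro mult_left_mono) auto
      have small: "\<eta> * (H * n) * (8 * H ^ k) \<le> n * (8 / 1000)" if "k \<le> 5" for k
      proof -
        have "\<eta> * (H * n) * (8 * H ^ k) = (\<eta> * H ^ Suc k) * (8 * n)" by (simp add: algebra_simps)
        also have "\<dots> \<le> 1 / 1000 * (8 * n)" using \<eta>le[of "Suc k"] that n1 by (intro mult_right_mono) auto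
        finally show ?thesis by simp
      qed
      have "E \<le> n / (8 * H\<^sup>2)"
      proof -
        have "E * (8 * H\<^sup>2) \<le> \<eta> * (H * n) * (8 * H\<^sup>2)" using EM \<eta>M H1 by (intro mult_right_mono) auto
        also have "\<dots> \<le> n * (8 / 1000)" by (rule small) simp
        also have "\<dots> \<le> n" using n1 by simp
        finally show ?thesis using H1 by (simp add: pos_le_divide_eq)
      qed
      note En = this[unfolded n_def]
      have up: "real (card (A + dil l A)) \<le> g (real (card A)) + 0" using lt by simp
      have Hn0: "0 \<le> H * real (card A)" using H1 by simp
      note splitA = A.split_bounds[of l H D \<sigma> 0, folded E_def, OF l H1 less_imp_le[OF D(1)] \<sigma>(1) \<sigma>1
          IH[unfolded g_def] up[unfolded g_def] order_refl Hn0 En]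
      have sp1: "real (card (Q + dil l P)) \<le> g (real (card (P \<inter> Q))) + E"
        and sp2: "n / (8 * H ^ 3) \<le> real (card (P \<inter> Q))"
        and sp3: "real (card (Q + dil l P)) \<le> real (card ((P \<inter> Q) + dil l (P \<inter> Q))) + E"
        if "P \<in> ?I" "Q \<in> ?J" for P Q
        unfolding n_def g_def using splitA[OF _ that] by blast+
      obtain P Q where P: "P \<in> ?I" and Q: "Q \<in> ?J" using A.dclasses_ne by blast
      define B where "B = P \<inter> Q"
      define b where "b = real (card B)"
      have BA: "B \<subseteq> A" using P A.dclasses_subset by (auto simp: B_def)
      have finB: "finite B" using BA fin finite_subset by blast
      have bn: "n / (8 * H ^ 3) \<le> b" unfolding b_def B_def using P Q by (rule sp2)
      then have bn': "n \<le> 8 * H ^ 3 * b" using H1 by (simp add: pos_divide_le_eq mult.commute)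
      have b0: "b > 0"
      proof -
        have "0 < n / (8 * H ^ 3)" using n1 H1 by simp
        with bn show ?thesis by linarith
      qed
      then have neB: "B \<noteq> {}" by (auto simp: b_def)
      then obtain b0 where b0B: "b0 \<in> B" by auto
      have Elt: "E < n / (8 * H ^ 3)"
      proof -
        have "E * (8 * H ^ 3) \<le> \<eta> * (H * n) * (8 * H ^ 3)" using EM \<eta>M H1 by (intro mult_right_mono) auto
        also have "\<dots> \<le> n * (8 / 1000)" by (rule small) simp
        also have "\<dots> < n" using n1 by simp
        finally show ?thesis using H1 by (simp add: pos_less_divide_eq)
      qed
      have surj1: "\<exists>b\<in>B. l * (b - b0) - z \<in> \<Gamma> \<and> l * (l * (b - b0) - z) \<in> \<Gamma>" if "z \<in> \<Gamma>" for z
        unfolding B_def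
      proof (rule A.dclasses_nonexpanding_surj[OF l \<Gamma>_def P Q b0B[unfolded B_def] _ sp3[OF P Q] that])
        fix P' assume "P' \<in> ?I"
        from sp2[OF this Q] Elt show "E < real (card (P' \<inter> Q))" by linarith
      qed
      \<comment> \<open>The same rigidity with \<open>P\<close> and \<open>Q\<close> exchanged and 1
        / l in place of \<open>l\<close>.\<close>
      have surj2: "\<exists>b\<in>B. 1 / l * (b - b0) - z \<in> \<Gamma> \<and> 1 / l * (1 / l * (b - b0) - z) \<in> \<Gamma>" if "z \<in> \<Gamma>" for z
      proof -
        have "\<exists>b\<in>Q \<inter> P. 1 / l * (b - b0) - z \<in> \<Gamma> \<and> 1 / l * (1 / l * (b - b0) - z) \<in> \<Gamma>"
        proof (rule A.dclasses_nonexpanding_surj[OF _ \<Gamma>_def Q _ _ _ _ that, of P b0 E])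
          show "1 / l \<noteq> 0" using l by simp
          show "P \<in> dclasses (1 / (1 / l)) \<Gamma> A" using P by simp
          show "b0 \<in> Q \<inter> P" using b0B by (auto simp: B_def)
          show "real (card (P + dil (1 / l) Q)) \<le> real (card (Q \<inter> P + dil (1 / l) (Q \<inter> P))) + E"
            using sp3[OF P Q] by (simp add: card_plus_dil_inverse[OF l] Int_commute)
          show "E < real (card (P' \<inter> P))" if "P' \<in> ?J" for P'
            using sp2[OF P that] Elt by (simp add: Int_commute)
        qed
        then show ?thesis by (simp add: B_def Int_commute)
      qed
      \<comment> \<open>B - B lies in this group because \<open>B\<close> is contained in one class
        of each kind. Imposing both conditions lets a single group serve the count of the classes P
        and that of the classes Q.\<close>
      define \<Gamma>' where "\<Gamma>' = {z \<in> \<Gamma>. l * z \<in> \<Gamma> \<and> 1 / l * z \<in> \<Gamma>}"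
      have B': "diff_group \<Gamma>' B"
      proof
        fix u v assume "u \<in> \<Gamma>'" "v \<in> \<Gamma>'"
        then show "u - v \<in> \<Gamma>'" using A.diff_mem by (simp add: \<Gamma>'_def right_diff_distrib diff_divide_distrib)
      next
        fix u v assume uv: "u \<in> B" "v \<in> B"
        then show "u - v \<in> \<Gamma>'"
          using A.dclasses_diff[OF P, of u v] A.dclasses_diff[OF Q, of u v] A.diff_A BA by (auto simp: \<Gamma>'_def B_def)
      qed (use finB neB in auto)
      interpret B: diff_group \<Gamma>' B by (rule B')
      let ?I' = "dclasses l \<Gamma>' B" and ?J' = "dclasses (1 / l) \<Gamma>' B"
      have cI': "\<alpha> ^ ?d \<le> real (card ?I')"
      proof -
        obtain G where G: "G \<subseteq> \<Gamma>" "card G = nat \<bar>lead_coeff p\<bar>"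
          "\<forall>x\<in>G. \<forall>y\<in>G. x \<noteq> y \<longrightarrow> l * (x - y) \<notin> \<Gamma>"
          unfolding \<Gamma>_def using group_closure_index[OF fin AK xy] by blast
        have "card G \<le> card ?I'"
          by (rule A.card_le_card_dclasses[OF BA b0B surj1 G(1) _ B']) (use G(3) in \<open>auto simp: \<Gamma>'_def\<close>)
        then show ?thesis using G(2) ad by simp
      qed
      have cJ': "\<beta> ^ ?d \<le> real (card ?J')"
      proof -
        have AR: "A \<subseteq> R.K" using AK KR by blast
        obtain G where G: "G \<subseteq> \<Gamma>" "card G = nat \<bar>lead_coeff (reflect_poly p)\<bar>"
          "\<forall>x\<in>G. \<forall>y\<in>G. x \<noteq> y \<longrightarrow> 1 / l * (x - y) \<notin> \<Gamma>"
          unfolding \<Gamma>_def using R.group_closure_index[OF fin AR xy] by blast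
        have "card G \<le> card ?J'"
          by (rule A.card_le_card_dclasses[OF BA b0B surj2 G(1) _ B']) (use G(3) in \<open>auto simp: \<Gamma>'_def\<close>)
        then show ?thesis using G(2) bd reflect_min_poly(3)[OF l] by simp
      qed
      \<comment> \<open>At the second level \<open>B\<close> may exceed its lower bound by
        \<open>E\<close>, which now plays the part of \<open>E0\<close>.\<close>
      define E' where "E' = E + ((4 * H\<^sup>2) powr \<sigma> - 1) * (D * real (card B) powr (1 - \<sigma>))"
      have E'M: "E' \<le> 2 * (\<eta> * M)"
      proof -
        have "real (card B) \<le> n" unfolding n_def using BA fin by (auto intro: card_mono)
        then have "D * real (card B) powr (1 - \<sigma>) \<le> M" unfolding M_def using D \<sigma>1 by (intro mult_left_mono powr_mono2) auto
        then have "((4 * H\<^sup>2) powr \<sigma> - 1) * (D * real (card B) powr (1 - \<sigma>)) \<le> \<eta> * M"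
          using \<sigma>\<eta> \<eta> D by (intro mult_mono) auto
        with EM show ?thesis by (simp add: E'_def)
      qed
      have E'b: "E' \<le> b / (8 * H\<^sup>2)"
      proof -
        have "E' * (8 * H\<^sup>2) \<le> 2 * (\<eta> * (H * n)) * (8 * H\<^sup>2)"
          using E'M \<eta>M H1 by (intro mult_right_mono) auto
        also have "\<dots> \<le> 2 * (\<eta> * (H * (8 * H ^ 3 * b))) * (8 * H\<^sup>2)"
          using bn' \<eta> H1 by (intro mult_right_mono mult_left_mono) auto
        also have "\<dots> = (\<eta> * H ^ 6) * (128 * b)" by (simp add: eval_nat_numeral)
        also have "\<dots> \<le> 1 / 1000 * (128 * b)" using \<eta>le[of 6] b0 by (intro mult_right_mono) auto
        also have "\<dots> \<le> b" using b0 by simp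
        finally show ?thesis using H1 by (simp add: pos_le_divide_eq)
      qed
      have upB: "real (card (B + dil l B)) \<le> g (real (card B)) + E"
      proof -
        have "finite (Q + dil l P)" using P Q A.dclasses_finite by (intro finite_set_plus finite_dil) auto
        then have "card (B + dil l B) \<le> card (Q + dil l P)"
          unfolding B_def by (rule card_mono) (intro set_plus_subset dil_mono Int_lower1 Int_lower2)
        with sp1[OF P Q] show ?thesis by (simp add: B_def)
      qed
      have EHb: "E \<le> H * real (card B)"
      proof -
        have "E \<le> b" using Elt bn by linarith
        also have "\<dots> \<le> H * b" using H1 b0 by simp
        finally show ?thesis by (simp add: b_def)
      qed
      have IHB: "g (real (card B1)) \<le> real (card (B1 + dil l B1))" if "B1 \<subset> B" for B1
        using IH that BA by blast
      have sB: "real (card (Q' + dil l P')) \<le> g (real (card (P' \<inter> Q'))) + E'"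
           "b / (8 * H ^ 3) \<le> real (card (P' \<inter> Q'))"
        if "P' \<in> ?I'" "Q' \<in> ?J'" for P' Q'
        using B.split_bounds(1,2)[of l H D \<sigma> E, folded E'_def,
            OF l H1 less_imp_le[OF D(1)] \<sigma>(1) \<sigma>1 IHB[unfolded g_def] upB[unfolded g_def]
              E0 EHb E'b[unfolded b_def] that]
        unfolding b_def g_def by blast+
      show False
      proof (rule B.not_all_pieces_large[of ?d \<alpha> l \<beta>])
        fix P' Q' assume P': "P' \<in> ?I'" and Q': "Q' \<in> ?J'"
        define c where "c = real (card (P' \<inter> Q'))"
        have "real (card (A + dil l A)) \<le> H * real (card A)" using MH lt unfolding g_def n_def[symmetric] M_def[symmetric] using M0 by linarith
        then have "(real (card Q') powr (1 / real ?d) + real (card P') powr (1 / real ?d)) ^ ?d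
            \<le> real (card (Q' + dil l P')) + C * n powr (1 - \<sigma>0)"
          unfolding n_def using P' Q' BA B.dclasses_subset B.dclasses_nonempty
          by (intro BM fin AK) blast+
        also have "\<dots> \<le> (g c + E') + \<eta> * M"
        proof (rule add_mono)
          show "real (card (Q' + dil l P')) \<le> g c + E'" unfolding c_def by (rule sB(1)[OF P' Q'])
          have "C * n powr (1 - \<sigma>0) \<le> (\<eta> * D) * n powr (1 - \<sigma>)"
            using D(1,2) \<eta> n1 \<sigma> by (intro mult_mono powr_mono) auto
          then show "C * n powr (1 - \<sigma>0) \<le> \<eta> * M" by (simp add: M_def)
        qed
        also have "\<dots> \<le> H * c - D * c powr (1 - \<sigma>) + 3 * (\<eta> * M)" unfolding g_def using E'M by linarith
        also have "\<dots> < H * c"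
        proof -
          \<comment> \<open>Each of the two levels keeps at least one part in 8H^3, and k =
            (8H^3)^2. The piece's own error term D c^(1-\<sigma>) is therefore at least M / k, more
            than the total loss 3 \<eta> M.\<close>
          define k where "k = 64 * H ^ 6"
          have k1: "k \<ge> 1" using Hpow[of 6] by (simp add: k_def)
          have "n / k \<le> c"
          proof -
            have "n \<le> 8 * H ^ 3 * b" by (rule bn')
            also have "\<dots> \<le> 8 * H ^ 3 * (8 * H ^ 3 * c)"
              using sB(2)[OF P' Q'] H1 unfolding c_def by (intro mult_left_mono) (simp_all add: pos_divide_le_eq mult.commute)
            also have "\<dots> = k * c" by (simp add: k_def eval_nat_numeral)
            finally show ?thesis using k1 by (simp add: pos_divide_le_eq mult.commute)
          qed
          then have "(n / k) powr (1 - \<sigma>) \<le> c powr (1 - \<sigma>)" using n1 k1 \<sigma>1 by (intro powr_mono2) auto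
          moreover have "n powr (1 - \<sigma>) / k \<le> (n / k) powr (1 - \<sigma>)"
          proof -
            have "k powr (1 - \<sigma>) \<le> k powr 1" using k1 \<sigma> by (intro powr_mono) auto
            then have "n powr (1 - \<sigma>) / k \<le> n powr (1 - \<sigma>) / k powr (1 - \<sigma>)"
              using k1 by (intro divide_left_mono mult_pos_pos) auto
            then show ?thesis using n1 k1 by (simp add: powr_divide)
          qed
          ultimately have "D * (n powr (1 - \<sigma>) / k) \<le> D * c powr (1 - \<sigma>)" using D by (intro mult_left_mono) auto
          then have "M / k \<le> D * c powr (1 - \<sigma>)" by (simp add: M_def)
          moreover have "3 * (\<eta> * M) < M / k"
          proof -
            have "M / H ^ 6 > 0" using M0 H1 by simp
            moreover have "3 * (\<eta> * M) = 3 / 1000 * (M / H ^ 6)" by (simp add: \<eta>_def)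
            moreover have "M / k = 1 / 64 * (M / H ^ 6)" by (simp add: k_def)
            ultimately show ?thesis by linarith
          qed
          ultimately show ?thesis by linarith
        qed
        finally show "(real (card Q') powr (1 / real ?d) + real (card P') powr (1 / real ?d)) ^ ?d
            < (\<alpha> + \<beta>) ^ ?d * real (card (P' \<inter> Q'))" by (simp add: H_def c_def)
      qed (use degree_pos ab cI' cJ' in auto)
    qed
  qed
  show ?thesis
    using D(1) \<sigma>(1) main unfolding g_def H_def by blast
qed

end


section \<open>Reduction to the field\<close>

context int_min_poly
begin

definition K_subspace :: "real set \<Rightarrow> bool" where
  "K_subspace V \<longleftrightarrow> (\<forall>u\<in>V. \<forall>v\<in>V. u + v \<in> V) \<and> (\<forall>k\<in>K. \<forall>v\<in>V. k * v \<in> V)"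

lemma K_subspace_insert:
  assumes "K_subspace V"
  shows "K_subspace {u + k * t |u k. u \<in> V \<and> k \<in> K}"
proof -
  have "\<exists>u'' k''. (u + k * t) + (u' + k' * t) = u'' + k'' * t \<and> u'' \<in> V \<and> k'' \<in> K"
    if "u \<in> V" "u' \<in> V" "k \<in> K" "k' \<in> K" for u u' k k'
    using that assms K_add unfolding K_subspace_def
    by (intro exI[of _ "u + u'"] exI[of _ "k + k'"]) (auto simp: algebra_simps)
  moreover have "\<exists>u'' k''. c * (u + k * t) = u'' + k'' * t \<and> u'' \<in> V \<and> k'' \<in> K"
    if "u \<in> V" "c \<in> K" "k \<in> K" for u c k
    using that assms K_mult unfolding K_subspace_def
    by (intro exI[of _ "c * u"] exI[of _ "c * k"]) (auto simp: algebra_simps)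
  ultimately show ?thesis unfolding K_subspace_def by auto
qed

text \<open>The generator \<open>t\<close> is replaced by a natural number q. The resulting map is
  linear over \<open>K\<close> and lands in \<open>V\<close> because \<open>V\<close> contains
  \<open>K\<close>; it is injective on \<open>A\<close> as soon as q avoids the finitely many ratios
  in \<open>bad\<close>.\<close>

lemma project_subspace:
  assumes V: "K_subspace V" and t: "t \<notin> V" and fin: "finite A"
    and A: "A \<subseteq> {u + k * t |u k. u \<in> V \<and> k \<in> K}" and one: "1 \<in> V"
  shows "\<exists>A'\<subseteq>V. finite A' \<and> card A' = card A \<and> card (A' + dil l A') \<le> card (A + dil l A)"
proof -
  have Vadd: "u + v \<in> V" if "u \<in> V" "v \<in> V" for u v using V that by (simp add: K_subspace_def)
  have Vmult: "k * v \<in> V" if "k \<in> K" "v \<in> V" for k v using V that by (simp add: K_subspace_def)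
  have Vdiff: "u - v \<in> V" if "u \<in> V" "v \<in> V" for u v
    using Vadd[OF that(1) Vmult[of "- 1" v]] that by simp
  have KV: "k \<in> V" if "k \<in> K" for k using Vmult[OF that one] by simp
  have uniq: "u = u' \<and> k = k'"
    if "u + k * t = u' + k' * t" "u \<in> V" "u' \<in> V" "k \<in> K" "k' \<in> K" for u u' k k'
  proof -
    have "k = k'"
    proof (rule ccontr)
      assume "k \<noteq> k'"
      then have "t = inverse (k - k') * (u' - u)" using that(1) by (simp add: field_simps)
      moreover have "inverse (k - k') * (u' - u) \<in> V"
        using that by (intro Vmult Vdiff K_inverse K_diff)
      ultimately show False using t by simp
    qed
    with that show ?thesis by simp
  qed
  define W where "W = {u + k * t |u k. u \<in> V \<and> k \<in> K}"
  have "\<forall>a\<in>W. \<exists>u k. u \<in> V \<and> k \<in> K \<and> a = u + k * t" by (auto simp: W_def)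
  then obtain u k where uk: "\<And>a. a \<in> W \<Longrightarrow> u a \<in> V" "\<And>a. a \<in> W \<Longrightarrow> k a \<in> K" "\<And>a. a \<in> W \<Longrightarrow> a = u a + k a * t"
    by metis
  have AW: "A \<subseteq> W" using A by (simp add: W_def)
  define bad where "bad = (\<lambda>(a, b). (u b - u a) / (k a - k b)) ` (A \<times> A)"
  have "finite bad" unfolding bad_def using fin by simp
  moreover have "infinite (range real)" by (simp add: finite_image_iff)
  ultimately have "\<not> range real \<subseteq> bad" using finite_subset by blast
  then obtain q :: nat where q: "real q \<notin> bad" by auto
  have qK: "real q \<in> K" using K_of_int[of "int q"] by simp
  define f where "f = (\<lambda>a. u a + k a * real q)"
  have fV: "f a \<in> V" if "a \<in> W" for a
    unfolding f_def by (rule Vadd[OF uk(1)[OF that] KV[OF K_mult[OF uk(2)[OF that] qK]]])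
  have fadd: "f (a + l * b) = f a + l * f b" if "a \<in> W" "b \<in> W" for a b
  proof -
    have eq: "a + l * b = (u a + l * u b) + (k a + l * k b) * t"
    proof -
      have "a + l * b = (u a + k a * t) + l * (u b + k b * t)"
        by (simp only: uk(3)[OF that(1), symmetric] uk(3)[OF that(2), symmetric])
      then show ?thesis by (simp add: algebra_simps)
    qed
    have mem: "u a + l * u b \<in> V" "k a + l * k b \<in> K"
      using Vadd[OF uk(1) Vmult[OF K_l uk(1)]] K_add[OF uk(2) K_mult[OF K_l uk(2)]] that by blast+
    then have ab: "a + l * b \<in> W" unfolding W_def using eq by blast
    have "u (a + l * b) = u a + l * u b \<and> k (a + l * b) = k a + l * k b"
      using uk(3)[OF ab] eq uk(1,2)[OF ab] mem by (intro uniq) auto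
    then show ?thesis by (simp add: f_def algebra_simps)
  qed
  have "inj_on f A"
  proof (rule inj_onI)
    fix a b assume ab: "a \<in> A" "b \<in> A" "f a = f b"
    have "k a = k b"
    proof (rule ccontr)
      assume "k a \<noteq> k b"
      then have "real q = (u b - u a) / (k a - k b)" using ab(3) by (simp add: f_def field_simps)
      then have "real q \<in> bad" unfolding bad_def using ab by (intro image_eqI[of _ _ "(a, b)"]) auto
      with q show False by simp
    qed
    with ab(3) have "u a = u b" by (simp add: f_def)
    with \<open>k a = k b\<close> uk(3)[of a] uk(3)[of b] ab AW show "a = b" by (metis subsetD)
  qed
  then have card: "card (f ` A) = card A" by (rule card_image)
  have "f ` A + dil l (f ` A) \<subseteq> f ` (A + dil l A)"
  proof
    fix z assume "z \<in> f ` A + dil l (f ` A)"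
    then obtain a b where ab: "a \<in> A" "b \<in> A" "z = f a + l * f b" by (auto simp: dil_def elim!: set_plus_elim)
    then have "z = f (a + l * b)" using fadd AW by (simp add: subset_iff)
    moreover have "a + l * b \<in> A + dil l A" using ab by (auto simp: dil_def)
    ultimately show "z \<in> f ` (A + dil l A)" by blast
  qed
  then have "card (f ` A + dil l (f ` A)) \<le> card (f ` (A + dil l A))"
    using fin by (intro card_mono finite_imageI finite_set_plus finite_dil)
  also have "\<dots> \<le> card (A + dil l A)" using fin by (intro card_image_le finite_set_plus finite_dil)
  finally have "card (f ` A + dil l (f ` A)) \<le> card (A + dil l A)" .
  moreover have "f ` A \<subseteq> V" using fV AW by auto
  ultimately show ?thesis using card fin by (intro exI[of _ "f ` A"]) simp
qed

text \<open>\<open>A\<close> lies in the span over \<open>K\<close> of 1 and its own elements.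
  \<open>project_subspace\<close> removes one generator at a time; a generator already in the span
  of the remaining ones is simply dropped.\<close>

lemma ex_model_in_K:
  assumes "finite A"
  shows "\<exists>B\<subseteq>K. finite B \<and> card B = card A \<and> card (B + dil l B) \<le> card (A + dil l A)"
proof -
  \<comment> \<open>The recursion starts from \<open>K\<close> instead of 0, so that every span
    contains 1.\<close>
  define span where "span = rec_list K (\<lambda>t _ V. {u + k * t |u k. u \<in> V \<and> k \<in> K})"
  have span: "span [] = K" "span (t # ts) = {u + k * t |u k. u \<in> span ts \<and> k \<in> K}" for t ts
    by (simp_all add: span_def)
  have sub: "span ts \<subseteq> span (t # ts)" for t ts
  proof
    fix v assume "v \<in> span ts"
    moreover have "v = v + 0 * t" by simp
    ultimately show "v \<in> span (t # ts)" unfolding span using K_01 by blast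
  qed
  have K: "K \<subseteq> span ts" for ts
  proof (induction ts)
    case (Cons t ts)
    then show ?case using sub by blast
  qed (simp add: span)
  have ss: "K_subspace (span ts)" for ts
  proof (induction ts)
    case Nil
    show ?case by (auto simp: span K_subspace_def K_add K_mult)
  qed (unfold span, rule K_subspace_insert)
  have mem: "set ts \<subseteq> span ts" for ts
  proof (induction ts)
    case (Cons t ts)
    have "t = 0 + 1 * t" by simp
    moreover have "0 \<in> span ts" "1 \<in> K" using K[of ts] K_01 by auto
    ultimately have "t \<in> span (t # ts)" unfolding span by blast
    with Cons sub[of ts t] show ?case by auto
  qed simp
  have "\<exists>B\<subseteq>K. finite B \<and> card B = card A \<and> card (B + dil l B) \<le> card (A + dil l A)"
    if "finite A" "A \<subseteq> span ts" for A ts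
    using that
  proof (induction ts arbitrary: A)
    case Nil
    then show ?case by (auto simp: span)
  next
    case (Cons t ts)
    show ?case
    proof (cases "t \<in> span ts")
      case True
      have "span (t # ts) \<subseteq> span ts"
        unfolding span using True ss[of ts] by (auto simp: K_subspace_def)
      with Cons show ?thesis by blast
    next
      case False
      obtain A' where A': "A' \<subseteq> span ts" "finite A'" "card A' = card A" "card (A' + dil l A') \<le> card (A + dil l A)"
        using project_subspace[OF ss False Cons.prems(1)] Cons.prems(2) K[of ts] K_01 unfolding span by blast
      obtain B where "B \<subseteq> K" "finite B" "card B = card A'" "card (B + dil l B) \<le> card (A' + dil l A')"
        using Cons.IH[OF A'(2,1)] by blast
      with A' show ?thesis by (metis le_trans)
    qed
  qed
  moreover obtain ts where "set ts = A" using finite_list[OF assms] by blast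
  ultimately show ?thesis using mem[of ts] assms by blast
qed

end

lemma sum_dil_eq: "sum_dil A l = A + dil l A"
  by (auto simp: sum_dil_def dil_def set_plus_def)

theorem theorem1p5:
  fixes l :: real and p :: "int poly" and d :: nat
  assumes "is_int_min_poly p l"
    and "d = degree p"
  shows "\<exists>D > 0. \<exists>\<sigma> > 0. \<forall>A :: real set. finite A \<longrightarrow>
           real (card (sum_dil A l)) \<ge>
             (\<bar>real_of_int (coeff p d)\<bar> powr (1 / real d) + \<bar>real_of_int (coeff p 0)\<bar> powr (1 / real d)) ^ d
               * real (card A) - D * real (card A) powr (1 - \<sigma>)"
proof -
  let ?H = "(\<bar>real_of_int (coeff p d)\<bar> powr (1 / real d) + \<bar>real_of_int (coeff p 0)\<bar> powr (1 / real d)) ^ d"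
  interpret int_min_poly p l by unfold_locales (rule assms(1))
  show ?thesis
  proof (cases "l = 0")
    \<comment> \<open>Reflection of \<open>p\<close> requires a nonzero \<open>l\<close>. Here p is
      x up to sign, the leading constant is 1 and A + 0 A = A.\<close>
    case True
    have X: "ieval (monom 1 1) l = 0" using True by simp
    have "degree p \<le> 1" using degree_le[of "monom 1 1"] X by (simp add: degree_monom_eq)
    then have d1: "d = 1" using degree_pos assms(2) by simp
    have "lead_coeff p dvd 1" using lead_coeff_dvd[OF X] by (simp add: degree_monom_eq)
    then have lc: "\<bar>coeff p d\<bar> = 1" using assms(2) by simp
    have "coeff p 0 = 0"
      using ieval_p True by (simp add: poly_0_coeff_0 coeff_map_poly)
    then have H: "?H = 1"
      using lc d1 by (simp flip: of_int_abs)
    have "sum_dil A l = A" for A using True by (auto simp: sum_dil_def)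
    with H show ?thesis by (intro exI[of _ 1] conjI allI impI) auto
  next
    case False
    obtain D \<sigma> where D: "D > 0" "\<sigma> > 0" and bound: "\<And>A. finite A \<Longrightarrow> A \<subseteq> K \<Longrightarrow>
      ?H * real (card A) - D * real (card A) powr (1 - \<sigma>) \<le> real (card (A + dil l A))"
      using card_sum_dil_ge[OF False] unfolding assms(2) by blast
    have "?H * real (card A) - D * real (card A) powr (1 - \<sigma>) \<le> real (card (sum_dil A l))" if A: "finite A" for A
    proof -
      obtain B where B: "B \<subseteq> K" "finite B" "card B = card A" "card (B + dil l B) \<le> card (A + dil l A)"
        using ex_model_in_K[OF A] by blast
      from bound[OF B(2,1)] B(3,4) show ?thesis unfolding sum_dil_eq by simp
    qed
    with D show ?thesis by blast
  qed
qed

end
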